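(* Let $G$ be of type $\mathrm{G}_2$ with $I=\{1,2\}$ and Cartan matrix satisfying $a_{2,1}=-3$, $a_{1,2}=-1$, so that $N=6$. Let $\mathbf{i}=(i_1,\dots,i_6)$ be a reduced word of the longest element $w_0$, i.e. $\mathbf{i}=(1,2,1,2,1,2)$ or $\mathbf{i}=(2,1,2,1,2,1)$, and let $i\in I$. Let $k\in[1,N]$ be such that $s_{i_N}s_{i_{N-1}}\cdots s_{i_{k+1}}\alpha_{i_k}=\alpha_i$. Then the following algorithm stops after finitely many steps, and the set of monomials appearing in $\Delta_{w_0\Lambda_i,s_i\Lambda_i}\circ\theta^-_{\mathbf{i}}(t_1,\dots,t_N)$ coincides with the set of Laurent monomials labelling the vertices of the directed graph $\overline{DG}$ that it produces. (1) Let $\overline{DG}_0$ be the graph with the single vertex $t_k$ and no arrow. Associate to the monomial $t_k$ the integer vector $(b^0_1,\dots,b^0_N)$ given by $b^0_t=\langle h_{i_t},s_{i_{t+1}}\cdots s_{i_N}s_i\Lambda_i\rangle$ for $k<t\le N$, $b^0_k=0$, and $b^0_t=\langle h_{i_t},s_{i_{t+1}}\cdots s_{i_N}\Lambda_i\rangle$ for $1\le t<k$. (2) For each sink $M=\prod_{j=1}^N t_j^{d_j}$ of $\overline{DG}_l$, with associated vector $(b_1,\dots,b_N)$, and for each $j\in[1,N]$ with $j^+\le N$, add a vertex $M\cdot A_j^{-1}$ and an arrow $M\to M\cdot A_j^{-1}$ to $\overline{DG}_l$ if and only if $d_j>0$, $b_{j^+}>0$ and one of the following holds: (a) $d_{j^+}<d_j$;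 (b) $d_{j^+}=d_j$ and there exists $p\in\mathbb{Z}_{\ge 2}$ with $j^{p+}\le N$ such that $d_{j^{m+}}=b_{j^{m+}}=0$ for $m=2,\dots,p-1$, and $d_{j^{p+}}=-1$, $b_{j^{p+}}=1$. Associate to $M\cdot A_j^{-1}$ the integers $(b'_1,\dots,b'_N)$ defined by $b'_s=b_s$ for $s\in[1,N]\setminus\{j,j^+\}$, $b'_j=b_j+1$, $b'_{j^+}=b_{j^+}-1$. Equal monomials obtained from different sinks define the same vertex. Let $\overline{DG}_{l+1}$ be the directed graph obtained by this step. (3) If no sink $M$ of $\overline{DG}_r$ (with any $j$) satisfies the condition in (2), stop and set $\overline{DG}=\overline{DG}_r$.
   Context: $G$ is a simply connected connected simple algebraic group over $\mathbb{C}$ with opposite Borel subgroups $B,B^-$, unipotent radicals $U,U^-$, maximal torus $T=B\cap B^-$, Weyl group $W=\mathrm{Norm}_G(T)/T$ with simple reflections $s_i$ ($i\in I$), longest element $w_0$ and $N=l(w_0)$. $\mathfrak{g}=\mathrm{Lie}(G)$ has Chevalley generators $e_i,f_i,h_i$, simple roots $\alpha_i$, fundamental weights $\Lambda_i$ ($\langle h_j,\Lambda_i\rangle=\delta_{ij}$), and Cartan matrix $a_{i,j}=\langle h_i,\alpha_j\rangle$. Write $[1,N]=\{1,\dots,N\}$. Put $x_i(t)=\exp(te_i)$, $y_i(t)=\exp(tf_i)$, $x_{-i}(t)=y_i(t)\,t^{-h_i}$, where $t^{h_i}=\phi_i(\mathrm{diag}(t,t^{-1}))$ and $\phi_i:SL_2(\mathbb{C})\to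 G$ is the canonical homomorphism for index $i$. For a reduced word $\mathbf{i}=(i_1,\dots,i_N)$ of $w_0$ put $\theta^-_{\mathbf{i}}(t_1,\dots,t_N)=x_{-i_1}(t_1)\cdots x_{-i_N}(t_N)$ for $t_l\in\mathbb{C}^\times$. Put $\overline{s_i}=x_i(-1)y_i(1)x_i(-1)$ and $\overline{uv}=\overline{u}\cdot\overline{v}$ whenever $l(uv)=l(u)+l(v)$. Every $x\in G_0=U^-TU$ is uniquely $x=[x]_-[x]_0[x]_+$ with $[x]_-\in U^-$, $[x]_0\in T$, $[x]_+\in U$. For $u,v\in W$, the generalized minor $\Delta_{u\Lambda_i,v\Lambda_i}$ is the regular function on $G$ with $\Delta_{u\Lambda_i,v\Lambda_i}(x)=([\overline{u}^{-1}x\overline{v}]_0)^{\Lambda_i}$ for $x\in\overline{u}G_0\overline{v}^{-1}$, where $\tau\mapsto\tau^{\Lambda_i}$ is the character of $T$ with $(t^{h_j})^{\Lambda_i}=t^{\Lambda_i(h_j)}$. The function $\Delta_{w_0\Lambda_i,s_i\Lambda_i}\circ\theta^-_{\mathbf{i}}(t_1,\dots,t_N)$ is a Laurent polynomial with nonnegative integer coefficients; its set of monomials is the set of Laurent monomials $\prod_l t_l^{d_l}$ occurring with nonzero coefficient. For $j\in[1,N]$: $j^+=\min(\{l\in[1,N]: i_l=i_j,\ l>j\}\cup\{N+1\})$; $j^{0+}=j$, $j^{m+}=(j^{(m-1)+})^+$ for $m\ge1$, with $(N+1)^+=N+1$. For $j$ with $j^+\le N$, $A_j=t_jt_{j^+}\prod_{j<l<j^+}t_l^{a_{i_l,i_j}}$.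 A sink of a directed graph is a vertex with no outgoing arrow. *)

theory Defs
  imports
    "HOL-Analysis.Analysis"
    "HOL-Algebra.Solvable_Groups"
    "HOL-Algebra.Group_Action"
begin

section \<open>Linear algebraic groups over the complex numbers\<close>

text \<open>
  Every affine algebraic group over the complex numbers is isomorphic to a Zariski closed
  subgroup of some general linear group, so algebraic groups are rendered as such subgroups;
  the size of the matrices is the (arbitrary) index type \<open>'n\<close>.
\<close>

type_synonym 'n cmat = "complex ^ 'n ^ 'n"

definition GL :: "('n::finite cmat) monoid" where
  "GL = \<lparr>carrier = {g. invertible g}, mult = (**), one = mat 1\<rparr>"

definition SL :: "('n::finite cmat) monoid" where
  "SL = \<lparr>carrier = {g. det g = 1}, mult = (**), one = mat 1\<rparr>"

abbreviation as_group :: "('n::finite cmat) set \<Rightarrow> ('n cmat) monoid" where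
  "as_group H \<equiv> GL\<lparr>carrier := H\<rparr>"

inductive_set poly_fun :: "('n::finite cmat \<Rightarrow> complex) set" where
  const: "(\<lambda>g. c) \<in> poly_fun"
| entry: "(\<lambda>g. g $ r $ s) \<in> poly_fun"
| add: "p \<in> poly_fun \<Longrightarrow> q \<in> poly_fun \<Longrightarrow> (\<lambda>g. p g + q g) \<in> poly_fun"
| mult: "p \<in> poly_fun \<Longrightarrow> q \<in> poly_fun \<Longrightarrow> (\<lambda>g. p g * q g) \<in> poly_fun"

text \<open>The coordinate ring of a closed subset of the general linear group consists of the
  restrictions of polynomials in the matrix entries and the inverse of the determinant.\<close>

definition regular_on :: "('n::finite cmat) set \<Rightarrow> ('n cmat \<Rightarrow> complex) \<Rightarrow> bool" where
  "regular_on H f \<longleftrightarrow> (\<exists>p\<in>poly_fun. \<exists>k::nat. \<forall>g\<in>H. f g = p g / det g ^ k)"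

definition zariski_closed :: "('n::finite cmat) set \<Rightarrow> bool" where
  "zariski_closed S \<longleftrightarrow> (\<exists>P\<subseteq>poly_fun. S = {g. invertible g \<and> (\<forall>p\<in>P. p g = 0)})"

definition zariski_connected :: "('n::finite cmat) set \<Rightarrow> bool" where
  "zariski_connected S \<longleftrightarrow>
     \<not> (\<exists>C D. zariski_closed C \<and> zariski_closed D \<and> S \<subseteq> C \<union> D \<and> C \<inter> D \<inter> S = {}
            \<and> C \<inter> S \<noteq> {} \<and> D \<inter> S \<noteq> {})"

definition closed_connected_subgroup :: "('n::finite cmat) set \<Rightarrow> bool" where
  "closed_connected_subgroup H \<longleftrightarrow> subgroup H GL \<and> zariski_closed H \<and> zariski_connected H"

definition simple_algebraic_group :: "('n::finite cmat) set \<Rightarrow> bool" where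
  "simple_algebraic_group G \<longleftrightarrow>
     closed_connected_subgroup G \<and> \<not> comm_group (as_group G) \<and>
     (\<forall>H. closed_connected_subgroup H \<and> H \<lhd> as_group G \<longrightarrow> H = {mat 1} \<or> H = G)"

definition solvable_connected_in :: "('n::finite cmat) set \<Rightarrow> ('n cmat) set \<Rightarrow> bool" where
  "solvable_connected_in G H \<longleftrightarrow>
     H \<subseteq> G \<and> closed_connected_subgroup H \<and> solvable (as_group H)"

definition borel_subgroup :: "('n::finite cmat) set \<Rightarrow> ('n cmat) set \<Rightarrow> bool" where
  "borel_subgroup G B \<longleftrightarrow>
     solvable_connected_in G B \<and> (\<forall>H. solvable_connected_in G H \<and> B \<subseteq> H \<longrightarrow> H = B)"

definition diagonalizable_set :: "('n::finite cmat) set \<Rightarrow> bool" where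
  "diagonalizable_set S \<longleftrightarrow>
     (\<exists>P :: 'n cmat. invertible P \<and> (\<forall>g\<in>S. \<forall>r s. r \<noteq> s \<longrightarrow> (P ** g ** matrix_inv P) $ r $ s = 0))"

definition torus_in :: "('n::finite cmat) set \<Rightarrow> ('n cmat) set \<Rightarrow> bool" where
  "torus_in G H \<longleftrightarrow> H \<subseteq> G \<and> closed_connected_subgroup H \<and> diagonalizable_set H"

definition maximal_torus :: "('n::finite cmat) set \<Rightarrow> ('n cmat) set \<Rightarrow> bool" where
  "maximal_torus G T \<longleftrightarrow> torus_in G T \<and> (\<forall>H. torus_in G H \<and> T \<subseteq> H \<longrightarrow> H = T)"

definition unipotent :: "'n::finite cmat \<Rightarrow> bool" where
  "unipotent g \<longleftrightarrow> (\<exists>k. (((**) (g - mat 1)) ^^ k) (mat 1) = 0)"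

definition unipotent_normal_in :: "('n::finite cmat) set \<Rightarrow> ('n cmat) set \<Rightarrow> bool" where
  "unipotent_normal_in H V \<longleftrightarrow>
     closed_connected_subgroup V \<and> V \<lhd> as_group H \<and> (\<forall>g\<in>V. unipotent g)"

definition unipotent_radical :: "('n::finite cmat) set \<Rightarrow> ('n cmat) set \<Rightarrow> bool" where
  "unipotent_radical H V \<longleftrightarrow>
     unipotent_normal_in H V \<and> (\<forall>V'. unipotent_normal_in H V' \<longrightarrow> V' \<subseteq> V)"

definition cscale :: "complex \<Rightarrow> 'n::finite cmat \<Rightarrow> 'n cmat" where
  "cscale c X = (\<chi> r s. c * X $ r $ s)"

definition mexp :: "'n::finite cmat \<Rightarrow> 'n cmat" where
  "mexp X = (\<Sum>k. (1 / fact k) *\<^sub>R (((**) X) ^^ k) (mat 1))"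

definition lie_algebra :: "('n::finite cmat) set \<Rightarrow> ('n cmat) set" where
  "lie_algebra H = {X. \<forall>t. mexp (cscale t X) \<in> H}"

definition bracket :: "'n::finite cmat \<Rightarrow> 'n cmat \<Rightarrow> 'n cmat" where
  "bracket X Y = X ** Y - Y ** X"

definition lie_subalgebra :: "('n::finite cmat) set \<Rightarrow> bool" where
  "lie_subalgebra L \<longleftrightarrow> 0 \<in> L \<and>
     (\<forall>X\<in>L. \<forall>Y\<in>L. X + Y \<in> L \<and> bracket X Y \<in> L) \<and> (\<forall>c. \<forall>X\<in>L. cscale c X \<in> L)"

section \<open>Simple groups with Chevalley generators\<close>

text \<open>Here \<open>cartan D i j\<close> is $\langle h_i,\alpha_j\rangle$ and \<open>phi D i\<close> is the canonical
  homomorphism from $SL_2$ attached to \<open>i\<close>.\<close>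

record ('n::finite) chevalley_data =
  grp :: "'n cmat set"
  borel :: "'n cmat set"
  borel_op :: "'n cmat set"
  unip :: "'n cmat set"
  unip_op :: "'n cmat set"
  torus :: "'n cmat set"
  idx :: "nat set"
  cartan :: "nat \<Rightarrow> nat \<Rightarrow> int"
  gen_e :: "nat \<Rightarrow> 'n cmat"
  gen_f :: "nat \<Rightarrow> 'n cmat"
  gen_h :: "nat \<Rightarrow> 'n cmat"
  phi :: "nat \<Rightarrow> 2 cmat \<Rightarrow> 'n cmat"

definition xplus :: "('n::finite) chevalley_data \<Rightarrow> nat \<Rightarrow> complex \<Rightarrow> 'n cmat" where
  "xplus D i t = mexp (cscale t (gen_e D i))"

definition yminus :: "('n::finite) chevalley_data \<Rightarrow> nat \<Rightarrow> complex \<Rightarrow> 'n cmat" where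
  "yminus D i t = mexp (cscale t (gen_f D i))"

definition chevalley_relations :: "('n::finite) chevalley_data \<Rightarrow> bool" where
  "chevalley_relations D \<longleftrightarrow> (\<forall>i\<in>idx D. \<forall>j\<in>idx D.
     bracket (gen_h D i) (gen_h D j) = 0 \<and>
     bracket (gen_h D i) (gen_e D j) = cscale (of_int (cartan D i j)) (gen_e D j) \<and>
     bracket (gen_h D i) (gen_f D j) = cscale (- of_int (cartan D i j)) (gen_f D j) \<and>
     bracket (gen_e D i) (gen_f D j) = (if i = j then gen_h D i else 0) \<and>
     (i \<noteq> j \<longrightarrow>
        (bracket (gen_e D i) ^^ nat (1 - cartan D i j)) (gen_e D j) = 0 \<and>
        (bracket (gen_f D i) ^^ nat (1 - cartan D i j)) (gen_f D j) = 0))"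

definition canonical_sl2_homs :: "('n::finite) chevalley_data \<Rightarrow> bool" where
  "canonical_sl2_homs D \<longleftrightarrow> (\<forall>i\<in>idx D.
     phi D i \<in> hom SL (as_group (grp D)) \<and>
     (\<forall>r s. regular_on (carrier SL) (\<lambda>A. phi D i A $ r $ s)) \<and>
     (\<forall>t. phi D i (vector [vector [1, t], vector [0, 1]]) = xplus D i t) \<and>
     (\<forall>t. phi D i (vector [vector [1, 0], vector [t, 1]]) = yminus D i t))"

text \<open>\<open>simply_connected\<close> refers to the complex (Euclidean) topology; for semisimple groups over
  the complex numbers this is the algebraic notion.\<close>

definition simply_connected_simple_group :: "('n::finite) chevalley_data \<Rightarrow> bool" where
  "simply_connected_simple_group D \<longleftrightarrow>
     simple_algebraic_group (grp D) \<and> simply_connected (grp D) \<and>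
     borel_subgroup (grp D) (borel D) \<and> borel_subgroup (grp D) (borel_op D) \<and>
     torus D = borel D \<inter> borel_op D \<and> maximal_torus (grp D) (torus D) \<and>
     unipotent_radical (borel D) (unip D) \<and> unipotent_radical (borel_op D) (unip_op D) \<and>
     finite (idx D) \<and> (\<forall>i\<in>idx D. cartan D i i = 2) \<and>
     (\<forall>i\<in>idx D. gen_e D i \<in> lie_algebra (unip D) \<and> gen_f D i \<in> lie_algebra (unip_op D)
               \<and> gen_h D i \<in> lie_algebra (torus D)) \<and>
     chevalley_relations D \<and>
     lie_algebra (grp D) =
       \<Inter>{L. lie_subalgebra L \<and> gen_e D ` idx D \<union> gen_f D ` idx D \<union> gen_h D ` idx D \<subseteq> L} \<and>
     canonical_sl2_homs D"

text \<open>\<open>tpow D i t\<close> is $t^{h_i}$, and \<open>xminus D i t\<close> is $x_{-i}(t)$.\<close>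

definition tpow :: "('n::finite) chevalley_data \<Rightarrow> nat \<Rightarrow> complex \<Rightarrow> 'n cmat" where
  "tpow D i t = phi D i (vector [vector [t, 0], vector [0, inverse t]])"

definition xminus :: "('n::finite) chevalley_data \<Rightarrow> nat \<Rightarrow> complex \<Rightarrow> 'n cmat" where
  "xminus D i t = yminus D i t ** tpow D i (inverse t)"

text \<open>Words and exponent vectors are indexed from 1; \<open>letter iw l\<close> is $i_l$.\<close>

definition letter :: "nat list \<Rightarrow> nat \<Rightarrow> nat" where
  "letter iw l = iw ! (l - 1)"

definition theta_minus ::
    "('n::finite) chevalley_data \<Rightarrow> nat list \<Rightarrow> (nat \<Rightarrow> complex) \<Rightarrow> 'n cmat" where
  "theta_minus D iw t =
     foldr (\<lambda>l X. xminus D (letter iw l) (t l) ** X) [1..<Suc (length iw)] (mat 1)"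

section \<open>The Weyl group and generalized minors\<close>

definition weyl_group :: "('n::finite) chevalley_data \<Rightarrow> ('n cmat set) monoid" where
  "weyl_group D = as_group (normalizer (as_group (grp D)) (torus D)) Mod torus D"

definition s_bar :: "('n::finite) chevalley_data \<Rightarrow> nat \<Rightarrow> 'n cmat" where
  "s_bar D i = xplus D i (-1) ** yminus D i 1 ** xplus D i (-1)"

definition simple_reflection :: "('n::finite) chevalley_data \<Rightarrow> nat \<Rightarrow> 'n cmat set" where
  "simple_reflection D i = torus D #>\<^bsub>GL\<^esub> s_bar D i"

definition word_prod :: "('n::finite) chevalley_data \<Rightarrow> nat list \<Rightarrow> 'n cmat set" where
  "word_prod D iw =
     foldr (\<lambda>i w. simple_reflection D i \<otimes>\<^bsub>weyl_group D\<^esub> w) iw \<one>\<^bsub>weyl_group D\<^esub>"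

definition weyl_length :: "('n::finite) chevalley_data \<Rightarrow> 'n cmat set \<Rightarrow> nat" where
  "weyl_length D w = (LEAST n. \<exists>iw. set iw \<subseteq> idx D \<and> length iw = n \<and> word_prod D iw = w)"

definition reduced_word :: "('n::finite) chevalley_data \<Rightarrow> nat list \<Rightarrow> 'n cmat set \<Rightarrow> bool" where
  "reduced_word D iw w \<longleftrightarrow>
     set iw \<subseteq> idx D \<and> word_prod D iw = w \<and> length iw = weyl_length D w"

definition longest_element :: "('n::finite) chevalley_data \<Rightarrow> 'n cmat set \<Rightarrow> bool" where
  "longest_element D w \<longleftrightarrow> w \<in> carrier (weyl_group D) \<and>
     (\<forall>v\<in>carrier (weyl_group D). weyl_length D v \<le> weyl_length D w)"

text \<open>The map $w \mapsto \overline{w}$ is the unique one satisfying this predicate.\<close>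

definition canonical_representatives ::
    "('n::finite) chevalley_data \<Rightarrow> ('n cmat set \<Rightarrow> 'n cmat) \<Rightarrow> bool" where
  "canonical_representatives D rep \<longleftrightarrow>
     (\<forall>w\<in>carrier (weyl_group D). rep w \<in> w) \<and>
     (\<forall>i\<in>idx D. rep (simple_reflection D i) = s_bar D i) \<and>
     (\<forall>u\<in>carrier (weyl_group D). \<forall>v\<in>carrier (weyl_group D).
        weyl_length D (u \<otimes>\<^bsub>weyl_group D\<^esub> v) = weyl_length D u + weyl_length D v \<longrightarrow>
        rep (u \<otimes>\<^bsub>weyl_group D\<^esub> v) = rep u ** rep v)"

text \<open>A weight $\mu$ is represented by its coordinates \<open>\<mu> j\<close> $= \langle h_j,\mu\rangle$
  for \<open>j\<close> in the index set (these determine it).\<close>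

type_synonym weight = "nat \<Rightarrow> int"

definition simple_root :: "(nat \<Rightarrow> nat \<Rightarrow> int) \<Rightarrow> nat \<Rightarrow> weight" where
  "simple_root a i = (\<lambda>j. a j i)"

definition fundamental_weight :: "nat \<Rightarrow> weight" where
  "fundamental_weight i = (\<lambda>j. if j = i then 1 else 0)"

definition reflect :: "(nat \<Rightarrow> nat \<Rightarrow> int) \<Rightarrow> nat \<Rightarrow> weight \<Rightarrow> weight" where
  "reflect a i \<mu> = (\<lambda>j. \<mu> j - \<mu> i * simple_root a i j)"

definition reflect_word :: "(nat \<Rightarrow> nat \<Rightarrow> int) \<Rightarrow> nat list \<Rightarrow> weight \<Rightarrow> weight" where
  "reflect_word a ws \<mu> = foldr (reflect a) ws \<mu>"

definition weight_character ::
    "('n::finite) chevalley_data \<Rightarrow> weight \<Rightarrow> ('n cmat \<Rightarrow> complex) \<Rightarrow> bool" where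
  "weight_character D \<mu> \<xi> \<longleftrightarrow> regular_on (torus D) \<xi> \<and>
     (\<forall>x\<in>torus D. \<forall>y\<in>torus D. \<xi> (x ** y) = \<xi> x * \<xi> y) \<and> (\<forall>x\<in>torus D. \<xi> x \<noteq> 0) \<and>
     (\<forall>j\<in>idx D. \<forall>t. t \<noteq> 0 \<longrightarrow> \<xi> (tpow D j t) = t powi \<mu> j)"

definition big_cell :: "('n::finite) chevalley_data \<Rightarrow> 'n cmat set" where
  "big_cell D = {y ** \<tau> ** x | y \<tau> x. y \<in> unip_op D \<and> \<tau> \<in> torus D \<and> x \<in> unip D}"

definition torus_part :: "('n::finite) chevalley_data \<Rightarrow> 'n cmat \<Rightarrow> 'n cmat" where
  "torus_part D g = (THE \<tau>. \<tau> \<in> torus D \<and> (\<exists>y\<in>unip_op D. \<exists>x\<in>unip D. g = y ** \<tau> ** x))"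

text \<open>\<open>\<Delta>\<close> is the generalized minor $\Delta_{u\Lambda_i,v\Lambda_i}$; this determines its values on
  the group, since the translate of the big cell is dense there.\<close>

definition generalized_minor ::
    "('n::finite) chevalley_data \<Rightarrow> ('n cmat set \<Rightarrow> 'n cmat) \<Rightarrow> 'n cmat set \<Rightarrow> 'n cmat set
       \<Rightarrow> nat \<Rightarrow> ('n cmat \<Rightarrow> complex) \<Rightarrow> bool" where
  "generalized_minor D rep u v i \<Delta> \<longleftrightarrow> regular_on (grp D) \<Delta> \<and>
     (\<exists>\<xi>. weight_character D (fundamental_weight i) \<xi> \<and>
        (\<forall>x \<in> (\<lambda>g. rep u ** g ** matrix_inv (rep v)) ` big_cell D.
           \<Delta> x = \<xi> (torus_part D (matrix_inv (rep u) ** x ** rep v))))"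

section \<open>Laurent monomials\<close>

text \<open>The Laurent monomial $\prod_{l=1}^N t_l^{d_l}$ is represented by its exponent vector \<open>d\<close>,
  which vanishes outside \<open>{1..N}\<close>.\<close>

type_synonym ivec = "nat \<Rightarrow> int"

definition laurent_expansion ::
    "nat \<Rightarrow> ((nat \<Rightarrow> complex) \<Rightarrow> complex) \<Rightarrow> (ivec \<Rightarrow> complex) \<Rightarrow> bool" where
  "laurent_expansion N F c \<longleftrightarrow>
     finite {d. c d \<noteq> 0} \<and> (\<forall>d. c d \<noteq> 0 \<longrightarrow> (\<forall>l. l \<notin> {1..N} \<longrightarrow> d l = 0)) \<and>
     (\<forall>t. (\<forall>l\<in>{1..N}. t l \<noteq> 0) \<longrightarrow> F t = (\<Sum>d | c d \<noteq> 0. c d * (\<Prod>l=1..N. t l powi d l)))"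

text \<open>The expansion of a Laurent polynomial function is unique, so the following is the set of
  monomials occurring with nonzero coefficient.\<close>

definition laurent_monomials :: "nat \<Rightarrow> ((nat \<Rightarrow> complex) \<Rightarrow> complex) \<Rightarrow> ivec set" where
  "laurent_monomials N F = {d. \<exists>c. laurent_expansion N F c \<and> c d \<noteq> 0}"

section \<open>The algorithm\<close>

definition next_pos :: "nat list \<Rightarrow> nat \<Rightarrow> nat" where
  "next_pos iw j =
     Min ({l \<in> {1..length iw}. letter iw l = letter iw j \<and> l > j} \<union> {length iw + 1})"

definition A_vec :: "(nat \<Rightarrow> nat \<Rightarrow> int) \<Rightarrow> nat list \<Rightarrow> nat \<Rightarrow> ivec" where
  "A_vec a iw j = (\<lambda>l.
     if l = j \<or> l = next_pos iw j then 1
     else if j < l \<and> l < next_pos iw j then a (letter iw l) (letter iw j) else 0)"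

text \<open>The vertices are the Laurent monomials themselves, so equal monomials are the same vertex;
  \<open>assoc\<close> relates a vertex to its associated integer vector.\<close>

record monomial_graph =
  verts :: "ivec set"
  arrows :: "(ivec \<times> ivec) set"
  assoc :: "(ivec \<times> ivec) set"

definition sinks :: "monomial_graph \<Rightarrow> ivec set" where
  "sinks \<Gamma> = {M \<in> verts \<Gamma>. \<forall>M'. (M, M') \<notin> arrows \<Gamma>}"

definition initial_b :: "(nat \<Rightarrow> nat \<Rightarrow> int) \<Rightarrow> nat list \<Rightarrow> nat \<Rightarrow> nat \<Rightarrow> ivec" where
  "initial_b a iw i k = (\<lambda>t.
     if k < t \<and> t \<le> length iw then
       reflect_word a (drop t iw) (reflect a i (fundamental_weight i)) (letter iw t)
     else if 1 \<le> t \<and> t < k then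
       reflect_word a (drop t iw) (fundamental_weight i) (letter iw t)
     else 0)"

definition initial_graph :: "(nat \<Rightarrow> nat \<Rightarrow> int) \<Rightarrow> nat list \<Rightarrow> nat \<Rightarrow> nat \<Rightarrow> monomial_graph" where
  "initial_graph a iw i k =
     (let M = (\<lambda>l. if l = k then 1 else 0)
      in \<lparr>verts = {M}, arrows = {}, assoc = {(M, initial_b a iw i k)}\<rparr>)"

definition move_cond :: "nat list \<Rightarrow> ivec \<Rightarrow> ivec \<Rightarrow> nat \<Rightarrow> bool" where
  "move_cond iw d b j \<longleftrightarrow>
     d j > 0 \<and> b (next_pos iw j) > 0 \<and>
     (d (next_pos iw j) < d j \<or>
      d (next_pos iw j) = d j \<and>
      (\<exists>p\<ge>2. (next_pos iw ^^ p) j \<le> length iw \<and>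
         (\<forall>m\<in>{2..p-1}. d ((next_pos iw ^^ m) j) = 0 \<and> b ((next_pos iw ^^ m) j) = 0) \<and>
         d ((next_pos iw ^^ p) j) = -1 \<and> b ((next_pos iw ^^ p) j) = 1))"

definition moves :: "nat list \<Rightarrow> monomial_graph \<Rightarrow> (ivec \<times> ivec \<times> nat) set" where
  "moves iw \<Gamma> = {(M, b, j). M \<in> sinks \<Gamma> \<and> (M, b) \<in> assoc \<Gamma> \<and>
     j \<in> {1..length iw} \<and> next_pos iw j \<le> length iw \<and> move_cond iw M b j}"

definition target :: "(nat \<Rightarrow> nat \<Rightarrow> int) \<Rightarrow> nat list \<Rightarrow> ivec \<Rightarrow> nat \<Rightarrow> ivec" where
  "target a iw M j = (\<lambda>l. M l - A_vec a iw j l)"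

definition target_b :: "nat list \<Rightarrow> ivec \<Rightarrow> nat \<Rightarrow> ivec" where
  "target_b iw b j = b(j := b j + 1, next_pos iw j := b (next_pos iw j) - 1)"

definition step :: "(nat \<Rightarrow> nat \<Rightarrow> int) \<Rightarrow> nat list \<Rightarrow> monomial_graph \<Rightarrow> monomial_graph" where
  "step a iw \<Gamma> = \<lparr>
     verts = verts \<Gamma> \<union> {target a iw M j | M b j. (M, b, j) \<in> moves iw \<Gamma>},
     arrows = arrows \<Gamma> \<union> {(M, target a iw M j) | M b j. (M, b, j) \<in> moves iw \<Gamma>},
     assoc = assoc \<Gamma> \<union> {(target a iw M j, target_b iw b j) | M b j. (M, b, j) \<in> moves iw \<Gamma>}\<rparr>"

definition DG :: "(nat \<Rightarrow> nat \<Rightarrow> int) \<Rightarrow> nat list \<Rightarrow> nat \<Rightarrow> nat \<Rightarrow> nat \<Rightarrow> monomial_graph" where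
  "DG a iw i k l = (step a iw ^^ l) (initial_graph a iw i k)"

definition stops_at :: "(nat \<Rightarrow> nat \<Rightarrow> int) \<Rightarrow> nat list \<Rightarrow> nat \<Rightarrow> nat \<Rightarrow> nat \<Rightarrow> bool" where
  "stops_at a iw i k r \<longleftrightarrow> moves iw (DG a iw i k r) = {}"

definition DG_final :: "(nat \<Rightarrow> nat \<Rightarrow> int) \<Rightarrow> nat list \<Rightarrow> nat \<Rightarrow> nat \<Rightarrow> monomial_graph" where
  "DG_final a iw i k = DG a iw i k (LEAST r. stops_at a iw i k r)"

end

theory Submission
  imports Defs "HOL-Complex_Analysis.Conformal_Mappings" "HOL-Algebra.Zassenhaus"
begin

text \<open>
  The minor is the value of an additive character. In \<open>SL\<^sub>2\<close> the element \<open>x_{-i}(t)\<close> equals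
  \<open>x_i(1/t) s_i x_i(t)\<close>, where \<open>s_i\<close> also denotes the representative of the simple reflection. Multiply
  the factors of \<open>\<theta>\<close> one after the other. Whenever a positive unipotent element \<open>u\<close> meets the next
  factor, \<open>u x_{-i}(t) = s_i y_i(a) u'\<close> for a number \<open>a\<close> and another positive unipotent element \<open>u'\<close>.
  The word being reduced, the factors \<open>y_i(a)\<close> can be moved to the right of all reflections without
  leaving the negative unipotent group, so that \<open>\<theta> = w y u\<close> with \<open>w\<close> the representative of the longest
  element, \<open>y\<close> negative and \<open>u\<close> positive unipotent (\<open>factorization\<close>). If \<open>c\<close> denotes the coefficient of the
  simple root vector \<open>e_i\<close> in \<open>u\<close>, then \<open>u s_i\<close> lies in the product of the negative unipotent group, the
  torus element \<open>c\<^sup>h\<close> and the positive unipotent group (\<open>coord_big_cell\<close>), so the minor takes the value \<open>c\<close> at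
  \<open>\<theta>\<close> (\<open>minor_on_positive\<close>).

  To find \<open>c\<close>, the positive unipotent group is written as a one-parameter group times a Heisenberg
  group of dimension five (\<open>g2_serre\<close>), and \<open>u \<mapsto> u'\<close> becomes an explicit rational map on six
  coordinates (\<open>coord_xm_one\<close>, \<open>coord_xm_two\<close>). If \<open>i\<close> is the last letter of the word, then \<open>c\<close> is the last
  parameter. Otherwise it is a Laurent polynomial with positive coefficients, with 13 terms for
  the long simple root (\<open>coord_one\<close>) and 6 terms for the short one (\<open>coord_two\<close>).

  All this is done for positive parameters, where only real exponentials occur and \<open>c\<close> does not
  vanish; regular functions of \<open>\<theta>\<close> are holomorphic in each parameter, so the formula extends to all
  nonzero ones (\<open>extend_from_positive\<close>). Laurent expansions are unique
  (\<open>laurent_expansion_unique\<close>), hence the monomials can be read off. On the other side the algorithm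
  is run on lists of integers (\<open>run_one\<close>, \<open>run_two\<close>) and yields the same monomials.
\<close>

unbundle no fps_syntax

section \<open>Exponentials in a Banach algebra\<close>

definition br :: "'a::ring \<Rightarrow> 'a \<Rightarrow> 'a" where
  "br X Y = X * Y - Y * X"

lemma br_add: "br (X + X') Y = br X Y + br X' Y" "br X (Y + Y') = br X Y + br X Y'"
  by (simp_all add: br_def algebra_simps)

lemma br_diff: "br (X - X') Y = br X Y - br X' Y" "br X (Y - Y') = br X Y - br X Y'"
  by (simp_all add: br_def algebra_simps)

lemma br_uminus: "br (- X) Y = - br X Y" "br X (- Y) = - br X Y"
  by (simp_all add: br_def algebra_simps)

lemma br_scaleR:
  fixes X Y :: "'a::real_algebra"
  shows "br (c *\<^sub>R X) Y = c *\<^sub>R br X Y" "br X (c *\<^sub>R Y) = c *\<^sub>R br X Y"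
  by (simp_all add: br_def algebra_simps)

lemma br_zero: "br 0 Y = 0" "br X 0 = 0" and br_self: "br X X = 0"
  by (simp_all add: br_def)

lemma br_swap: "br Y X = - br X Y"
  by (simp add: br_def)

lemma br_jacobi: "br X (br Y Z) = br (br X Y) Z + br Y (br X Z)"
  by (simp add: br_def algebra_simps)

lemmas br_linear = br_add br_diff br_uminus br_scaleR br_zero br_self

text \<open>
  For invertible \<open>A\<close> this says that conjugation commutes with the exponential. In this
  inverse-free form it moves an exponential from one side of a group element to the other.
\<close>

lemma exp_intertwine:
  fixes A X Y :: "'a::{real_normed_algebra_1,banach}"
  assumes "A * X = Y * A"
  shows "A * exp X = exp Y * A"
proof -
  have p: "A * X ^ n = Y ^ n * A" for n
  proof (induction n)
    case (Suc n)
    have "A * X ^ Suc n = (Y * A) * X ^ n" by (simp add: assms[symmetric] mult.assoc)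
    also have "\<dots> = Y ^ Suc n * A" using Suc by (simp add: mult.assoc)
    finally show ?case .
  qed simp
  show ?thesis
    unfolding exp_def
    by (simp add: suminf_mult[symmetric] suminf_mult2 summable_exp_generic p)
qed

lemma exp_commute:
  fixes A X :: "'a::{real_normed_algebra_1,banach}"
  shows "br A X = 0 \<Longrightarrow> A * exp X = exp X * A"
  by (rule exp_intertwine) (simp add: br_def)

text \<open>
  The formula for \<open>exp (ad (s X)) Y\<close> when \<open>(ad X)\<^sup>4 Y = 0\<close>, which covers all root strings in
  type G2. Transporting the right-hand polynomial back by \<open>exp (- s X)\<close> gives a function of \<open>s\<close>
  with derivative zero.
\<close>

lemma exp_conj_nilpotent:
  fixes X Y :: "'a::{real_normed_algebra_1,banach}"
  assumes "br X Y = Y1" "br X Y1 = Y2" "br X Y2 = Y3" "br X Y3 = 0"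
  shows "exp (s *\<^sub>R X) * Y = (Y + s *\<^sub>R Y1 + (s\<^sup>2/2) *\<^sub>R Y2 + (s^3/6) *\<^sub>R Y3) * exp (s *\<^sub>R X)"
proof -
  define P where "P s = Y + s *\<^sub>R Y1 + (s\<^sup>2/2) *\<^sub>R Y2 + (s^3/6) *\<^sub>R Y3" for s :: real
  define P' where "P' s = Y1 + s *\<^sub>R Y2 + (s\<^sup>2/2) *\<^sub>R Y3" for s :: real
  define g where "g s = exp (s *\<^sub>R (- X)) * (P s * exp (s *\<^sub>R X))" for s
  have dP: "(P has_vector_derivative P' s) (at s)" for s
  proof -
    have q: "((\<lambda>s::real. s\<^sup>2/2) has_real_derivative s) (at s)"
      "((\<lambda>s::real. s^3/6) has_real_derivative s\<^sup>2/2) (at s)"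
      "((\<lambda>s::real. s) has_real_derivative 1) (at s)"
      by (auto intro!: derivative_eq_intros)
    have "(P has_vector_derivative 0 + (s *\<^sub>R 0 + 1 *\<^sub>R Y1) + ((s\<^sup>2/2) *\<^sub>R 0 + s *\<^sub>R Y2)
        + ((s^3/6) *\<^sub>R 0 + (s\<^sup>2/2) *\<^sub>R Y3)) (at s)"
      unfolding P_def
      by (intro has_vector_derivative_add has_vector_derivative_scaleR q has_vector_derivative_const)
    thus ?thesis by (simp add: P'_def)
  qed
  have brP: "br X (P s) = P' s" for s
    unfolding P_def P'_def by (simp add: br_linear assms)
  have "(g has_vector_derivative 0) (at s)" for s
  proof -
    have "(g has_vector_derivative
        exp (s *\<^sub>R (- X)) * (P s * (X * exp (s *\<^sub>R X)) + P' s * exp (s *\<^sub>R X)) +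
        (exp (s *\<^sub>R (-X)) * (- X)) * (P s * exp (s *\<^sub>R X))) (at s)"
      unfolding g_def
      by (intro has_vector_derivative_mult exp_scaleR_has_vector_derivative_right dP
            exp_scaleR_has_vector_derivative_left)
    also have "exp (s *\<^sub>R (- X)) * (P s * (X * exp (s *\<^sub>R X)) + P' s * exp (s *\<^sub>R X)) +
        (exp (s *\<^sub>R (-X)) * (- X)) * (P s * exp (s *\<^sub>R X)) = exp (s *\<^sub>R (-X)) * ((P' s - br X (P s)) * exp (s *\<^sub>R X))"
      by (simp add: br_def algebra_simps)
    finally show ?thesis by (simp add: brP)
  qed
  then obtain c where c: "\<And>s. g s = c"
    using has_vector_derivative_zero_constant[of UNIV g] by auto
  have "g s = Y" using c[of 0] c[of s] by (simp add: g_def P_def)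
  hence "exp (s *\<^sub>R X) * Y = (exp (s *\<^sub>R X) * exp (- (s *\<^sub>R X))) * (P s * exp (s *\<^sub>R X))"
    by (simp add: g_def mult.assoc)
  thus ?thesis by (simp add: P_def exp_minus_inverse)
qed

text \<open>
  The Baker-Campbell-Hausdorff formula for a central commutator: the quotient of
  \<open>exp (t A) exp (t B)\<close> and \<open>exp (t (A + B) + t\<^sup>2 C / 2)\<close> is constant in \<open>t\<close>.
\<close>

lemma exp_add_central:
  fixes A B :: "'a::{real_normed_algebra_1,banach}"
  assumes C: "br A B = C" and AC: "br A C = 0" and BC: "br B C = 0"
  shows "exp A * exp B = exp (A + B + (1/2) *\<^sub>R C)"
proof -
  define g where "g t = exp (t *\<^sub>R (- (A + B))) * (exp (t *\<^sub>R A) * exp (t *\<^sub>R B))" for t :: real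
  define k where "k t = exp ((t\<^sup>2) *\<^sub>R ((-1/2) *\<^sub>R C)) * g t" for t :: real
  have comm: "C * A = A * C" "C * B = B * C" using AC BC by (auto simp: br_def)
  have dk1: "((\<lambda>t. exp (t\<^sup>2 *\<^sub>R ((-1/2) *\<^sub>R C))) has_vector_derivative
      (2 * t) *\<^sub>R (exp (t\<^sup>2 *\<^sub>R ((-1/2) *\<^sub>R C)) * ((-1/2) *\<^sub>R C))) (at t)" for t :: real
  proof -
    have "((\<lambda>t::real. t\<^sup>2) has_vector_derivative (2 * t)) (at t)"
      unfolding has_real_derivative_iff_has_vector_derivative[symmetric]
      by (auto intro!: derivative_eq_intros)
    from vector_diff_chain_at[OF this exp_scaleR_has_vector_derivative_right[of "(-1/2) *\<^sub>R C"]]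
    show ?thesis by (simp add: o_def)
  qed
  have "(k has_vector_derivative 0) (at t)" for t
  proof -
    let ?EA = "exp (t *\<^sub>R A)" and ?EB = "exp (t *\<^sub>R B)" and ?ES = "exp (t *\<^sub>R (- (A + B)))"
      and ?EC = "exp (t\<^sup>2 *\<^sub>R ((-1/2) *\<^sub>R C))"
    have d: "(k has_vector_derivative
       ?EC * (?ES * (?EA * (B * ?EB) + (A * ?EA) * ?EB) + (?ES * (-(A + B))) * (?EA * ?EB))
       + (2 * t) *\<^sub>R (?EC * ((-1/2) *\<^sub>R C)) * (?ES * (?EA * ?EB))) (at t)"
      unfolding k_def g_def
      by (intro has_vector_derivative_mult exp_scaleR_has_vector_derivative_right dk1
            exp_scaleR_has_vector_derivative_left)
    have e1: "?EA * B = (B + t *\<^sub>R C) * ?EA"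
      using exp_conj_nilpotent[of A B C 0 0 t] by (simp add: C AC br_linear)
    have e2: "C * ?ES = ?ES * C"
      by (rule exp_commute) (use AC BC in \<open>simp add: br_linear br_swap[of C]\<close>)
    have e1': "?EA * (B * Z) = (B + t *\<^sub>R C) * (?EA * Z)" for Z
      by (simp only: mult.assoc[symmetric] e1)
    have e2': "C * (?ES * Z) = ?ES * (C * Z)" for Z
      by (simp only: mult.assoc[symmetric] e2)
    have e3': "C * (exp (- (t *\<^sub>R A) - t *\<^sub>R B) * Z) = exp (- (t *\<^sub>R A) - t *\<^sub>R B) * (C * Z)" for Z
      using e2'[of Z] by (simp add: algebra_simps)
    have "?EC * (?ES * (?EA * (B * ?EB) + (A * ?EA) * ?EB) + (?ES * (-(A + B))) * (?EA * ?EB))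
       + (2 * t) *\<^sub>R (?EC * ((-1/2) *\<^sub>R C)) * (?ES * (?EA * ?EB)) = 0"
      by (simp add: e1' e3' algebra_simps)
    with d show ?thesis by simp
  qed
  then obtain c where c: "\<And>s. k s = c"
    using has_vector_derivative_zero_constant[of UNIV k] by auto
  have "k 1 = 1" using c[of 0] c[of 1] by (simp add: k_def g_def)
  hence k1: "exp (- ((1/2) *\<^sub>R C)) * (exp (- (A + B)) * (exp A * exp B)) = 1"
    by (simp add: k_def g_def)
  have "exp (A + B) * exp ((1/2) *\<^sub>R C) * (exp (- ((1/2) *\<^sub>R C)) * (exp (- (A + B)) * (exp A * exp B)))
     = exp (A + B) * ((exp ((1/2) *\<^sub>R C) * exp (- ((1/2) *\<^sub>R C))) * exp (- (A + B))) * (exp A * exp B)"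
    by (simp only: mult.assoc)
  also have "\<dots> = exp A * exp B" by (simp only: exp_minus_inverse mult_1_left mult_1_right mult.assoc)
  finally have "exp A * exp B = exp (A + B) * exp ((1/2) *\<^sub>R C)" using k1 by simp
  also have "\<dots> = exp (A + B + (1/2) *\<^sub>R C)"
    by (rule exp_add_commuting[symmetric]) (use comm in \<open>simp add: algebra_simps\<close>)
  finally show ?thesis .
qed

text \<open>
  A vector of weight \<open>w\<close> is scaled by \<open>exp (s w)\<close> under conjugation by \<open>exp (s h)\<close>.
\<close>

lemma exp_weight:
  fixes h X :: "'a::{real_normed_algebra_1,banach}"
  assumes "br h X = w *\<^sub>R X"
  shows "X * exp (- s *\<^sub>R h) = exp (- s *\<^sub>R h) * (exp (s * w) *\<^sub>R X)"
proof -
  have "X * (- s *\<^sub>R h) = (- s *\<^sub>R h + (s * w) *\<^sub>R 1) * X"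
    using arg_cong[OF assms, of "\<lambda>Z. s *\<^sub>R Z"] by (simp add: br_def algebra_simps)
  hence "X * exp (- s *\<^sub>R h) = exp (- s *\<^sub>R h + (s * w) *\<^sub>R 1) * X" by (rule exp_intertwine)
  also have "exp (- s *\<^sub>R h + (s * w) *\<^sub>R 1) = exp (- s *\<^sub>R h) * exp ((s * w) *\<^sub>R 1)"
    by (rule exp_add_commuting) simp
  also have "exp ((s * w) *\<^sub>R 1 :: 'a) = exp (s * w) *\<^sub>R 1"
    using exp_of_real[of "s * w", where 'a='a] by (simp add: of_real_def)
  finally show ?thesis by simp
qed

section \<open>The maximal unipotent subgroup of type G2\<close>

text \<open>
  The positive part of type G2, with \<open>x\<close> the root vector of the long simple root \<open>\<alpha>\<close> and \<open>y\<close> that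
  of the short one \<open>\<beta>\<close>. The divided powers \<open>v\<^sub>k = (ad y)\<^sup>k x / k!\<close> belong to \<open>\<alpha> + k \<beta>\<close> and \<open>\<zeta>\<close> to the highest
  root \<open>2 \<alpha> + 3 \<beta>\<close>. The vectors \<open>x, v1, v2, v3, \<zeta>\<close> span a Heisenberg algebra with centre \<open>\<zeta>\<close>, on
  which \<open>y\<close> acts as on binary cubic forms; this makes the whole unipotent group computable.
\<close>

locale g2_serre =
  fixes x y :: "'a::{real_normed_algebra_1,banach}"
  assumes serre_x: "br x (br x y) = 0"
    and serre_y: "br y (br y (br y (br y x))) = 0"
begin

definition v1 :: 'a where "v1 = br y x"
definition v2 :: 'a where "v2 = (1/2) *\<^sub>R br y v1"
definition v3 :: 'a where "v3 = (1/3) *\<^sub>R br y v2"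
definition \<zeta> :: 'a where "\<zeta> = br x v3"

lemma br_y: "br y x = v1" "br y v1 = 2 *\<^sub>R v2" "br y v2 = 3 *\<^sub>R v3" "br y v3 = 0"
  using serre_y by (simp_all add: v1_def v2_def v3_def br_linear)

text \<open>
  The rest of the bracket table follows from the two Serre relations by applying \<open>ad y\<close> to
  brackets already known. The only subtle entry is \<open>[v1, v3] = 0\<close>: the brackets \<open>[x, v3]\<close> and
  \<open>[v1, v2]\<close> are both multiples of \<open>\<zeta>\<close>, and \<open>ad y\<close> turns them into contradictory values of \<open>[y, \<zeta>]\<close>
  unless it vanishes.
\<close>

lemma br_x: "br x y = - v1" "br x v1 = 0" "br x v2 = 0" "br x v3 = \<zeta>"
  and br_12: "br v1 v2 = (-3) *\<^sub>R \<zeta>" and br_13: "br v1 v3 = 0" and br_23: "br v2 v3 = 0"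
  and br_y\<zeta>: "br y \<zeta> = 0" and br_x\<zeta>: "br x \<zeta> = 0" and br_v\<zeta>: "br v1 \<zeta> = 0" "br v2 \<zeta> = 0" "br v3 \<zeta> = 0"
proof -
  show xy: "br x y = - v1" by (simp add: v1_def br_swap[of y x])
  show x1: "br x v1 = 0" using serre_x by (simp add: xy br_linear)
  show x2: "br x v2 = 0" using br_jacobi[of y x v1] by (simp add: x1 br_y br_linear)
  show x3: "br x v3 = \<zeta>" by (simp add: \<zeta>_def)
  show b12: "br v1 v2 = (-3) *\<^sub>R \<zeta>"
    using br_jacobi[of y x v2] by (simp add: x2 x3 br_y br_linear add_eq_0_iff2)
  have "(-3) *\<^sub>R br y \<zeta> = 3 *\<^sub>R br v1 v3"
    using br_jacobi[of y v1 v2] by (simp add: b12 br_y br_linear)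
  moreover have "br y \<zeta> = br v1 v3" using br_jacobi[of y x v3] by (simp add: x3 br_y br_linear)
  ultimately have "6 *\<^sub>R br v1 v3 = 0"
    using scaleR_add_left[of 3 3 "br v1 v3"] by (simp add: neg_eq_iff_add_eq_0)
  thus b13: "br v1 v3 = 0" by simp
  with \<open>br y \<zeta> = br v1 v3\<close> show y\<zeta>: "br y \<zeta> = 0" by simp
  show b23: "br v2 v3 = 0" using br_jacobi[of y v1 v3] by (simp add: b13 br_y br_linear)
  show x\<zeta>: "br x \<zeta> = 0" using br_jacobi[of x v1 v2] by (simp add: x1 x2 b12 br_linear)
  show z1: "br v1 \<zeta> = 0" using br_jacobi[of y x \<zeta>] by (simp add: x\<zeta> y\<zeta> br_y br_linear)
  show z2: "br v2 \<zeta> = 0" using br_jacobi[of y v1 \<zeta>] by (simp add: z1 y\<zeta> br_y br_linear)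
  show "br v3 \<zeta> = 0" using br_jacobi[of y v2 \<zeta>] by (simp add: z2 y\<zeta> br_y br_linear)
qed

lemmas br_table = br_x br_12 br_13 br_23 br_y\<zeta> br_x\<zeta> br_v\<zeta> br_y
  br_swap[of v1 x] br_swap[of v2 x] br_swap[of v3 x] br_swap[of v2 v1] br_swap[of v3 v1] br_swap[of v3 v2]
  br_swap[of \<zeta> x] br_swap[of \<zeta> v1] br_swap[of \<zeta> v2] br_swap[of \<zeta> v3] br_linear

definition heis :: "real \<times> real \<times> real \<times> real \<times> real \<Rightarrow> 'a" where
  "heis a = (case a of (a0, a1, a2, a3, z) \<Rightarrow>
     a0 *\<^sub>R x + a1 *\<^sub>R v1 + a2 *\<^sub>R v2 + a3 *\<^sub>R v3 + z *\<^sub>R \<zeta>)"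

end

type_synonym heis_coord = "real \<times> real \<times> real \<times> real \<times> real"

text \<open>
  The group law of the Heisenberg group in exponential coordinates with respect to
  \<open>x, v1, v2, v3, \<zeta>\<close>.
\<close>

fun hmul :: "heis_coord \<Rightarrow> heis_coord \<Rightarrow> heis_coord" where
  "hmul (a0, a1, a2, a3, z) (b0, b1, b2, b3, w) =
    (a0 + b0, a1 + b1, a2 + b2, a3 + b3, z + w + (a0 * b3 - a3 * b0 - 3 * a1 * b2 + 3 * a2 * b1) / 2)"

text \<open>
  The adjoint action of \<open>exp (s y)\<close>, a translation of the variable in a binary cubic form.
\<close>

fun hshift :: "real \<Rightarrow> heis_coord \<Rightarrow> heis_coord" where
  "hshift s (a0, a1, a2, a3, z) =
    (a0, a1 + s * a0, a2 + 2 * s * a1 + s\<^sup>2 * a0, a3 + 3 * s * a2 + 3 * s\<^sup>2 * a1 + s^3 * a0, z)"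

text \<open>
  The coordinates of \<open>exp (- p y) exp (p y + q v1)\<close>, see \<open>exp_split\<close>.
\<close>

definition hsplit :: "real \<Rightarrow> real \<Rightarrow> heis_coord" where
  "hsplit p q = (0, q, - (p * q), p\<^sup>2 * q, - (p * q\<^sup>2 / 2))"

context g2_serre begin

lemma exp_heis_mult: "exp (heis a) * exp (heis b) = exp (heis (hmul a b))"
proof -
  obtain a0 a1 a2 a3 z where a: "a = (a0, a1, a2, a3, z)" by (cases a) auto
  obtain b0 b1 b2 b3 w where b: "b = (b0, b1, b2, b3, w)" by (cases b) auto
  define c where "c = a0 * b3 - a3 * b0 - 3 * a1 * b2 + 3 * a2 * b1"
  have "br (heis a) (heis b) = c *\<^sub>R \<zeta>"
    by (simp add: a b heis_def br_table c_def algebra_simps)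
  hence "exp (heis a) * exp (heis b) = exp (heis a + heis b + (1/2) *\<^sub>R (c *\<^sub>R \<zeta>))"
    by (rule exp_add_central) (simp_all add: a b heis_def br_table)
  also have "heis a + heis b + (1/2) *\<^sub>R (c *\<^sub>R \<zeta>) = heis (hmul a b)"
    by (simp add: a b heis_def c_def algebra_simps add_divide_distrib diff_divide_distrib)
  finally show ?thesis .
qed

lemma exp_y_heis: "exp (s *\<^sub>R y) * heis a = heis (hshift s a) * exp (s *\<^sub>R y)"
proof -
  obtain a0 a1 a2 a3 z where a: "a = (a0, a1, a2, a3, z)" by (cases a) auto
  have "exp (s *\<^sub>R y) * heis a = (heis a
    + s *\<^sub>R (a0 *\<^sub>R v1 + (2 * a1) *\<^sub>R v2 + (3 * a2) *\<^sub>R v3)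
    + (s\<^sup>2/2) *\<^sub>R ((2 * a0) *\<^sub>R v2 + (6 * a1) *\<^sub>R v3)
    + (s^3/6) *\<^sub>R ((6 * a0) *\<^sub>R v3)) * exp (s *\<^sub>R y)"
    by (rule exp_conj_nilpotent) (simp_all add: a heis_def br_table algebra_simps)
  also have "heis a + s *\<^sub>R (a0 *\<^sub>R v1 + (2 * a1) *\<^sub>R v2 + (3 * a2) *\<^sub>R v3)
    + (s\<^sup>2/2) *\<^sub>R ((2 * a0) *\<^sub>R v2 + (6 * a1) *\<^sub>R v3)
    + (s^3/6) *\<^sub>R ((6 * a0) *\<^sub>R v3) = heis (hshift s a)"
    by (simp add: a heis_def algebra_simps)
  finally show ?thesis .
qed

lemma exp_heis_y: "exp (heis a) * exp (s *\<^sub>R y) = exp (s *\<^sub>R y) * exp (heis (hshift (- s) a))"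
proof -
  have "hshift s (hshift (- s) a) = a"
    by (cases a) (simp add: algebra_simps power2_eq_square power3_eq_cube)
  hence "exp (s *\<^sub>R y) * heis (hshift (- s) a) = heis a * exp (s *\<^sub>R y)"
    by (simp add: exp_y_heis)
  thus ?thesis by (simp add: exp_intertwine)
qed

lemma exp_heis_sum: "exp (heis (a0, a1, a2, a3, z)) =
    exp (a0 *\<^sub>R x) * exp (heis (0, a1, a2, a3, z - a0 * a3 / 2))"
  using exp_heis_mult[of "(a0, 0, 0, 0, 0)" "(0, a1, a2, a3, z - a0 * a3 / 2)"]
  by (simp add: heis_def)

lemma exp_y_x: "exp (p *\<^sub>R y) * exp (s *\<^sub>R x) = exp (s *\<^sub>R x) * exp (p *\<^sub>R (y + s *\<^sub>R v1))"
proof -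
  have "exp (s *\<^sub>R x) * y = (y - s *\<^sub>R v1) * exp (s *\<^sub>R x)"
    using exp_conj_nilpotent[of x y "-v1" 0 0 s] by (simp add: br_table)
  moreover have "exp (s *\<^sub>R x) * v1 = v1 * exp (s *\<^sub>R x)"
    using exp_conj_nilpotent[of x v1 0 0 0 s] by (simp add: br_table)
  ultimately have "exp (s *\<^sub>R x) * (y + s *\<^sub>R v1) = y * exp (s *\<^sub>R x)"
    by (simp add: algebra_simps)
  hence "exp (s *\<^sub>R x) * (p *\<^sub>R (y + s *\<^sub>R v1)) = (p *\<^sub>R y) * exp (s *\<^sub>R x)"
    by (simp only: mult_scaleR_right mult_scaleR_left)
  from exp_intertwine[OF this] show ?thesis by simp
qed

text \<open>
  For \<open>p \<noteq> 0\<close> the vector \<open>y + (q / p) v1\<close> is the conjugate of \<open>y\<close> by \<open>exp (- (q / p) x)\<close>, so that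
  the formula reduces to multiplication in the Heisenberg group.
\<close>

lemma exp_split: "exp (p *\<^sub>R y + q *\<^sub>R v1) = exp (p *\<^sub>R y) * exp (heis (hsplit p q))"
proof (cases "p = 0")
  case True
  thus ?thesis by (simp add: heis_def hsplit_def)
next
  case False
  define s where "s = q / p"
  have ps: "p * s = q" using False by (simp add: s_def)
  have "exp (p *\<^sub>R y + q *\<^sub>R v1) = exp (- s *\<^sub>R x) * (exp (s *\<^sub>R x) * exp (p *\<^sub>R (y + s *\<^sub>R v1)))"
    using exp_minus_inverse[of "- s *\<^sub>R x"] by (simp add: mult.assoc[symmetric] scaleR_add_right ps)
  also have "\<dots> = exp (- s *\<^sub>R x) * exp (p *\<^sub>R y) * exp (s *\<^sub>R x)"
    by (simp only: exp_y_x[symmetric] mult.assoc)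
  also have "exp (- s *\<^sub>R x) = exp (heis (- s, 0, 0, 0, 0))" by (simp add: heis_def)
  also have "\<dots> * exp (p *\<^sub>R y) = exp (p *\<^sub>R y) * exp (heis (hshift (- p) (- s, 0, 0, 0, 0)))"
    by (rule exp_heis_y)
  also have "\<dots> * exp (s *\<^sub>R x) = exp (p *\<^sub>R y) *
      exp (heis (hmul (hshift (- p) (- s, 0, 0, 0, 0)) (s, 0, 0, 0, 0)))"
    by (simp only: exp_heis_mult[symmetric] mult.assoc) (simp add: heis_def)
  also have "hmul (hshift (- p) (- s, 0, 0, 0, 0)) (s, 0, 0, 0, 0) = hsplit p q"
    by (simp add: hsplit_def ps[symmetric] power2_eq_square power3_eq_cube)
  finally show ?thesis .
qed

text \<open>
  Coordinates on the unipotent group. The first entry is the additive character of the short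
  simple root, the second (the coefficient of \<open>x\<close>) that of the long one; the minors below are
  values of these two characters.
\<close>

definition coord :: "real \<times> heis_coord \<Rightarrow> 'a" where
  "coord u = exp (fst u *\<^sub>R y) * exp (heis (snd u))"

text \<open>
  The conjugates of \<open>exp (t x)\<close> by \<open>exp (s y)\<close> are exponentials of
  \<open>t (x + s v1 + s\<^sup>2 v2 + s\<^sup>3 v3)\<close>. For four values of \<open>s\<close> these vectors span the part of the
  Heisenberg algebra outside its centre, and the centre is reached by commutators.
\<close>

lemma root_subgroups:
  assumes S: "\<And>g h. g \<in> S \<Longrightarrow> h \<in> S \<Longrightarrow> g * h \<in> S"
    and x: "\<And>t. exp (t *\<^sub>R x) \<in> S" and y: "\<And>t. exp (t *\<^sub>R y) \<in> S"
  shows "exp (heis a) \<in> S"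
proof -
  have W: "exp (heis (t, s * t, s\<^sup>2 * t, s^3 * t, 0)) \<in> S" for s t
  proof -
    have "exp (s *\<^sub>R y) * exp (heis (t, 0, 0, 0, 0)) = exp (heis (hshift s (t, 0, 0, 0, 0))) * exp (s *\<^sub>R y)"
      by (rule exp_intertwine[OF exp_y_heis])
    hence "exp (s *\<^sub>R y) * exp (heis (t, 0, 0, 0, 0)) * exp (- s *\<^sub>R y) = exp (heis (hshift s (t, 0, 0, 0, 0)))"
      using exp_minus_inverse[of "s *\<^sub>R y"] by (simp add: mult.assoc)
    moreover have "exp (s *\<^sub>R y) * exp (heis (t, 0, 0, 0, 0)) * exp (- s *\<^sub>R y) \<in> S"
      by (intro S y) (simp add: heis_def x)
    ultimately show ?thesis by simp
  qed
  have mul: "exp (heis (hmul a b)) \<in> S" if "exp (heis a) \<in> S" "exp (heis b) \<in> S" for a b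
    using S[OF that] by (simp add: exp_heis_mult)
  have Z: "exp (heis (0, 0, 0, 0, z)) \<in> S" for z
    using mul[OF mul[OF mul[OF W[of z 0] W[of 1 1]] W[of "-z" 0]] W[of "-1" 1]] by simp
  obtain a0 a1 a2 a3 z where a: "a = (a0, a1, a2, a3, z)" by (cases a) auto
  define c3 where "c3 = (a3 - a1) / 6"
  define c1 where "c1 = (a2 - 4 * c3 + (a1 - 2 * c3)) / 2"
  define c2 where "c2 = (a2 - 4 * c3 - (a1 - 2 * c3)) / 2"
  define c0 where "c0 = a0 - c1 - c2 - c3"
  have eqs: "c0 + c1 + c2 + c3 = a0" "c1 - c2 + 2 * c3 = a1" "c1 + c2 + 4 * c3 = a2" "c1 - c2 + 8 * c3 = a3"
    by (simp_all add: c0_def c1_def c2_def c3_def field_simps)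
  have "\<exists>z'. exp (heis (c0 + c1 + c2 + c3, c1 - c2 + 2 * c3, c1 + c2 + 4 * c3, c1 - c2 + 8 * c3, z')) \<in> S"
    using mul[OF mul[OF mul[OF W[of c0 0] W[of c1 1]] W[of c2 "-1"]] W[of c3 2]] by (auto simp: mult.commute)
  then obtain z' where "exp (heis (a0, a1, a2, a3, z')) \<in> S" by (auto simp: eqs)
  from mul[OF this Z[of "z - z'"]] show ?thesis by (simp add: a)
qed

end

section \<open>Simple reflections acting on root vectors\<close>

lemma scaleR_3: "3 *\<^sub>R X = X + X + (X :: 'a::real_vector)"
  using scaleR_add_left[of 2 1 X] by (simp add: scaleR_2)

text \<open>
  Rewrite rules that merge real multiples of one vector, for evaluating brackets of weight
  vectors.
\<close>

lemma scaleR_collect: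
  fixes X :: "'a::real_vector"
  shows "a *\<^sub>R X + b *\<^sub>R X = (a + b) *\<^sub>R X" "X + b *\<^sub>R X = (1 + b) *\<^sub>R X"
    "a *\<^sub>R X + X = (a + 1) *\<^sub>R X" "X + X = 2 *\<^sub>R X"
    "a *\<^sub>R X - b *\<^sub>R X = (a - b) *\<^sub>R X" "X - b *\<^sub>R X = (1 - b) *\<^sub>R X"
    "a *\<^sub>R X - X = (a - 1) *\<^sub>R X" "- X + b *\<^sub>R X = (b - 1) *\<^sub>R X"
  by (simp_all add: algebra_simps scaleR_2)

lemma scaleR_solve:
  fixes X :: "'a::real_vector"
  assumes "c *\<^sub>R X = d *\<^sub>R Y" "c \<noteq> 0"
  shows "X = (d / c) *\<^sub>R Y"
  using arg_cong[OF assms(1), of "\<lambda>Z. (1 / c) *\<^sub>R Z"] assms(2) by simp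

text \<open>
  The representative of a simple reflection. The lemmas below have the form
  \<open>v * s = s * v'\<close>, where \<open>v'\<close> is the image of \<open>v\<close> under the adjoint action of the inverse of \<open>s\<close>.
\<close>

definition weyl_elem :: "'a::{real_normed_algebra_1,banach} \<Rightarrow> 'a \<Rightarrow> 'a" where
  "weyl_elem e f = exp (- e) * exp f * exp (- e)"

lemma weyl_elem_singlet:
  assumes "br e v = 0" "br f v = 0"
  shows "v * weyl_elem e f = weyl_elem e f * v"
proof -
  have "v * exp (- e) = exp (- e) * v" "v * exp f = exp f * v"
    using assms by (auto intro!: exp_commute simp: br_linear br_swap[of v])
  hence "v * (exp (- e) * Z) = exp (- e) * (v * Z)" "v * (exp f * Z) = exp f * (v * Z)" for Z
    by (simp_all only: mult.assoc[symmetric])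
  thus ?thesis using \<open>v * exp (- e) = exp (- e) * v\<close> by (simp add: weyl_elem_def mult.assoc)
qed

lemma weyl_elem_doublet:
  assumes ev: "br e v = w" and ew: "br e w = 0" and fv: "br f v = 0" and fw: "br f w = v"
  shows "v * weyl_elem e f = weyl_elem e f * w" "w * weyl_elem e f = - (weyl_elem e f * v)"
proof -
  have e: "exp (- e) * v = (v - w) * exp (- e)" "exp (- e) * w = w * exp (- e)"
    using exp_conj_nilpotent[of e v w 0 0 "-1"] exp_conj_nilpotent[of e w 0 0 0 "-1"]
    by (simp_all add: ev ew br_linear)
  have f: "exp f * v = v * exp f" "exp f * w = (w + v) * exp f"
    using exp_conj_nilpotent[of f v 0 0 0 1] exp_conj_nilpotent[of f w v 0 0 1]
    by (simp_all add: fv fw br_linear)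
  have e': "exp (- e) * (v * Z) = (v - w) * (exp (- e) * Z)" "exp (- e) * (w * Z) = w * (exp (- e) * Z)"
    and f': "exp f * (v * Z) = v * (exp f * Z)" "exp f * (w * Z) = (w + v) * (exp f * Z)" for Z
    by (simp_all only: mult.assoc[symmetric] e f)
  show "v * weyl_elem e f = weyl_elem e f * w" "w * weyl_elem e f = - (weyl_elem e f * v)"
    by (simp_all add: weyl_elem_def mult.assoc e f e' f' algebra_simps)
qed

text \<open>
  A root string of length four is the space of binary cubic forms, on which the reflection
  exchanges the two variables up to sign.
\<close>

lemma weyl_elem_quartet:
  assumes e: "br e v0 = v1" "br e v1 = 2 *\<^sub>R v2" "br e v2 = 3 *\<^sub>R v3" "br e v3 = 0"
    and f: "br f v0 = 0" "br f v1 = 3 *\<^sub>R v0" "br f v2 = 2 *\<^sub>R v1" "br f v3 = v2"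
  shows "v0 * weyl_elem e f = weyl_elem e f * v3" "v1 * weyl_elem e f = - (weyl_elem e f * v2)"
    "v2 * weyl_elem e f = weyl_elem e f * v1" "v3 * weyl_elem e f = - (weyl_elem e f * v0)"
proof -
  have e1: "exp (- e) * v0 = (v0 - v1 + v2 - v3) * exp (- e)" 
    "exp (- e) * v1 = (v1 - 2 *\<^sub>R v2 + 3 *\<^sub>R v3) * exp (- e)"
    "exp (- e) * v2 = (v2 - 3 *\<^sub>R v3) * exp (- e)"
    "exp (- e) * v3 = v3 * exp (- e)"
    using exp_conj_nilpotent[of e v0 v1 "2 *\<^sub>R v2" "6 *\<^sub>R v3" "-1"]
      exp_conj_nilpotent[of e v1 "2 *\<^sub>R v2" "6 *\<^sub>R v3" 0 "-1"]
      exp_conj_nilpotent[of e v2 "3 *\<^sub>R v3" 0 0 "-1"] exp_conj_nilpotent[of e v3 0 0 0 "-1"]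
    by (simp_all add: e br_linear)
  have f1: "exp f * v0 = v0 * exp f" "exp f * v1 = (v1 + 3 *\<^sub>R v0) * exp f"
    "exp f * v2 = (v2 + 2 *\<^sub>R v1 + 3 *\<^sub>R v0) * exp f" "exp f * v3 = (v3 + v2 + v1 + v0) * exp f"
    using exp_conj_nilpotent[of f v3 v2 "2 *\<^sub>R v1" "6 *\<^sub>R v0" 1]
      exp_conj_nilpotent[of f v2 "2 *\<^sub>R v1" "6 *\<^sub>R v0" 0 1]
      exp_conj_nilpotent[of f v1 "3 *\<^sub>R v0" 0 0 1] exp_conj_nilpotent[of f v0 0 0 0 1]
    by (simp_all add: f br_linear)
  have e': "exp (- e) * (v0 * Z) = (v0 - v1 + v2 - v3) * (exp (- e) * Z)" 
    "exp (- e) * (v1 * Z) = (v1 - 2 *\<^sub>R v2 + 3 *\<^sub>R v3) * (exp (- e) * Z)"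
    "exp (- e) * (v2 * Z) = (v2 - 3 *\<^sub>R v3) * (exp (- e) * Z)"
    "exp (- e) * (v3 * Z) = v3 * (exp (- e) * Z)"
    and f': "exp f * (v0 * Z) = v0 * (exp f * Z)" "exp f * (v1 * Z) = (v1 + 3 *\<^sub>R v0) * (exp f * Z)"
    "exp f * (v2 * Z) = (v2 + 2 *\<^sub>R v1 + 3 *\<^sub>R v0) * (exp f * Z)"
    "exp f * (v3 * Z) = (v3 + v2 + v1 + v0) * (exp f * Z)" for Z
    by (simp_all only: mult.assoc[symmetric] e1 f1)
  show "v0 * weyl_elem e f = weyl_elem e f * v3" "v1 * weyl_elem e f = - (weyl_elem e f * v2)"
    "v2 * weyl_elem e f = weyl_elem e f * v1" "v3 * weyl_elem e f = - (weyl_elem e f * v0)"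
    by (simp_all add: weyl_elem_def mult.assoc e1 f1 e' f' algebra_simps scaleR_2 scaleR_3)
qed

lemma exp_move:
  assumes "F * s = s * F'"
  shows "exp (c *\<^sub>R F) * s = s * exp (c *\<^sub>R F')" "exp (c *\<^sub>R F) * (s * Z) = s * (exp (c *\<^sub>R F') * Z)"
proof -
  have "s * (c *\<^sub>R F') = (c *\<^sub>R F) * s" using assms by simp
  from exp_intertwine[OF this] show 1: "exp (c *\<^sub>R F) * s = s * exp (c *\<^sub>R F')" by simp
  show "exp (c *\<^sub>R F) * (s * Z) = s * (exp (c *\<^sub>R F') * Z)" by (simp only: mult.assoc[symmetric] 1)
qed

lemma exp_move_minus:
  assumes "F * s = - (s * F')"
  shows "exp (c *\<^sub>R F) * s = s * exp ((- c) *\<^sub>R F')" "exp (c *\<^sub>R F) * (s * Z) = s * (exp ((- c) *\<^sub>R F') * Z)"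
  using exp_move[of F s "- F'" c] assms by simp_all

text \<open>
  Chevalley generators of type G2 with \<open>e1\<close> long and \<open>e2\<close> short: the Cartan integers are
  \<open>\<langle>h1, \<alpha>2\<rangle> = -1\<close> and \<open>\<langle>h2, \<alpha>1\<rangle> = -3\<close>. Only real scalars occur, because the group elements are
  evaluated at positive parameters.
\<close>

locale g2_algebra =
  fixes e1 e2 f1 f2 h1 h2 :: "'a::{real_normed_algebra_1,banach}"
  assumes he: "br h1 e1 = 2 *\<^sub>R e1" "br h1 e2 = - e2" "br h2 e1 = (-3) *\<^sub>R e1" "br h2 e2 = 2 *\<^sub>R e2"
    and hf: "br h1 f1 = (-2) *\<^sub>R f1" "br h1 f2 = f2" "br h2 f1 = 3 *\<^sub>R f1" "br h2 f2 = (-2) *\<^sub>R f2"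
    and ef: "br e1 f1 = h1" "br e1 f2 = 0" "br e2 f1 = 0" "br e2 f2 = h2"
    and serre_e: "br e1 (br e1 e2) = 0" "br e2 (br e2 (br e2 (br e2 e1))) = 0"
    and serre_f: "br f1 (br f1 f2) = 0" "br f2 (br f2 (br f2 (br f2 f1))) = 0"
begin

sublocale pos: g2_serre e1 e2 by unfold_locales (rule serre_e)+
sublocale neg: g2_serre f1 f2 by unfold_locales (rule serre_f)+

text \<open>
  The Chevalley involution, which transfers statements about the \<open>e\<close>'s to the \<open>f\<close>'s.
\<close>

lemma dual: "g2_algebra f1 f2 e1 e2 (- h1) (- h2)"
  by unfold_locales (simp_all add: br_linear he hf ef serre_e serre_f br_swap[of f1 e1] br_swap[of f1 e2] br_swap[of f2 e1] br_swap[of f2 e2])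

lemma weights:
  "br h1 pos.v1 = pos.v1" "br h1 pos.v2 = 0" "br h1 pos.v3 = - pos.v3" "br h1 pos.\<zeta> = pos.\<zeta>"
  "br h2 pos.v1 = - pos.v1" "br h2 pos.v2 = pos.v2" "br h2 pos.v3 = 3 *\<^sub>R pos.v3" "br h2 pos.\<zeta> = 0"
proof -
  show a: "br h1 pos.v1 = pos.v1" "br h2 pos.v1 = - pos.v1"
    using br_jacobi[of h1 e2 e1] br_jacobi[of h2 e2 e1]
    by (simp_all add: pos.br_y br_linear he scaleR_collect)
  show b: "br h1 pos.v2 = 0" "br h2 pos.v2 = pos.v2"
    using br_jacobi[of h1 e2 pos.v1] br_jacobi[of h2 e2 pos.v1]
    by (simp_all add: pos.br_y br_linear he a scaleR_collect)
  show c: "br h1 pos.v3 = - pos.v3" "br h2 pos.v3 = 3 *\<^sub>R pos.v3"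
    using br_jacobi[of h1 e2 pos.v2] br_jacobi[of h2 e2 pos.v2]
    scaleR_solve[of 3 "br h1 pos.v3" "-3" pos.v3] scaleR_solve[of 3 "br h2 pos.v3" 9 pos.v3]
    by (simp_all add: pos.br_y br_linear he a b scaleR_collect)
  show "br h1 pos.\<zeta> = pos.\<zeta>" "br h2 pos.\<zeta> = 0"
    using br_jacobi[of h1 e1 pos.v3] br_jacobi[of h2 e1 pos.v3]
    by (simp_all add: pos.br_x br_linear he c scaleR_collect)
qed

lemma lowering:
  "br f1 pos.v1 = - e2" "br f1 pos.v2 = 0" "br f1 pos.v3 = 0" "br f1 pos.\<zeta> = pos.v3" "br f1 e2 = 0"
  "br f2 e1 = 0" "br f2 pos.v1 = 3 *\<^sub>R e1" "br f2 pos.v2 = 2 *\<^sub>R pos.v1" "br f2 pos.v3 = pos.v2" "br f2 pos.\<zeta> = 0"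
proof -
  have fe: "br f1 e1 = - h1" "br f1 e2 = 0" "br f2 e1 = 0" "br f2 e2 = - h2"
    by (simp_all add: ef br_swap[of f1 e1] br_swap[of f1 e2] br_swap[of f2 e1] br_swap[of f2 e2])
  show "br f1 e2 = 0" "br f2 e1 = 0" by (fact fe)+
  show a: "br f1 pos.v1 = - e2" "br f2 pos.v1 = 3 *\<^sub>R e1"
    using br_jacobi[of f1 e2 e1] br_jacobi[of f2 e2 e1]
    by (simp_all add: pos.br_y br_linear fe he br_swap[of _ h1])
  show b: "br f1 pos.v2 = 0" "br f2 pos.v2 = 2 *\<^sub>R pos.v1"
    using br_jacobi[of f1 e2 pos.v1] br_jacobi[of f2 e2 pos.v1]
    scaleR_solve[of 2 "br f2 pos.v2" 4 pos.v1]
    by (simp_all add: pos.br_y br_linear fe a weights scaleR_collect)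
  show c: "br f1 pos.v3 = 0" "br f2 pos.v3 = pos.v2"
    using br_jacobi[of f1 e2 pos.v2] br_jacobi[of f2 e2 pos.v2]
    by (simp_all add: pos.br_y br_linear fe a b weights scaleR_collect)
  show "br f1 pos.\<zeta> = pos.v3" "br f2 pos.\<zeta> = 0"
    using br_jacobi[of f1 e1 pos.v3] br_jacobi[of f2 e1 pos.v3]
    by (simp_all add: pos.br_x br_linear fe a b c weights scaleR_collect)
qed

abbreviation "s1 \<equiv> weyl_elem e1 f1"
abbreviation "s2 \<equiv> weyl_elem e2 f2"

text \<open>
  A simple reflection permutes the negative roots different from its own; on root vectors this
  holds up to sign.
\<close>

lemma neg_reflect:
  "f2 * s1 = s1 * neg.v1" "neg.v1 * s1 = - (s1 * f2)"
  "neg.v2 * s1 = s1 * neg.v2" "neg.v3 * s1 = - (s1 * neg.\<zeta>)" "neg.\<zeta> * s1 = s1 * neg.v3"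
  "f1 * s2 = - (s2 * neg.v3)" "neg.v1 * s2 = s2 * neg.v2" "neg.v2 * s2 = - (s2 * neg.v1)"
  "neg.v3 * s2 = s2 * f1" "neg.\<zeta> * s2 = s2 * neg.\<zeta>"
proof -
  interpret dual: g2_algebra f1 f2 e1 e2 "- h1" "- h2" by (rule dual)
  show "f2 * s1 = s1 * neg.v1"
    using weyl_elem_doublet(2)[of e1 "- neg.v1" f2 f1] by (simp add: dual.lowering br_linear neg.br_table)
  show "neg.v1 * s1 = - (s1 * f2)"
    using weyl_elem_doublet(1)[of e1 "- neg.v1" f2 f1]
    by (simp add: dual.lowering br_linear neg.br_table minus_equation_iff[of "neg.v1 * _"])
  show "neg.v2 * s1 = s1 * neg.v2"
    by (rule weyl_elem_singlet) (simp_all add: dual.lowering neg.br_table)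
  show "neg.v3 * s1 = - (s1 * neg.\<zeta>)" "neg.\<zeta> * s1 = s1 * neg.v3"
    using weyl_elem_doublet[of e1 neg.\<zeta> neg.v3 f1] by (simp_all add: dual.lowering neg.br_table)
  show "f1 * s2 = - (s2 * neg.v3)" "neg.v1 * s2 = s2 * neg.v2" "neg.v2 * s2 = - (s2 * neg.v1)"
    "neg.v3 * s2 = s2 * f1"
    using weyl_elem_quartet[of e2 neg.v3 neg.v2 neg.v1 f1 f2] by (simp_all add: dual.lowering neg.br_table)
  show "neg.\<zeta> * s2 = s2 * neg.\<zeta>"
    by (rule weyl_elem_singlet) (simp_all add: dual.lowering neg.br_table)
qed

lemmas neg_moves = exp_move[OF neg_reflect(1)] exp_move_minus[OF neg_reflect(2)]
  exp_move[OF neg_reflect(3)] exp_move_minus[OF neg_reflect(4)] exp_move[OF neg_reflect(5)]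
  exp_move_minus[OF neg_reflect(6)] exp_move[OF neg_reflect(7)] exp_move_minus[OF neg_reflect(8)]
  exp_move[OF neg_reflect(9)] exp_move[OF neg_reflect(10)]

abbreviation "z1 c \<equiv> s1 * exp (c *\<^sub>R f1)"
abbreviation "z2 c \<equiv> s2 * exp (c *\<^sub>R f2)"

text \<open>
  Both words are reduced, so a factor \<open>exp (c f)\<close> that is moved to the right end through the
  remaining reflections always stays in a negative root subgroup; the six factors end up in the
  six different ones.
\<close>

lemma neg_word:
  assumes S: "\<And>g h. g \<in> S \<Longrightarrow> h \<in> S \<Longrightarrow> g * h \<in> S"
    and f: "\<And>t. exp (t *\<^sub>R f1) \<in> S" "\<And>t. exp (t *\<^sub>R f2) \<in> S"
  shows "\<exists>y\<in>S. z1 c1 * z2 c2 * z1 c3 * z2 c4 * z1 c5 * z2 c6 = s1 * s2 * s1 * s2 * s1 * s2 * y"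
    and "\<exists>y\<in>S. z2 c1 * z1 c2 * z2 c3 * z1 c4 * z2 c5 * z1 c6 = s2 * s1 * s2 * s1 * s2 * s1 * y"
proof -
  have n: "exp (t *\<^sub>R neg.v1) \<in> S" "exp (t *\<^sub>R neg.v2) \<in> S" "exp (t *\<^sub>R neg.v3) \<in> S"
    "exp (t *\<^sub>R neg.\<zeta>) \<in> S" for t
    using neg.root_subgroups[OF S f, of "(0, t, 0, 0, 0)"] neg.root_subgroups[OF S f, of "(0, 0, t, 0, 0)"]
      neg.root_subgroups[OF S f, of "(0, 0, 0, t, 0)"] neg.root_subgroups[OF S f, of "(0, 0, 0, 0, t)"]
    by (simp_all add: neg.heis_def)
  show "\<exists>y\<in>S. z1 c1 * z2 c2 * z1 c3 * z2 c4 * z1 c5 * z2 c6 = s1 * s2 * s1 * s2 * s1 * s2 * y"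
  proof
    show "z1 c1 * z2 c2 * z1 c3 * z2 c4 * z1 c5 * z2 c6 = s1 * s2 * s1 * s2 * s1 * s2 * (exp (c1 *\<^sub>R f1) * exp (- c2 *\<^sub>R neg.v1) * exp (c3 *\<^sub>R neg.\<zeta>) *
        exp (c4 *\<^sub>R neg.v2) * exp (- c5 *\<^sub>R neg.v3) * exp (c6 *\<^sub>R f2))"
      by (simp only: mult.assoc neg_moves minus_minus)
    show "exp (c1 *\<^sub>R f1) * exp (- c2 *\<^sub>R neg.v1) * exp (c3 *\<^sub>R neg.\<zeta>) *
        exp (c4 *\<^sub>R neg.v2) * exp (- c5 *\<^sub>R neg.v3) * exp (c6 *\<^sub>R f2) \<in> S"
      by (intro S n f)
  qed
  show "\<exists>y\<in>S. z2 c1 * z1 c2 * z2 c3 * z1 c4 * z2 c5 * z1 c6 = s2 * s1 * s2 * s1 * s2 * s1 * y"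
  proof
    show "z2 c1 * z1 c2 * z2 c3 * z1 c4 * z2 c5 * z1 c6 = s2 * s1 * s2 * s1 * s2 * s1 * (exp (c1 *\<^sub>R f2) * exp (c2 *\<^sub>R neg.v3) * exp (c3 *\<^sub>R neg.v2) *
        exp (c4 *\<^sub>R neg.\<zeta>) * exp (c5 *\<^sub>R neg.v1) * exp (c6 *\<^sub>R f1))"
      by (simp only: mult.assoc neg_moves minus_minus)
    show "exp (c1 *\<^sub>R f2) * exp (c2 *\<^sub>R neg.v3) * exp (c3 *\<^sub>R neg.v2) *
        exp (c4 *\<^sub>R neg.\<zeta>) * exp (c5 *\<^sub>R neg.v1) * exp (c6 *\<^sub>R f1) \<in> S"
      by (intro S n f)
  qed
qed

end

section \<open>Factoring products of the elements x_{-i}(t)\<close>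

text \<open>
  The functions \<open>step_one\<close> and \<open>step_two\<close> give the coordinates of the unipotent factor after
  multiplication by \<open>x_{-i}(t)\<close> from the right and removal of \<open>s exp (c f)\<close> from the left; see
  \<open>coord_xm_one\<close> and \<open>coord_xm_two\<close>. For the short root the Heisenberg coordinates are transformed
  linearly by the adjoint action of the inverse of \<open>x_{-2}(t)\<close>.
\<close>

fun step_two :: "real \<Rightarrow> real \<times> heis_coord \<Rightarrow> real \<times> heis_coord" where
  "step_two t (p, a0, a1, a2, a3, z) =
    (t, (a0 - 3 * t * a1 + 3 * t\<^sup>2 * a2 - t^3 * a3) / t^3, (a1 - 2 * t * a2 + t\<^sup>2 * a3) / t,
      t * (a2 - t * a3), t^3 * a3, z)"

text \<open>
  For the long root the element is first written as
  \<open>exp (a0 x) exp (p (y + a0 v1)) exp (a1 v1) exp (a2 v2 + a3 v3 + b \<zeta>)\<close>. The last three factors are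
  conjugated by \<open>x_{-1}(t)\<close> and reassembled, which explains the shape of the formula.
\<close>

fun step_one :: "real \<Rightarrow> real \<times> heis_coord \<Rightarrow> real \<times> heis_coord" where
  "step_one t (p, a0, a1, a2, a3, z) =
    (let q = p / t + p * a0; b = z - a0 * a3 / 2 + 3 * a1 * a2 / 2
     in (q + a1, hmul (hmul (hmul (hshift (- (q + a1)) (t, 0, 0, 0, 0)) (hshift (- a1) (hsplit q (p * a0 * t))))
          (hsplit a1 (a1 * t))) (0, 0, a2, a3 / t - b, t * b)))"

lemma hmul_assoc: "hmul (hmul a b) c = hmul a (hmul b c)"
  by (cases a; cases b; cases c) (simp add: field_simps)

text \<open>
  After a step for the long root the coordinates of \<open>x\<close> and \<open>v1\<close> are single parameters up to
  sign. Iterating on tuples of this form keeps all intermediate rational functions short.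
\<close>

lemma step_one_two:
  assumes "t > 0" "t' > 0"
  shows "step_one t' (step_two t (p, s, - r, b, c, z)) =
    (s / t\<^sup>2 + 2 * r / t + b + t / t', t', - t, s / t + r + t\<^sup>2 / t',
     - (s\<^sup>2 / t^3) - 3 * s * r / t\<^sup>2 - s * c / 2 - 2 * s / t' - 3 * r\<^sup>2 / t - 3 * r * b / 2 - 3 * r * t / t' - z - t^3 / t'\<^sup>2,
     t' / 2 * (s\<^sup>2 / t^3 + 3 * s * r / t\<^sup>2 + s * c / 2 + s / t' + 3 * r\<^sup>2 / t + 3 * r * b / 2 + z))"
proof -
  have nz: "t \<noteq> 0" "t' \<noteq> 0" using assms by auto
  define a0 where "a0 = (s + 3 * t * r + 3 * t\<^sup>2 * b - t^3 * c) / t^3"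
  define a1 where "a1 = - (r + 2 * t * b - t\<^sup>2 * c) / t"
  define q where "q = t / t' + t * a0"
  have st: "step_two t (p, s, - r, b, c, z) = (t, a0, a1, t * (b - t * c), t^3 * c, z)"
    by (simp add: a0_def a1_def)
  have q1: "q + a1 = s / t\<^sup>2 + 2 * r / t + b + t / t'"
    using nz by (simp add: q_def a0_def a1_def field_simps power2_eq_square power3_eq_cube)
  show ?thesis
    unfolding st
    using nz by (simp add: Let_def hsplit_def flip: q_def)
      (simp add: q1, simp add: q_def a0_def a1_def, intro conjI; simp add: divide_simps; algebra)
qed

text \<open>
  The values of the two characters on the unipotent factor, for the words ending in the other
  letter.
\<close>

definition chi_one :: "(nat \<Rightarrow> real) \<Rightarrow> real" where
  "chi_one t = t 1 + (t 2)^3 / t 3 + 3 * (t 2)\<^sup>2 / t 4 + 3 * t 2 * t 3 / (t 4)\<^sup>2 + 3 * t 2 * t 4 / t 5 + 3 * t 2 / t 6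
     + (t 3)\<^sup>2 / (t 4)^3 + 2 * t 3 / t 5 + 3 * t 3 / (t 4 * t 6) + (t 4)^3 / (t 5)\<^sup>2 + 3 * (t 4)\<^sup>2 / (t 5 * t 6)
     + 3 * t 4 / (t 6)\<^sup>2 + t 5 / (t 6)^3"

definition chi_two :: "(nat \<Rightarrow> real) \<Rightarrow> real" where
  "chi_two t = t 1 + t 2 / t 3 + (t 3)\<^sup>2 / t 4 + 2 * t 3 / t 5 + t 4 / (t 5)\<^sup>2 + t 5 / t 6"

definition start :: "real \<times> heis_coord" where "start = (0, 0, 0, 0, 0, 0)"

lemma step_one_chain:
  assumes "t1 > 0" "t2 > 0" "t3 > 0" "t4 > 0" "t5 > 0"
  shows "step_one t5 (step_two t4 (step_one t3 (step_two t2 (step_one t1 start)))) = 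
    (t1 / t2 + t2\<^sup>2 / t3 + 2 * t2 / t4 + t3 / t4\<^sup>2 + t4 / t5, t5, - t4, t2 + t3 / t4 + t4\<^sup>2 / t5,
     - t1 - t2^3 / t3 - 3 * t2\<^sup>2 / t4 - 3 * t2 * t3 / t4\<^sup>2 - 3 * t2 * t4 / t5 - t3\<^sup>2 / t4^3 - 2 * t3 / t5 - t4^3 / t5\<^sup>2, 
     t1 * t5 / 2 + t2^3 * t5 / (2 * t3) + 3 * t2\<^sup>2 * t5 / (2 * t4) + 3 * t2 * t3 * t5 / (2 * t4\<^sup>2) + t3\<^sup>2 * t5 / (2 * t4^3) + t3 / 2)"
proof -
  have s1: "step_one t1 start = (0, t1, - 0, 0, 0, 0)"
    using assms by (simp add: start_def hsplit_def)
  show ?thesis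
    unfolding s1 step_one_two[OF assms(2,3)] step_one_two[OF assms(4,5)]
    using assms by (simp, intro conjI; simp add: divide_simps; algebra)
qed

definition coord_one :: "(nat \<Rightarrow> real) \<Rightarrow> real \<times> heis_coord" where
  "coord_one t = step_two (t 6) (step_one (t 5) (step_two (t 4) (step_one (t 3) (step_two (t 2) (step_one (t 1) start)))))"

definition coord_two :: "(nat \<Rightarrow> real) \<Rightarrow> real \<times> heis_coord" where
  "coord_two t = step_one (t 6) (step_two (t 5) (step_one (t 4) (step_two (t 3) (step_one (t 2) (step_two (t 1) start)))))"

lemma coord_one:
  assumes "\<And>l. t l > 0"
  shows "fst (coord_one t) = t 6" "fst (snd (coord_one t)) = chi_one t"
proof -
  have *: "(t5 + 3 * t6 * t4 + 3 * t6\<^sup>2 * (t2 + t3 / t4 + t4\<^sup>2 / t5) - t6^3 *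
     (- t1 - t2^3 / t3 - 3 * t2\<^sup>2 / t4 - 3 * t2 * t3 / t4\<^sup>2 - 3 * t2 * t4 / t5 - t3\<^sup>2 / t4^3 - 2 * t3 / t5 - t4^3 / t5\<^sup>2)) / t6^3
    = t1 + t2^3 / t3 + 3 * t2\<^sup>2 / t4 + 3 * t2 * t3 / t4\<^sup>2 + 3 * t2 * t4 / t5 + 3 * t2 / t6
     + t3\<^sup>2 / t4^3 + 2 * t3 / t5 + 3 * t3 / (t4 * t6) + t4^3 / t5\<^sup>2 + 3 * t4\<^sup>2 / (t5 * t6)
     + 3 * t4 / t6\<^sup>2 + t5 / t6^3" 
    if "t2 > 0" "t3 > 0" "t4 > 0" "t5 > 0" "t6 > 0" for t1 t2 t3 t4 t5 t6 :: real
    using that by (simp add: divide_simps) algebra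
  show "fst (coord_one t) = t 6" "fst (snd (coord_one t)) = chi_one t"
    unfolding coord_one_def step_one_chain[OF assms assms assms assms assms] chi_one_def *[OF assms assms assms assms assms, symmetric]
    by simp_all
qed

lemma coord_two:
  assumes "\<And>l. t l > 0"
  shows "fst (snd (coord_two t)) = t 6" "fst (coord_two t) = chi_two t"
proof -
  have s1: "start = (0, 0, - 0, 0, 0, 0)" by (simp add: start_def)
  have eq: "step_one t2 (step_two t1 start) = (t1 / t2, t2, - t1, t1\<^sup>2 / t2, - (t1^3 / t2\<^sup>2), 0)"
    if "t1 > 0" "t2 > 0" for t1 t2
    unfolding s1 step_one_two[OF that] by simp
  show "fst (snd (coord_two t)) = t 6"
    by (simp add: coord_two_def eq[OF assms assms] step_one_two[OF assms assms] del: step_one.simps step_two.simps)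
  show "fst (coord_two t) = chi_two t"
    unfolding coord_two_def eq[OF assms assms] step_one_two[OF assms assms] fst_conv chi_two_def
    by simp
qed

text \<open>
  The elements \<open>x_{-i}(t)\<close> and \<open>t\<^sup>h\<close> at positive parameters. The assumptions \<open>xm_sl2\<close> and \<open>tp_sl2\<close> are
  identities between matrices in \<open>SL\<^sub>2\<close>.
\<close>

locale g2_group = g2_algebra e1 e2 f1 f2 h1 h2
  for e1 e2 f1 f2 h1 h2 :: "'a::{real_normed_algebra_1,banach}" +
  fixes xm1 xm2 tp1 tp2 :: "real \<Rightarrow> 'a"
  assumes xm: "t > 0 \<Longrightarrow> xm1 t = exp (t *\<^sub>R f1) * exp (- ln t *\<^sub>R h1)"
      "t > 0 \<Longrightarrow> xm2 t = exp (t *\<^sub>R f2) * exp (- ln t *\<^sub>R h2)"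
    and xm_sl2: "t > 0 \<Longrightarrow> exp (c *\<^sub>R e1) * xm1 t = s1 * exp (- (1 / t + c) *\<^sub>R f1) * exp (t *\<^sub>R e1)"
      "t > 0 \<Longrightarrow> exp (c *\<^sub>R e2) * xm2 t = s2 * exp (- (1 / t + c) *\<^sub>R f2) * exp (t *\<^sub>R e2)"
    and tp_sl2: "c > 0 \<Longrightarrow> s1 * exp (- c *\<^sub>R f1) = exp ((1 / c) *\<^sub>R f1) * tp1 c * exp (- (1 / c) *\<^sub>R e1)"
      "c > 0 \<Longrightarrow> s2 * exp (- c *\<^sub>R f2) = exp ((1 / c) *\<^sub>R f2) * tp2 c * exp (- (1 / c) *\<^sub>R e2)"
begin

lemma exp_conj_right:
  assumes "br X Y = Y1" "br X Y1 = Y2" "br X Y2 = Y3" "br X Y3 = 0"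
  shows "Y * exp (s *\<^sub>R X) = exp (s *\<^sub>R X) * (Y - s *\<^sub>R Y1 + (s\<^sup>2/2) *\<^sub>R Y2 - (s^3/6) *\<^sub>R Y3 :: 'a)"
proof -
  let ?R = "Y - s *\<^sub>R Y1 + (s\<^sup>2/2) *\<^sub>R Y2 - (s^3/6) *\<^sub>R Y3"
  have "exp (s *\<^sub>R X) * (exp (- s *\<^sub>R X) * Y) * exp (s *\<^sub>R X) =
      exp (s *\<^sub>R X) * ?R * (exp (- s *\<^sub>R X) * exp (s *\<^sub>R X))"
    using exp_conj_nilpotent[OF assms, of "- s"] by (simp add: mult.assoc)
  moreover have "exp (s *\<^sub>R X) * (exp (- s *\<^sub>R X) * Y) = Y"
    using exp_minus_inverse[of "s *\<^sub>R X"] by (simp flip: mult.assoc)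
  moreover have "exp (- s *\<^sub>R X) * exp (s *\<^sub>R X) = 1"
    using exp_minus_inverse[of "- s *\<^sub>R X"] by simp
  ultimately show ?thesis by simp
qed

lemma mult_weight:
  assumes "X * exp (t *\<^sub>R f) = exp (t *\<^sub>R f) * Y" "Y * exp (- ln t *\<^sub>R h) = exp (- ln t *\<^sub>R h) * Z"
  shows "X * (exp (t *\<^sub>R f) * exp (- ln t *\<^sub>R h)) = exp (t *\<^sub>R f) * exp (- ln t *\<^sub>R h) * (Z :: 'a)"
proof -
  have "X * (exp (t *\<^sub>R f) * exp (- ln t *\<^sub>R h)) = exp (t *\<^sub>R f) * (Y * exp (- ln t *\<^sub>R h))"
    by (simp only: mult.assoc[symmetric] assms(1))
  thus ?thesis by (simp only: assms(2) mult.assoc)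
qed

lemma pass_one:
  assumes t: "t > 0"
  shows "e2 * xm1 t = xm1 t * ((1 / t) *\<^sub>R e2)" "pos.v1 * xm1 t = xm1 t * (t *\<^sub>R pos.v1 + e2)"
    "pos.v2 * xm1 t = xm1 t * pos.v2" "pos.v3 * xm1 t = xm1 t * ((1 / t) *\<^sub>R pos.v3)"
    "pos.\<zeta> * xm1 t = xm1 t * (t *\<^sub>R pos.\<zeta> - pos.v3)"
proof -
  let ?H = "exp (- ln t *\<^sub>R h1)"
  have ex: "exp (ln t) = t" "exp (- ln t) = 1 / t" using t by (simp_all add: exp_minus field_simps)
  have w: "e2 * ?H = ?H * ((1 / t) *\<^sub>R e2)" "pos.v1 * ?H = ?H * (t *\<^sub>R pos.v1)" "pos.v2 * ?H = ?H * pos.v2"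
    "pos.v3 * ?H = ?H * ((1 / t) *\<^sub>R pos.v3)" "pos.\<zeta> * ?H = ?H * (t *\<^sub>R pos.\<zeta>)"
    using exp_weight[of h1 e2 "-1" "ln t"] exp_weight[of h1 pos.v1 1 "ln t"] exp_weight[of h1 pos.v2 0 "ln t"]
      exp_weight[of h1 pos.v3 "-1" "ln t"] exp_weight[of h1 pos.\<zeta> 1 "ln t"]
    by (simp_all add: weights he ex t)
  note l = exp_conj_right[of f1 _ _ _ _ t]
  show "e2 * xm1 t = xm1 t * ((1 / t) *\<^sub>R e2)"
    unfolding xm(1)[OF t] using l[of e2 0 0 0] w(1)
    by (intro mult_weight) (auto simp: lowering br_linear)
  show "pos.v1 * xm1 t = xm1 t * (t *\<^sub>R pos.v1 + e2)"
    unfolding xm(1)[OF t] using l[of pos.v1 "- e2" 0 0] w t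
    by (intro mult_weight[where Y = "pos.v1 + t *\<^sub>R e2"]) (auto simp: lowering br_linear algebra_simps)
  show "pos.v2 * xm1 t = xm1 t * pos.v2"
    unfolding xm(1)[OF t] using l[of pos.v2 0 0 0] w
    by (intro mult_weight) (auto simp: lowering br_linear)
  show "pos.v3 * xm1 t = xm1 t * ((1 / t) *\<^sub>R pos.v3)"
    unfolding xm(1)[OF t] using l[of pos.v3 0 0 0] w
    by (intro mult_weight) (auto simp: lowering br_linear)
  show "pos.\<zeta> * xm1 t = xm1 t * (t *\<^sub>R pos.\<zeta> - pos.v3)"
    unfolding xm(1)[OF t] using l[of pos.\<zeta> pos.v3 0 0] w t
    by (intro mult_weight[where Y = "pos.\<zeta> - t *\<^sub>R pos.v3"]) (auto simp: lowering br_linear algebra_simps)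
qed

lemma pass_two:
  assumes t: "t > 0"
  shows "e1 * xm2 t = xm2 t * ((1 / t^3) *\<^sub>R e1)"
    "pos.v1 * xm2 t = xm2 t * ((1 / t) *\<^sub>R pos.v1 - (3 / t\<^sup>2) *\<^sub>R e1)"
    "pos.v2 * xm2 t = xm2 t * (t *\<^sub>R pos.v2 - 2 *\<^sub>R pos.v1 + (3 / t) *\<^sub>R e1)"
    "pos.v3 * xm2 t = xm2 t * (t^3 *\<^sub>R pos.v3 - t\<^sup>2 *\<^sub>R pos.v2 + t *\<^sub>R pos.v1 - e1)"
    "pos.\<zeta> * xm2 t = xm2 t * pos.\<zeta>"
proof -
  let ?H = "exp (- ln t *\<^sub>R h2)"
  have "exp (3 * ln t) = t^3" using exp_of_nat_mult[of 3 "ln t"] t by simp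
  hence ex: "exp (ln t) = t" "exp (- ln t) = 1 / t" "exp (3 * ln t) = t^3" "exp (- (3 * ln t)) = 1 / t^3"
    "exp (ln t * 3) = t^3" "exp (- (ln t * 3)) = 1 / t^3"
    using t by (simp_all add: exp_minus field_simps)
  have w: "e1 * ?H = ?H * ((1 / t^3) *\<^sub>R e1)" "pos.v1 * ?H = ?H * ((1 / t) *\<^sub>R pos.v1)" "pos.v2 * ?H = ?H * (t *\<^sub>R pos.v2)"
    "pos.v3 * ?H = ?H * (t^3 *\<^sub>R pos.v3)" "pos.\<zeta> * ?H = ?H * pos.\<zeta>"
    using exp_weight[of h2 e1 "-3" "ln t"] exp_weight[of h2 pos.v1 "-1" "ln t"] exp_weight[of h2 pos.v2 1 "ln t"]
      exp_weight[of h2 pos.v3 3 "ln t"] exp_weight[of h2 pos.\<zeta> 0 "ln t"]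
    by (simp_all add: weights he ex t)
  note l = exp_conj_right[of f2 _ _ _ _ t]
  show "e1 * xm2 t = xm2 t * ((1 / t^3) *\<^sub>R e1)"
    unfolding xm(2)[OF t] using l[of e1 0 0 0] w(1)
    by (intro mult_weight) (auto simp: lowering br_linear)
  show "pos.v1 * xm2 t = xm2 t * ((1 / t) *\<^sub>R pos.v1 - (3 / t\<^sup>2) *\<^sub>R e1)"
    unfolding xm(2)[OF t]
  proof (rule mult_weight)
    show "pos.v1 * exp (t *\<^sub>R f2) = exp (t *\<^sub>R f2) * (pos.v1 - (3 * t) *\<^sub>R e1)"
      using l[of pos.v1 "3 *\<^sub>R e1" 0 0] by (simp add: lowering br_linear mult.commute)
    show "(pos.v1 - (3 * t) *\<^sub>R e1) * ?H = ?H * ((1 / t) *\<^sub>R pos.v1 - (3 / t\<^sup>2) *\<^sub>R e1)"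
      using w t by (simp add: algebra_simps power2_eq_square power3_eq_cube)
  qed
  show "pos.v2 * xm2 t = xm2 t * (t *\<^sub>R pos.v2 - 2 *\<^sub>R pos.v1 + (3 / t) *\<^sub>R e1)"
    unfolding xm(2)[OF t]
  proof (rule mult_weight)
    show "pos.v2 * exp (t *\<^sub>R f2) = exp (t *\<^sub>R f2) * (pos.v2 - (2 * t) *\<^sub>R pos.v1 + (3 * t\<^sup>2) *\<^sub>R e1)"
      using l[of pos.v2 "2 *\<^sub>R pos.v1" "6 *\<^sub>R e1" 0] by (simp add: lowering br_linear mult.commute)
    show "(pos.v2 - (2 * t) *\<^sub>R pos.v1 + (3 * t\<^sup>2) *\<^sub>R e1) * ?H = ?H * (t *\<^sub>R pos.v2 - 2 *\<^sub>R pos.v1 + (3 / t) *\<^sub>R e1)"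
      using w t by (simp add: algebra_simps power2_eq_square power3_eq_cube)
  qed
  show "pos.v3 * xm2 t = xm2 t * (t^3 *\<^sub>R pos.v3 - t\<^sup>2 *\<^sub>R pos.v2 + t *\<^sub>R pos.v1 - e1)"
    unfolding xm(2)[OF t]
  proof (rule mult_weight)
    show "pos.v3 * exp (t *\<^sub>R f2) = exp (t *\<^sub>R f2) * (pos.v3 - t *\<^sub>R pos.v2 + t\<^sup>2 *\<^sub>R pos.v1 - t^3 *\<^sub>R e1)"
      using l[of pos.v3 "pos.v2" "2 *\<^sub>R pos.v1" "6 *\<^sub>R e1"] by (simp add: lowering br_linear mult.commute)
    show "(pos.v3 - t *\<^sub>R pos.v2 + t\<^sup>2 *\<^sub>R pos.v1 - t^3 *\<^sub>R e1) * ?H = ?H * (t^3 *\<^sub>R pos.v3 - t\<^sup>2 *\<^sub>R pos.v2 + t *\<^sub>R pos.v1 - e1)"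
      using w t by (simp add: algebra_simps power2_eq_square power3_eq_cube)
  qed
  show "pos.\<zeta> * xm2 t = xm2 t * pos.\<zeta>"
    unfolding xm(2)[OF t] using l[of pos.\<zeta> 0 0 0] w
    by (intro mult_weight) (auto simp: lowering br_linear)
qed

lemma exp_pass: "X * A = A * Y \<Longrightarrow> exp X * A = A * exp (Y :: 'a)"
  using exp_intertwine[of A Y X] by simp

text \<open>
  The Heisenberg group is normal and \<open>x_{-2}(t)\<close> normalizes it, so only
  \<open>exp (p e2) x_{-2}(t)\<close> has to be rewritten in \<open>SL\<^sub>2\<close>.
\<close>

lemma coord_xm_two:
  assumes t: "t > 0"
  shows "pos.coord u * xm2 t = s2 * exp (- (1 / t + fst u) *\<^sub>R f2) * pos.coord (step_two t u)"
proof -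
  obtain p a0 a1 a2 a3 z where u: "u = (p, a0, a1, a2, a3, z)" by (cases u) auto
  have "pos.heis (a0, a1, a2, a3, z) * xm2 t = xm2 t * pos.heis (snd (step_two t u))"
  proof -
    have c: "(a0 - 3 * t * a1 + 3 * t\<^sup>2 * a2 - t^3 * a3) / t^3 = a0 / t^3 - 3 * a1 / t\<^sup>2 + 3 * a2 / t - a3"
      "(a1 - 2 * t * a2 + t\<^sup>2 * a3) / t = a1 / t - 2 * a2 + t * a3"
      using t by (simp add: divide_simps, algebra) (use t in \<open>simp add: divide_simps\<close>, algebra)
    show ?thesis
      by (simp only: u step_two.simps snd_conv c pos.heis_def prod.case)
         (simp add: pass_two[OF t] algebra_simps power2_eq_square)
  qed
  from exp_pass[OF this]
  have "pos.coord u * xm2 t = exp (p *\<^sub>R e2) * xm2 t * exp (pos.heis (snd (step_two t u)))"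
    by (simp add: pos.coord_def u mult.assoc)
  also have "\<dots> = s2 * exp (- (1 / t + p) *\<^sub>R f2) * exp (t *\<^sub>R e2) * exp (pos.heis (snd (step_two t u)))"
    using xm_sl2(2)[OF t, of p] by simp
  finally show ?thesis by (simp add: pos.coord_def u mult.assoc)
qed

text \<open>
  The same idea for the long root. Here the normalized subgroup contains \<open>exp (p e2)\<close>, and after
  the conjugation its elements have to be brought back to the standard coordinates with
  \<open>exp_split\<close>.
\<close>

lemma coord_xm_one:
  assumes t: "t > 0"
  shows "pos.coord u * xm1 t = s1 * exp (- (1 / t + fst (snd u)) *\<^sub>R f1) * pos.coord (step_one t u)"
proof -
  obtain p a0 a1 a2 a3 z where u: "u = (p, a0, a1, a2, a3, z)" by (cases u) auto
  define b where "b = z - a0 * a3 / 2 + 3 * a1 * a2 / 2"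
  define q where "q = p / t + p * a0"
  have "exp (pos.heis (0, a1, a2, a3, z - a0 * a3 / 2)) =
      exp (pos.heis (0, a1, 0, 0, 0)) * exp (pos.heis (0, 0, a2, a3, b))"
    by (simp add: pos.exp_heis_mult b_def)
  hence "pos.coord u = exp (p *\<^sub>R e2) * (exp (a0 *\<^sub>R e1) * (exp (pos.heis (0, a1, 0, 0, 0)) * exp (pos.heis (0, 0, a2, a3, b))))"
    by (simp add: pos.coord_def u pos.exp_heis_sum[of a0])
  also have "\<dots> = exp (a0 *\<^sub>R e1) * exp (p *\<^sub>R (e2 + a0 *\<^sub>R pos.v1)) *
      (exp (pos.heis (0, a1, 0, 0, 0)) * exp (pos.heis (0, 0, a2, a3, b)))"
    by (simp only: mult.assoc[symmetric] pos.exp_y_x)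
  finally have cu: "pos.coord u = exp (a0 *\<^sub>R e1) * (exp (p *\<^sub>R (e2 + a0 *\<^sub>R pos.v1)) *
      (exp (pos.heis (0, a1, 0, 0, 0)) * exp (pos.heis (0, 0, a2, a3, b))))" by (simp only: mult.assoc)
  have m: "exp (p *\<^sub>R (e2 + a0 *\<^sub>R pos.v1)) * xm1 t = xm1 t * exp (q *\<^sub>R e2 + (p * a0 * t) *\<^sub>R pos.v1)"
    "exp (pos.heis (0, a1, 0, 0, 0)) * xm1 t = xm1 t * exp (a1 *\<^sub>R e2 + (a1 * t) *\<^sub>R pos.v1)"
    "exp (pos.heis (0, 0, a2, a3, b)) * xm1 t = xm1 t * exp (pos.heis (0, 0, a2, a3 / t - b, t * b))"
    by (rule exp_pass; simp add: pos.heis_def pass_one t q_def algebra_simps)+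
  have m': "exp (p *\<^sub>R (e2 + a0 *\<^sub>R pos.v1)) * (xm1 t * Z) = xm1 t * (exp (q *\<^sub>R e2 + (p * a0 * t) *\<^sub>R pos.v1) * Z)"
    "exp (pos.heis (0, a1, 0, 0, 0)) * (xm1 t * Z) = xm1 t * (exp (a1 *\<^sub>R e2 + (a1 * t) *\<^sub>R pos.v1) * Z)" for Z
    by (simp_all only: mult.assoc[symmetric] m)
  have "pos.coord u * xm1 t = exp (a0 *\<^sub>R e1) * (xm1 t * (exp (q *\<^sub>R e2 + (p * a0 * t) *\<^sub>R pos.v1) *
       (exp (a1 *\<^sub>R e2 + (a1 * t) *\<^sub>R pos.v1) * exp (pos.heis (0, 0, a2, a3 / t - b, t * b)))))"
    by (simp only: cu mult.assoc m m')
  also have "\<dots> = s1 * exp (- (1 / t + a0) *\<^sub>R f1) * (exp (t *\<^sub>R e1) * (exp (q *\<^sub>R e2 + (p * a0 * t) *\<^sub>R pos.v1) *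
       (exp (a1 *\<^sub>R e2 + (a1 * t) *\<^sub>R pos.v1) * exp (pos.heis (0, 0, a2, a3 / t - b, t * b)))))"
    by (simp only: mult.assoc[symmetric] xm_sl2(1)[OF t])
  also have "exp (t *\<^sub>R e1) * (exp (q *\<^sub>R e2 + (p * a0 * t) *\<^sub>R pos.v1) *
       (exp (a1 *\<^sub>R e2 + (a1 * t) *\<^sub>R pos.v1) * exp (pos.heis (0, 0, a2, a3 / t - b, t * b)))) =
     exp (pos.heis (t, 0, 0, 0, 0)) * (exp (q *\<^sub>R e2) * (exp (pos.heis (hsplit q (p * a0 * t))) *
       (exp (a1 *\<^sub>R e2) * (exp (pos.heis (hsplit a1 (a1 * t))) * exp (pos.heis (0, 0, a2, a3 / t - b, t * b))))))"
    by (simp add: pos.exp_split mult.assoc) (simp add: pos.heis_def)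
  also have "\<dots> = exp ((q + a1) *\<^sub>R e2) * exp (pos.heis (snd (step_one t u)))"
  proof -
    have sh: "exp (pos.heis a) * (exp (s *\<^sub>R e2) * Z) = exp (s *\<^sub>R e2) * (exp (pos.heis (hshift (- s) a)) * Z)" for a s Z
      by (simp only: mult.assoc[symmetric] pos.exp_heis_y)
    have hm: "exp (pos.heis a) * (exp (pos.heis b) * Z) = exp (pos.heis (hmul a b)) * Z" for a b Z
      by (simp only: mult.assoc[symmetric] pos.exp_heis_mult)
    have ad: "exp (q *\<^sub>R e2) * (exp (a1 *\<^sub>R e2) * Z) = exp ((q + a1) *\<^sub>R e2) * Z" for Z
      by (simp add: mult.assoc[symmetric] scaleR_add_left exp_add_commuting)
    have ss: "hshift (- a1) (hshift (- q) a) = hshift (- (q + a1)) a" for a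
      by (cases a) (simp add: algebra_simps power2_eq_square power3_eq_cube)
    have hs: "hshift (- a1) (hmul a b) = hmul (hshift (- a1) a) (hshift (- a1) b)" for a b
      by (cases a; cases b) (simp add: algebra_simps power2_eq_square power3_eq_cube add_divide_distrib diff_divide_distrib)
    show ?thesis
      by (simp only: sh hm pos.exp_heis_mult ss hs ad) (simp add: u Let_def q_def b_def hmul_assoc)
  qed
  finally show ?thesis by (simp add: pos.coord_def u Let_def q_def mult.assoc)
qed

lemma weyl_elem_xm: "s1 = exp (- e1) * xm1 1 * exp (- e1)" "s2 = exp (- e2) * xm2 1 * exp (- e2)"
proof -
  have "exp (- e1) * xm1 1 = s1 * exp e1" "exp (- e2) * xm2 1 = s2 * exp e2"
    using xm_sl2[of 1 "-1"] by simp_all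
  thus "s1 = exp (- e1) * xm1 1 * exp (- e1)" "s2 = exp (- e2) * xm2 1 * exp (- e2)"
    by (simp_all add: mult.assoc exp_minus_inverse)
qed

text \<open>
  Since \<open>s = exp (- e) x_-(1) exp (- e)\<close>, multiplication by \<open>s\<close> is one more step of the
  recursion with parameter 1; the shift of the character by \<open>exp (- e)\<close> cancels the summand
  \<open>1 / 1\<close>.
\<close>

lemma coord_weyl_elem:
  "\<exists>u'. pos.coord u * s1 = s1 * exp (- fst (snd u) *\<^sub>R f1) * pos.coord u' * exp (- e1)"
  "\<exists>u'. pos.coord u * s2 = s2 * exp (- fst u *\<^sub>R f2) * pos.coord u' * exp (- e2)"
proof -
  obtain p a where u: "u = (p, a)" by (cases u)
  obtain a0 a1 a2 a3 z where a: "a = (a0, a1, a2, a3, z)" by (cases a) auto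
  define u' where "u' = (p, hmul a (-1, 0, 0, 0, 0))"
  have 1: "pos.coord u * exp (- e1) = pos.coord u'"
    by (simp add: pos.coord_def u u'_def mult.assoc flip: pos.exp_heis_mult) (simp add: pos.heis_def)
  have 2: "fst (snd u') = fst (snd u) - 1" by (simp add: u'_def u a)
  have "pos.coord u * s1 = s1 * exp (- fst (snd u) *\<^sub>R f1) * pos.coord (step_one 1 u') * exp (- e1)"
  proof -
    have "pos.coord u * s1 = (pos.coord u * exp (- e1)) * xm1 1 * exp (- e1)"
      by (simp only: weyl_elem_xm(1) mult.assoc)
    also have "\<dots> = s1 * exp (- fst (snd u) *\<^sub>R f1) * pos.coord (step_one 1 u') * exp (- e1)"
      unfolding 1 by (subst coord_xm_one) (simp_all add: 2)
    finally show ?thesis .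
  qed
  thus "\<exists>u'. pos.coord u * s1 = s1 * exp (- fst (snd u) *\<^sub>R f1) * pos.coord u' * exp (- e1)" by (rule exI)
  define u'' where "u'' = (p - 1, hshift 1 a)"
  have "pos.coord u * exp (- e2) = exp (p *\<^sub>R e2) * exp (- 1 *\<^sub>R e2) * exp (pos.heis (hshift 1 a))"
    using pos.exp_heis_y[of a "-1"] by (simp add: pos.coord_def u mult.assoc)
  also have "exp (p *\<^sub>R e2) * exp (- 1 *\<^sub>R e2) = exp ((p - 1) *\<^sub>R e2)"
    by (subst exp_add_commuting[symmetric]) (simp_all add: algebra_simps)
  finally have 1: "pos.coord u * exp (- e2) = pos.coord u''" by (simp add: pos.coord_def u''_def)
  have 2: "fst u'' = fst u - 1" by (simp add: u''_def u)
  have "pos.coord u * s2 = s2 * exp (- fst u *\<^sub>R f2) * pos.coord (step_two 1 u'') * exp (- e2)"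
  proof -
    have "pos.coord u * s2 = (pos.coord u * exp (- e2)) * xm2 1 * exp (- e2)"
      by (simp only: weyl_elem_xm(2) mult.assoc)
    also have "\<dots> = s2 * exp (- fst u *\<^sub>R f2) * pos.coord (step_two 1 u'') * exp (- e2)"
      unfolding 1 by (subst coord_xm_two) (simp_all add: 2)
    finally show ?thesis .
  qed
  thus "\<exists>u'. pos.coord u * s2 = s2 * exp (- fst u *\<^sub>R f2) * pos.coord u' * exp (- e2)" by (rule exI)
qed

text \<open>
  The decomposition of the product of the \<open>x_{-i}(t)\<close> as the representative of the longest
  element, times a negative unipotent, times a positive unipotent element with known
  coordinates.
\<close>

lemma factorization:
  assumes t: "\<And>l. t l > 0"
    and S: "\<And>g h. g \<in> S \<Longrightarrow> h \<in> S \<Longrightarrow> g * h \<in> S" "\<And>t. exp (t *\<^sub>R f1) \<in> S" "\<And>t. exp (t *\<^sub>R f2) \<in> S"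
  shows "\<exists>y\<in>S. xm1 (t 1) * xm2 (t 2) * xm1 (t 3) * xm2 (t 4) * xm1 (t 5) * xm2 (t 6) =
      s1 * s2 * s1 * s2 * s1 * s2 * y * pos.coord (coord_one t)"
    and "\<exists>y\<in>S. xm2 (t 1) * xm1 (t 2) * xm2 (t 3) * xm1 (t 4) * xm2 (t 5) * xm1 (t 6) =
      s2 * s1 * s2 * s1 * s2 * s1 * y * pos.coord (coord_two t)"
proof -
  have start: "pos.coord start = 1" by (simp add: pos.coord_def start_def pos.heis_def)
  have m: "Y * pos.coord u * xm1 (t l) = Y * (s1 * exp (- (1 / t l + fst (snd u)) *\<^sub>R f1)) * pos.coord (step_one (t l) u)"
    "Y * pos.coord u * xm2 (t l) = Y * (s2 * exp (- (1 / t l + fst u) *\<^sub>R f2)) * pos.coord (step_two (t l) u)" for Y u l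
    by (simp_all only: mult.assoc coord_xm_one[OF t] coord_xm_two[OF t])
  have "\<exists>c1 c2 c3 c4 c5 c6. 1 * pos.coord start * xm1 (t 1) * xm2 (t 2) * xm1 (t 3) * xm2 (t 4) * xm1 (t 5) * xm2 (t 6) =
      1 * z1 c1 * z2 c2 * z1 c3 * z2 c4 * z1 c5 * z2 c6 * pos.coord (coord_one t)"
    unfolding m coord_one_def by (intro exI) (rule refl)
  then obtain c1 c2 c3 c4 c5 c6 where "1 * pos.coord start * xm1 (t 1) * xm2 (t 2) * xm1 (t 3) * xm2 (t 4) * xm1 (t 5) * xm2 (t 6) =
      1 * z1 c1 * z2 c2 * z1 c3 * z2 c4 * z1 c5 * z2 c6 * pos.coord (coord_one t)" by (elim exE)
  hence E: "xm1 (t 1) * xm2 (t 2) * xm1 (t 3) * xm2 (t 4) * xm1 (t 5) * xm2 (t 6) =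
      1 * z1 c1 * z2 c2 * z1 c3 * z2 c4 * z1 c5 * z2 c6 * pos.coord (coord_one t)" by (simp only: start mult_1_left)
  obtain y where y: "y \<in> S" "z1 c1 * z2 c2 * z1 c3 * z2 c4 * z1 c5 * z2 c6 = s1 * s2 * s1 * s2 * s1 * s2 * y"
  proof -
    have "\<exists>y\<in>S. z1 c1 * z2 c2 * z1 c3 * z2 c4 * z1 c5 * z2 c6 = s1 * s2 * s1 * s2 * s1 * s2 * y"
      by (rule neg_word(1)) (simp_all add: S)
    thus ?thesis using that by (elim bexE)
  qed
  show "\<exists>y\<in>S. xm1 (t 1) * xm2 (t 2) * xm1 (t 3) * xm2 (t 4) * xm1 (t 5) * xm2 (t 6) =
      s1 * s2 * s1 * s2 * s1 * s2 * y * pos.coord (coord_one t)"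
    by (rule bexI[OF _ y(1)]) (simp only: E y(2) mult_1_left)
  have "\<exists>c1 c2 c3 c4 c5 c6. 1 * pos.coord start * xm2 (t 1) * xm1 (t 2) * xm2 (t 3) * xm1 (t 4) * xm2 (t 5) * xm1 (t 6) =
      1 * z2 c1 * z1 c2 * z2 c3 * z1 c4 * z2 c5 * z1 c6 * pos.coord (coord_two t)"
    unfolding m coord_two_def by (intro exI) (rule refl)
  then obtain c1 c2 c3 c4 c5 c6 where "1 * pos.coord start * xm2 (t 1) * xm1 (t 2) * xm2 (t 3) * xm1 (t 4) * xm2 (t 5) * xm1 (t 6) =
      1 * z2 c1 * z1 c2 * z2 c3 * z1 c4 * z2 c5 * z1 c6 * pos.coord (coord_two t)" by (elim exE)
  hence E: "xm2 (t 1) * xm1 (t 2) * xm2 (t 3) * xm1 (t 4) * xm2 (t 5) * xm1 (t 6) =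
      1 * z2 c1 * z1 c2 * z2 c3 * z1 c4 * z2 c5 * z1 c6 * pos.coord (coord_two t)" by (simp only: start mult_1_left)
  obtain y where y: "y \<in> S" "z2 c1 * z1 c2 * z2 c3 * z1 c4 * z2 c5 * z1 c6 = s2 * s1 * s2 * s1 * s2 * s1 * y"
  proof -
    have "\<exists>y\<in>S. z2 c1 * z1 c2 * z2 c3 * z1 c4 * z2 c5 * z1 c6 = s2 * s1 * s2 * s1 * s2 * s1 * y"
      by (rule neg_word(2)) (simp_all add: S)
    thus ?thesis using that by (elim bexE)
  qed
  show "\<exists>y\<in>S. xm2 (t 1) * xm1 (t 2) * xm2 (t 3) * xm1 (t 4) * xm2 (t 5) * xm1 (t 6) =
      s2 * s1 * s2 * s1 * s2 * s1 * y * pos.coord (coord_two t)"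
    by (rule bexI[OF _ y(1)]) (simp only: E y(2) mult_1_left)
qed

text \<open>
  After \<open>coord_weyl_elem\<close>, the identity
  \<open>s exp (- c f) = exp (f / c) c\<^sup>h exp (- e / c)\<close> in \<open>SL\<^sub>2\<close> exhibits the torus part \<open>c\<^sup>h\<close>, where \<open>c\<close> is the value
  of the character.
\<close>

lemma coord_big_cell:
  assumes S: "\<And>g h. g \<in> S \<Longrightarrow> h \<in> S \<Longrightarrow> g * h \<in> S" "\<And>t. exp (t *\<^sub>R f1) \<in> S" "\<And>t. exp (t *\<^sub>R f2) \<in> S"
    and S': "\<And>g h. g \<in> S' \<Longrightarrow> h \<in> S' \<Longrightarrow> g * h \<in> S'" "\<And>t. exp (t *\<^sub>R e1) \<in> S'" "\<And>t. exp (t *\<^sub>R e2) \<in> S'"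
    and y: "y \<in> S"
  shows "fst (snd u) > 0 \<Longrightarrow> \<exists>y'\<in>S. \<exists>x\<in>S'. y * pos.coord u * s1 = y' * tp1 (fst (snd u)) * x"
    and "fst u > 0 \<Longrightarrow> \<exists>y'\<in>S. \<exists>x\<in>S'. y * pos.coord u * s2 = y' * tp2 (fst u) * x"
proof -
  have co: "pos.coord v \<in> S'" for v
    unfolding pos.coord_def by (intro S' pos.root_subgroups)
  have me: "exp (- e1) \<in> S'" "exp (- e2) \<in> S'" using S'(2)[of "-1"] S'(3)[of "-1"] by simp_all
  show "\<exists>y'\<in>S. \<exists>x\<in>S'. y * pos.coord u * s1 = y' * tp1 (fst (snd u)) * x" if c: "fst (snd u) > 0"
  proof -
    let ?c = "fst (snd u)"
    obtain v where v: "pos.coord u * s1 = s1 * exp (- ?c *\<^sub>R f1) * pos.coord v * exp (- e1)"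
      using coord_weyl_elem(1)[of u] by (elim exE)
    have "y * pos.coord u * s1 = (y * exp ((1 / ?c) *\<^sub>R f1)) * tp1 ?c * (exp (- (1 / ?c) *\<^sub>R e1) * pos.coord v * exp (- e1))"
      unfolding mult.assoc[of y] v tp_sl2(1)[OF c] by (simp only: mult.assoc)
    thus ?thesis
      by (intro bexI) (assumption | intro S S' y co me)+
  qed
  show "\<exists>y'\<in>S. \<exists>x\<in>S'. y * pos.coord u * s2 = y' * tp2 (fst u) * x" if c: "fst u > 0"
  proof -
    let ?c = "fst u"
    obtain v where v: "pos.coord u * s2 = s2 * exp (- ?c *\<^sub>R f2) * pos.coord v * exp (- e2)"
      using coord_weyl_elem(2)[of u] by (elim exE)
    have "y * pos.coord u * s2 = (y * exp ((1 / ?c) *\<^sub>R f2)) * tp2 ?c * (exp (- (1 / ?c) *\<^sub>R e2) * pos.coord v * exp (- e2))"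
      unfolding mult.assoc[of y] v tp_sl2(2)[OF c] by (simp only: mult.assoc)
    thus ?thesis
      by (intro bexI) (assumption | intro S S' y co me)+
  qed
qed

end

section \<open>Complex matrices as a Banach algebra\<close>

text \<open>
  Multiplication on the type of matrices is entrywise. A copy of this type carries the matrix
  product as its multiplication and becomes a Banach algebra, so that the exponential series and
  its derivatives are available. The norm is the largest absolute row sum, for which the identity
  matrix has norm 1.
\<close>

typedef (overloaded) ('n::finite) matalg = "UNIV :: 'n cmat set"
  morphisms mat_of alg_of by simp

lemma mat_of_alg_of [simp]: "mat_of (alg_of A) = A"
  by (simp add: alg_of_inverse)

lemmas alg_of_mat_of [simp] = mat_of_inverse

lemma matalg_eqI: "mat_of A = mat_of B \<Longrightarrow> A = B"
  by (simp add: mat_of_inject)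

definition row_norm :: "'n::finite cmat \<Rightarrow> real" where
  "row_norm A = Max (range (\<lambda>r. \<Sum>s\<in>UNIV. norm (A $ r $ s)))"

lemma row_norm_le_iff: "row_norm A \<le> c \<longleftrightarrow> (\<forall>r. (\<Sum>s\<in>UNIV. norm (A $ r $ s)) \<le> c)"
  unfolding row_norm_def by (subst Max_le_iff) auto

lemma row_sum_le: "(\<Sum>s\<in>UNIV. norm (A $ r $ s)) \<le> row_norm A"
  using row_norm_le_iff[of A "row_norm A"] by simp

lemma entry_le: "norm (A $ r $ s) \<le> row_norm A"
proof -
  have "norm (A $ r $ s) \<le> (\<Sum>s\<in>UNIV. norm (A $ r $ s))"
    by (rule member_le_sum[of s UNIV "\<lambda>s. norm (A $ r $ s)"]) auto
  thus ?thesis using row_sum_le[of A r] by linarith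
qed

lemma row_norm_ge_0: "0 \<le> row_norm A"
  using entry_le[of A undefined undefined] norm_ge_zero order_trans by blast

lemma row_norm_add: "row_norm (A + B) \<le> row_norm A + row_norm B"
  unfolding row_norm_le_iff
proof
  fix r
  have "(\<Sum>s\<in>UNIV. norm ((A + B) $ r $ s)) \<le> (\<Sum>s\<in>UNIV. norm (A $ r $ s) + norm (B $ r $ s))"
    by (intro sum_mono) (simp add: norm_triangle_ineq)
  thus "(\<Sum>s\<in>UNIV. norm ((A + B) $ r $ s)) \<le> row_norm A + row_norm B"
    using row_sum_le[of A r] row_sum_le[of B r] by (simp add: sum.distrib)
qed

lemma row_norm_mult: "row_norm (A ** B) \<le> row_norm A * row_norm B"
  unfolding row_norm_le_iff
proof
  fix r
  have "(\<Sum>s\<in>UNIV. norm ((A ** B) $ r $ s)) \<le> (\<Sum>s\<in>UNIV. \<Sum>k\<in>UNIV. norm (A $ r $ k) * norm (B $ k $ s))"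
    by (intro sum_mono) (simp add: matrix_matrix_mult_def sum_norm_le norm_mult)
  also have "\<dots> = (\<Sum>k\<in>UNIV. norm (A $ r $ k) * (\<Sum>s\<in>UNIV. norm (B $ k $ s)))"
    by (subst sum.swap) (simp add: sum_distrib_left)
  also have "\<dots> \<le> (\<Sum>k\<in>UNIV. norm (A $ r $ k) * row_norm B)"
    by (intro sum_mono mult_left_mono row_sum_le) auto
  also have "\<dots> \<le> row_norm A * row_norm B"
    unfolding sum_distrib_right[symmetric] by (intro mult_right_mono row_sum_le row_norm_ge_0)
  finally show "(\<Sum>s\<in>UNIV. norm ((A ** B) $ r $ s)) \<le> row_norm A * row_norm B" .
qed

lemma row_norm_scaleR:
  fixes A :: "'n::finite cmat"
  shows "row_norm (c *\<^sub>R A) = \<bar>c\<bar> * row_norm A"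
proof -
  have le: "row_norm (c *\<^sub>R A) \<le> \<bar>c\<bar> * row_norm A" for c :: real and A :: "'n cmat"
    unfolding row_norm_le_iff using row_sum_le[of A]
    by (simp add: sum_distrib_left[symmetric] mult_left_mono)
  show ?thesis
  proof (cases "c = 0")
    case False
    have "row_norm A \<le> \<bar>inverse c\<bar> * row_norm (c *\<^sub>R A)"
      using le[of "inverse c" "c *\<^sub>R A"] False by simp
    hence "\<bar>c\<bar> * row_norm A \<le> \<bar>c\<bar> * (\<bar>inverse c\<bar> * row_norm (c *\<^sub>R A))"
      by (intro mult_left_mono) auto
    also have "\<dots> = row_norm (c *\<^sub>R A)" using False by (simp add: abs_inverse)
    finally show ?thesis using le[of c A] by linarith
  qed (use le[of 0 A] row_norm_ge_0[of "0 *\<^sub>R A"] in simp)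
qed

lemma row_norm_0: "row_norm A = 0 \<longleftrightarrow> A = 0"
proof
  assume "row_norm A = 0"
  hence "norm (A $ r $ s) \<le> 0" for r s using entry_le[of A r s] by simp
  thus "A = 0" by (simp add: vec_eq_iff)
next
  assume "A = 0"
  thus "row_norm A = 0" using row_norm_scaleR[of 0 A] by simp
qed

lemma row_norm_1: "row_norm (mat 1 :: 'n::finite cmat) = 1"
proof -
  have "(\<Sum>s\<in>UNIV. norm (mat 1 $ r $ s :: complex)) = 1" for r :: 'n
    by (simp add: mat_def if_distrib[of norm] cong: if_cong)
  thus ?thesis unfolding row_norm_def by simp
qed

instantiation matalg :: (finite) real_algebra_1
begin

definition zero_matalg :: "'a matalg" where "zero_matalg = alg_of 0"
definition one_matalg :: "'a matalg" where "one_matalg = alg_of (mat 1)"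
definition plus_matalg :: "'a matalg \<Rightarrow> 'a matalg \<Rightarrow> 'a matalg"
  where "plus_matalg A B = alg_of (mat_of A + mat_of B)"
definition minus_matalg :: "'a matalg \<Rightarrow> 'a matalg \<Rightarrow> 'a matalg"
  where "minus_matalg A B = alg_of (mat_of A - mat_of B)"
definition uminus_matalg :: "'a matalg \<Rightarrow> 'a matalg"
  where "uminus_matalg A = alg_of (- mat_of A)"
definition times_matalg :: "'a matalg \<Rightarrow> 'a matalg \<Rightarrow> 'a matalg"
  where "times_matalg A B = alg_of (mat_of A ** mat_of B)"
definition scaleR_matalg :: "real \<Rightarrow> 'a matalg \<Rightarrow> 'a matalg"
  where "scaleR_matalg c A = alg_of (c *\<^sub>R mat_of A)"

instance
proof
  fix A B C :: "'a matalg" and c d :: real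
  note d = zero_matalg_def one_matalg_def plus_matalg_def minus_matalg_def uminus_matalg_def
    times_matalg_def scaleR_matalg_def
  show "A + B + C = A + (B + C)" "A + B = B + A" "0 + A = A" "- A + A = 0" "A - B = A + - B"
    by (simp_all add: d algebra_simps)
  show "c *\<^sub>R (A + B) = c *\<^sub>R A + c *\<^sub>R B" "(c + d) *\<^sub>R A = c *\<^sub>R A + d *\<^sub>R A" "c *\<^sub>R d *\<^sub>R A = (c * d) *\<^sub>R A"
    "1 *\<^sub>R A = A"
    by (simp_all add: d scaleR_add_right scaleR_add_left)
  show "A * B * C = A * (B * C)" "1 * A = A" "A * 1 = A"
    by (simp_all add: d matrix_mul_assoc)
  show "(A + B) * C = A * C + B * C" "A * (B + C) = A * B + A * C"
    by (simp_all add: d alg_of_inject matrix_matrix_mult_def vec_eq_iff sum.distrib algebra_simps)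
  show "c *\<^sub>R A * B = c *\<^sub>R (A * B)" "A * c *\<^sub>R B = c *\<^sub>R (A * B)"
    by (simp_all add: d alg_of_inject matrix_matrix_mult_def vec_eq_iff scaleR_sum_right)
  show "(0 :: 'a matalg) \<noteq> 1"
    by (simp add: d alg_of_inject mat_def vec_eq_iff)
qed

end

lemma mat_of_simps [simp]:
  "mat_of 0 = 0" "mat_of 1 = mat 1" "mat_of (A + B) = mat_of A + mat_of B" "mat_of (A - B) = mat_of A - mat_of B"
  "mat_of (- A) = - mat_of A" "mat_of (A * B) = mat_of A ** mat_of B" "mat_of (c *\<^sub>R A) = c *\<^sub>R mat_of A"
  by (simp_all add: zero_matalg_def one_matalg_def plus_matalg_def minus_matalg_def uminus_matalg_def
    times_matalg_def scaleR_matalg_def)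

instantiation matalg :: (finite) real_normed_algebra_1
begin

definition norm_matalg :: "'a matalg \<Rightarrow> real" where "norm_matalg A = row_norm (mat_of A)"
definition dist_matalg :: "'a matalg \<Rightarrow> 'a matalg \<Rightarrow> real" where "dist_matalg A B = norm (A - B)"
definition sgn_matalg :: "'a matalg \<Rightarrow> 'a matalg" where "sgn_matalg A = A /\<^sub>R norm A"
definition uniformity_matalg :: "('a matalg \<times> 'a matalg) filter" where
  "uniformity_matalg = (INF e\<in>{0 <..}. principal {(A, B). dist A B < e})"
definition open_matalg :: "'a matalg set \<Rightarrow> bool" where
  "open_matalg S \<longleftrightarrow> (\<forall>A\<in>S. eventually (\<lambda>(A', B). A' = A \<longrightarrow> B \<in> S) uniformity)"

instance
proof
  fix A B C :: "'a matalg" and c d :: real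
  show "dist A B = norm (A - B)" by (rule dist_matalg_def)
  show "sgn A = A /\<^sub>R norm A" by (rule sgn_matalg_def)
  show "uniformity = (INF e\<in>{0 <..}. principal {(A, B :: 'a matalg). dist A B < e})"
    by (rule uniformity_matalg_def)
  show "open S \<longleftrightarrow> (\<forall>A\<in>S. eventually (\<lambda>(A', B). A' = A \<longrightarrow> B \<in> S) uniformity)" for S :: "'a matalg set"
    by (rule open_matalg_def)
  show "norm A = 0 \<longleftrightarrow> A = 0"
    by (simp add: norm_matalg_def row_norm_0 flip: mat_of_inject)
  show "norm (A + B) \<le> norm A + norm B"
    by (simp add: norm_matalg_def row_norm_add)
  show "norm (c *\<^sub>R A) = \<bar>c\<bar> * norm A"
    by (simp add: norm_matalg_def row_norm_scaleR)
  show "norm (A * B) \<le> norm A * norm B"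
    by (simp add: norm_matalg_def row_norm_mult)
  show "norm (1 :: 'a matalg) = 1"
    by (simp add: norm_matalg_def row_norm_1)
qed

end

lemma alg_of_mult: "alg_of (A ** B) = alg_of A * alg_of B"
  by (rule matalg_eqI) simp

lemma bounded_linear_entry: "bounded_linear (\<lambda>A. mat_of A $ r $ s)"
  by (rule bounded_linear_intro[where K = 1]) (simp_all add: norm_matalg_def entry_le)

instance matalg :: (finite) banach
proof
  fix X :: "nat \<Rightarrow> 'a matalg"
  assume X: "Cauchy X"
  have "convergent (\<lambda>n. mat_of (X n) $ r $ s)" for r s
    using bounded_linear.Cauchy[OF bounded_linear_entry X] Cauchy_convergent_iff by blast
  then obtain l where l: "\<And>r s. (\<lambda>n. mat_of (X n) $ r $ s) \<longlonglongrightarrow> l r s"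
    unfolding convergent_def by metis
  define L where "L = alg_of (\<chi> r s. l r s)"
  have "(\<lambda>n. norm (X n - L)) \<longlonglongrightarrow> 0"
  proof (rule tendsto_sandwich[OF always_eventually always_eventually tendsto_const])
    show "\<forall>n. norm (X n - L) \<le> (\<Sum>r\<in>UNIV. \<Sum>s\<in>UNIV. norm (mat_of (X n) $ r $ s - l r s))"
    proof
      fix n
      have "(\<Sum>s\<in>UNIV. norm (mat_of (X n - L) $ r $ s)) \<le> (\<Sum>r\<in>UNIV. \<Sum>s\<in>UNIV. norm (mat_of (X n) $ r $ s - l r s))" for r
        using member_le_sum[of r UNIV "\<lambda>r. \<Sum>s\<in>UNIV. norm (mat_of (X n) $ r $ s - l r s)"]
        by (simp add: L_def sum_nonneg)
      thus "norm (X n - L) \<le> (\<Sum>r\<in>UNIV. \<Sum>s\<in>UNIV. norm (mat_of (X n) $ r $ s - l r s))"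
        by (simp add: norm_matalg_def row_norm_le_iff del: mat_of_simps)
    qed
    have "(\<lambda>n. norm (mat_of (X n) $ r $ s - l r s)) \<longlonglongrightarrow> 0" for r s
      using l[of r s] by (simp add: LIM_zero tendsto_norm_zero)
    thus "(\<lambda>n. \<Sum>r\<in>UNIV. \<Sum>s\<in>UNIV. norm (mat_of (X n) $ r $ s - l r s)) \<longlonglongrightarrow> 0"
      by (intro tendsto_null_sum)
  qed simp
  hence "X \<longlonglongrightarrow> L" by (simp add: tendsto_norm_zero_iff LIM_zero_iff)
  thus "convergent X" by (auto simp: convergent_def)
qed

lemma mat_of_exp: "mat_of (exp X) = mexp (mat_of X)"
proof -
  have pow: "mat_of (X ^ k) = (((**) (mat_of X)) ^^ k) (mat 1)" for k
    by (induction k) simp_all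
  have "(\<lambda>k. mat_of (X ^ k /\<^sub>R fact k) $ r $ s) sums (mat_of (exp X) $ r $ s)" for r s
    by (rule bounded_linear.sums[OF bounded_linear_entry exp_converges])
  hence "(\<lambda>n. (\<Sum>k<n. mat_of (X ^ k /\<^sub>R fact k)) $ r $ s) \<longlonglongrightarrow> mat_of (exp X) $ r $ s" for r s
    by (simp add: sums_def)
  hence "(\<lambda>k. mat_of (X ^ k /\<^sub>R fact k)) sums mat_of (exp X)"
    unfolding sums_def by (intro vec_tendstoI)
  thus ?thesis
    unfolding mexp_def by (simp add: pow sums_unique inverse_eq_divide)
qed

lemma alg_of_mexp: "alg_of (mexp X) = exp (alg_of X)"
  by (rule matalg_eqI) (simp add: mat_of_exp)

section \<open>Rank one subgroups and the torus\<close>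

text \<open>
  In \<open>SL\<^sub>2\<close> one has \<open>diag(t, 1/t) = y(1/t - 1) x(1) y(t - 1) x(- 1/t)\<close>. Differentiating at \<open>t = 1\<close> gives
  \<open>h\<close>, and a one-parameter group is determined by its derivative at the origin.
\<close>

lemma one_parameter_torus:
  fixes \<gamma> :: "real \<Rightarrow> 'a::{real_normed_algebra_1,banach}"
  assumes ef: "br e f = h" and he: "br h e = 2 *\<^sub>R e"
    and add: "\<And>r s. \<gamma> (r + s) = \<gamma> r * \<gamma> s"
    and \<gamma>: "\<And>r. \<gamma> r = exp ((exp (- r) - 1) *\<^sub>R f) * exp e * exp ((exp r - 1) *\<^sub>R f) * exp (- exp (- r) *\<^sub>R e)"
  shows "\<gamma> r = exp (r *\<^sub>R h)"
proof -
  have D1: "((\<lambda>r. exp ((exp (- r) - 1) *\<^sub>R f)) has_vector_derivative - f) (at (0::real))"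
  proof -
    have "((\<lambda>r::real. exp (- r) - 1) has_vector_derivative -1) (at 0)"
      unfolding has_real_derivative_iff_has_vector_derivative[symmetric]
      by (auto intro!: derivative_eq_intros)
    from vector_diff_chain_at[OF this exp_scaleR_has_vector_derivative_right[of f]]
    show ?thesis by (simp add: o_def)
  qed
  have D2: "((\<lambda>r. exp ((exp r - 1) *\<^sub>R f)) has_vector_derivative f) (at (0::real))"
  proof -
    have "((\<lambda>r::real. exp r - 1) has_vector_derivative 1) (at 0)"
      unfolding has_real_derivative_iff_has_vector_derivative[symmetric]
      by (auto intro!: derivative_eq_intros)
    from vector_diff_chain_at[OF this exp_scaleR_has_vector_derivative_right[of f]]
    show ?thesis by (simp add: o_def)
  qed
  have D3: "((\<lambda>r. exp (- exp (- r) *\<^sub>R e)) has_vector_derivative exp (- e) * e) (at (0::real))"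
  proof -
    have "((\<lambda>r::real. - exp (- r)) has_vector_derivative 1) (at 0)"
      unfolding has_real_derivative_iff_has_vector_derivative[symmetric]
      by (auto intro!: derivative_eq_intros)
    from vector_diff_chain_at[OF this exp_scaleR_has_vector_derivative_right[of e]]
    show ?thesis by (simp add: o_def)
  qed
  have inv: "exp e * exp (- e) = 1" by (rule exp_minus_inverse)
  have "exp e * f = (f + h - e) * exp e"
    using exp_conj_nilpotent[of e f h "(-2) *\<^sub>R e" 0 1] he ef by (simp add: br_swap[of e h] br_linear)
  hence conj: "exp e * (f * exp (- e)) = f + h - e"
    by (simp flip: mult.assoc) (simp add: mult.assoc inv)
  have ee: "exp e * (exp (- e) * e) = e" using inv by (simp flip: mult.assoc)
  have "((\<lambda>r. exp ((exp (- r) - 1) *\<^sub>R f) * exp e * exp ((exp r - 1) *\<^sub>R f) * exp (- exp (- r) *\<^sub>R e))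
    has_vector_derivative
      exp ((exp (- 0) - 1) *\<^sub>R f) * exp e * exp ((exp 0 - 1) *\<^sub>R f) * (exp (- e) * e) +
      (exp ((exp (- 0) - 1) *\<^sub>R f) * exp e * f + (exp ((exp (- 0) - 1) *\<^sub>R f) * 0 + - f * exp e) *
        exp ((exp 0 - 1) *\<^sub>R f)) * exp (- exp (- 0) *\<^sub>R e)) (at (0::real))"
    by (intro has_vector_derivative_mult D1 D2 D3 has_vector_derivative_const)
  hence g0: "(\<gamma> has_vector_derivative h) (at 0)"
    by (simp add: \<gamma>[abs_def] algebra_simps conj ee inv)
  have dg: "(\<gamma> has_vector_derivative \<gamma> r * h) (at r)" for r
  proof -
    have "((\<lambda>s. s - r) has_vector_derivative 1) (at r)"
      by (auto intro!: derivative_eq_intros)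
    from vector_diff_chain_at[OF this, of \<gamma> h] g0
    have "((\<lambda>s. \<gamma> (s - r)) has_vector_derivative h) (at r)" by (simp add: o_def)
    from has_vector_derivative_mult[OF has_vector_derivative_const[of "\<gamma> r"] this]
    have "((\<lambda>s. \<gamma> r * \<gamma> (s - r)) has_vector_derivative \<gamma> r * h) (at r)" by simp
    thus ?thesis by (simp flip: add)
  qed
  have "((\<lambda>r. \<gamma> r * exp (r *\<^sub>R (- h))) has_vector_derivative
      \<gamma> r * (- h * exp (r *\<^sub>R (- h))) + \<gamma> r * h * exp (r *\<^sub>R (- h))) (at r)" for r
    by (intro has_vector_derivative_mult dg exp_scaleR_has_vector_derivative_left)
  hence "((\<lambda>r. \<gamma> r * exp (r *\<^sub>R (- h))) has_vector_derivative 0) (at r)" for r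
    by (simp add: mult.assoc)
  then obtain c where c: "\<And>r. \<gamma> r * exp (r *\<^sub>R (- h)) = c"
    using has_vector_derivative_zero_constant[of UNIV "\<lambda>r. \<gamma> r * exp (r *\<^sub>R (- h))"] by auto
  have "\<gamma> 0 = 1" using exp_minus_inverse[of e] by (simp add: \<gamma>)
  hence "\<gamma> r * exp (- (r *\<^sub>R h)) = 1" using c[of 0] c[of r] by simp
  hence "\<gamma> r * (exp (- (r *\<^sub>R h)) * exp (r *\<^sub>R h)) = exp (r *\<^sub>R h)" by (simp flip: mult.assoc)
  moreover have "exp (- (r *\<^sub>R h)) * exp (r *\<^sub>R h) = 1" using exp_minus_inverse[of "- (r *\<^sub>R h)"] by simp
  ultimately show ?thesis by simp
qed

lemma poly_fun_holomorphic:
  assumes "p \<in> poly_fun" "\<And>r s. (\<lambda>z. A z $ r $ s) holomorphic_on S"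
  shows "(\<lambda>z. p (A z)) holomorphic_on S"
  using assms(1) by induction (auto intro!: holomorphic_intros assms(2))

text \<open>
  Positive reals accumulate inside the connected set of nonzero complex numbers; hence
  identities between functions of nonzero parameters need only be checked for positive ones.
\<close>

lemma holomorphic_zero_on_positive:
  assumes "f holomorphic_on - {0}" "\<And>x. x > 0 \<Longrightarrow> f (of_real x) = 0" "z \<noteq> 0"
  shows "f z = 0"
proof (rule analytic_continuation[where f = f and w = z and S = "- {0}" and U = "of_real ` {0<..}" and \<xi> = 1])
  show "connected (- {0 :: complex})" by (rule connected_punctured_universe) simp
  have "(\<lambda>n. 1 + 1 / real (Suc n)) \<longlonglongrightarrow> 1 + 0"
    using LIMSEQ_inverse_real_of_nat by (intro tendsto_intros) (simp add: inverse_eq_divide)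
  hence "(\<lambda>n. of_real (1 + 1 / real (Suc n)) :: complex) \<longlonglongrightarrow> of_real (1 + 0)"
    by (rule tendsto_of_real)
  moreover have "(of_real (1 + 1 / real (Suc n)) :: complex) \<in> of_real ` {0<..} - {1}" for n
  proof
    show "(of_real (1 + 1 / real (Suc n)) :: complex) \<in> of_real ` {0<..}"
      by (rule imageI) (simp add: add_pos_pos)
    show "(of_real (1 + 1 / real (Suc n)) :: complex) \<notin> {1}"
      using of_real_eq_1_iff[of "1 + 1 / real (Suc n)", where 'a = complex] by simp
  qed
  ultimately show "1 islimpt (of_real ` {0<..} :: complex set)"
    unfolding islimpt_sequential
    by (intro exI[of _ "\<lambda>n. of_real (1 + 1 / real (Suc n)) :: complex"] conjI allI) simp_all
  show "f holomorphic_on - {0}" by (rule assms(1))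
  show "f w = 0" if "w \<in> of_real ` {0<..}" for w using that assms(2) by auto
  show "of_real ` {0<..} \<subseteq> (- {0} :: complex set)" by auto
qed (use assms(3) in auto)

definition mat2 :: "complex \<Rightarrow> complex \<Rightarrow> complex \<Rightarrow> complex \<Rightarrow> 2 cmat" where
  "mat2 a b c d = vector [vector [a, b], vector [c, d]]"

lemma mat2_entries [simp]: "mat2 a b c d $ 1 $ 1 = a" "mat2 a b c d $ 1 $ 2 = b"
  "mat2 a b c d $ 2 $ 1 = c" "mat2 a b c d $ 2 $ 2 = d"
  by (simp_all add: mat2_def)

lemma mat2_mult: "mat2 a b c d ** mat2 a' b' c' d' =
    mat2 (a * a' + b * c') (a * b' + b * d') (c * a' + d * c') (c * b' + d * d')"
  by (simp add: matrix_matrix_mult_def vec_eq_iff forall_2 sum_2)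

lemma det_mat2: "det (mat2 a b c d) = a * d - b * c"
  by (simp add: det_2)

lemma alg_of_bracket: "alg_of (bracket X Y) = br (alg_of X) (alg_of Y)"
  by (rule matalg_eqI) (simp add: bracket_def br_def)

lemma alg_of_cscale: "alg_of (cscale (of_real r) X) = r *\<^sub>R alg_of X"
proof (rule matalg_eqI)
  show "mat_of (alg_of (cscale (of_real r) X)) = mat_of (r *\<^sub>R alg_of X)"
    unfolding mat_of_alg_of mat_of_simps by (simp add: cscale_def vec_eq_iff scaleR_conv_of_real[of r "_ :: complex"])
qed

lemma alg_of_xplus: "alg_of (xplus D i (of_real r)) = exp (r *\<^sub>R alg_of (gen_e D i))"
  and alg_of_yminus: "alg_of (yminus D i (of_real r)) = exp (r *\<^sub>R alg_of (gen_f D i))"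
  by (simp_all add: xplus_def yminus_def alg_of_mexp alg_of_cscale)

locale chevalley_group =
  fixes D :: "('n::finite) chevalley_data"
  assumes group: "simply_connected_simple_group D"
begin

abbreviation "G \<equiv> grp D"
abbreviation "T \<equiv> torus D"

lemma group_facts: "closed_connected_subgroup G" "closed_connected_subgroup T" "T \<subseteq> G"
    "closed_connected_subgroup (unip D)" "closed_connected_subgroup (unip_op D)"
    "diagonalizable_set T" "torus D = borel D \<inter> borel_op D"
    "subgroup (borel D) GL" "subgroup (borel_op D) GL" "unip D \<subseteq> borel D" "unip_op D \<subseteq> borel_op D"
    "borel D \<subseteq> G" "borel_op D \<subseteq> G" "\<And>g. g \<in> unip D \<Longrightarrow> unipotent g" "\<And>g. g \<in> unip_op D \<Longrightarrow> unipotent g"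
    and chevalley_rel: "chevalley_relations D" and sl2_homs: "canonical_sl2_homs D"
    and lie: "\<And>i. i \<in> idx D \<Longrightarrow> gen_e D i \<in> lie_algebra (unip D)" "\<And>i. i \<in> idx D \<Longrightarrow> gen_f D i \<in> lie_algebra (unip_op D)"
      "\<And>i. i \<in> idx D \<Longrightarrow> gen_h D i \<in> lie_algebra T"
    and cartan_diag: "\<And>i. i \<in> idx D \<Longrightarrow> cartan D i i = 2"
proof -
  note g = group[unfolded simply_connected_simple_group_def]
  show "closed_connected_subgroup G" using g by (simp add: simple_algebraic_group_def)
  show "closed_connected_subgroup T" "T \<subseteq> G" "diagonalizable_set T"
    using g by (auto simp: maximal_torus_def torus_in_def)
  show "closed_connected_subgroup (unip D)" "closed_connected_subgroup (unip_op D)"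
    using g by (auto simp: unipotent_radical_def unipotent_normal_in_def)
  show "torus D = borel D \<inter> borel_op D" using g by blast
  show "subgroup (borel D) GL" "subgroup (borel_op D) GL" "borel D \<subseteq> G" "borel_op D \<subseteq> G"
    using g by (auto simp: borel_subgroup_def solvable_connected_in_def closed_connected_subgroup_def)
  have "unip D \<lhd> as_group (borel D)" "unip_op D \<lhd> as_group (borel_op D)"
    using g by (auto simp: unipotent_radical_def unipotent_normal_in_def)
  thus "unip D \<subseteq> borel D" "unip_op D \<subseteq> borel_op D"
    by (auto dest!: normal_imp_subgroup subgroup.subset)
  show "\<And>g. g \<in> unip D \<Longrightarrow> unipotent g" "\<And>g. g \<in> unip_op D \<Longrightarrow> unipotent g"
    using g by (auto simp: unipotent_radical_def unipotent_normal_in_def)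
  show "chevalley_relations D" "canonical_sl2_homs D" using g by blast+
  show "\<And>i. i \<in> idx D \<Longrightarrow> gen_e D i \<in> lie_algebra (unip D)" "\<And>i. i \<in> idx D \<Longrightarrow> gen_f D i \<in> lie_algebra (unip_op D)"
      "\<And>i. i \<in> idx D \<Longrightarrow> gen_h D i \<in> lie_algebra T" "\<And>i. i \<in> idx D \<Longrightarrow> cartan D i i = 2"
    using g by blast+
qed

lemma phi_mult:
  assumes "i \<in> idx D" "det A = 1" "det B = 1"
  shows "phi D i (A ** B) = phi D i A ** phi D i B"
  using sl2_homs assms by (auto simp: canonical_sl2_homs_def hom_def SL_def GL_def)

lemma phi_in_group:
  assumes "i \<in> idx D" "det A = 1"
  shows "phi D i A \<in> G"
  using sl2_homs assms by (auto simp: canonical_sl2_homs_def hom_def SL_def)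

lemma xplus_phi: "i \<in> idx D \<Longrightarrow> xplus D i t = phi D i (mat2 1 t 0 1)"
  and yminus_phi: "i \<in> idx D \<Longrightarrow> yminus D i t = phi D i (mat2 1 0 t 1)"
  and tpow_phi: "tpow D i t = phi D i (mat2 t 0 0 (inverse t))"
  using sl2_homs by (auto simp: canonical_sl2_homs_def mat2_def tpow_def)

lemma xminus_phi:
  assumes "i \<in> idx D" "t \<noteq> 0"
  shows "xminus D i t = phi D i (mat2 (inverse t) 0 1 t)"
  using assms by (simp add: xminus_def yminus_phi tpow_phi det_mat2 mat2_mult flip: phi_mult)

lemma s_bar_phi: "i \<in> idx D \<Longrightarrow> s_bar D i = phi D i (mat2 0 (-1) 1 0)"
  by (simp add: s_bar_def yminus_phi xplus_phi det_mat2 mat2_mult flip: phi_mult)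

lemma xplus_xminus:
  assumes "i \<in> idx D" "t \<noteq> 0"
  shows "xplus D i c ** xminus D i t = s_bar D i ** yminus D i (- (1 / t + c)) ** xplus D i t"
  using assms
  by (simp add: xminus_phi yminus_phi xplus_phi s_bar_phi det_mat2 mat2_mult add_divide_distrib
      diff_divide_distrib algebra_simps inverse_eq_divide flip: phi_mult)

lemma s_bar_yminus:
  assumes "i \<in> idx D" "c \<noteq> 0"
  shows "s_bar D i ** yminus D i (- c) = yminus D i (1 / c) ** tpow D i c ** xplus D i (- (1 / c))"
  using assms
  by (simp add: tpow_phi yminus_phi xplus_phi s_bar_phi det_mat2 mat2_mult field_simps flip: phi_mult)

lemma s_bar_square: "i \<in> idx D \<Longrightarrow> s_bar D i ** s_bar D i = tpow D i (-1)"
  by (simp add: tpow_phi s_bar_phi det_mat2 mat2_mult flip: phi_mult)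

lemma tpow_mult: "i \<in> idx D \<Longrightarrow> a \<noteq> 0 \<Longrightarrow> b \<noteq> 0 \<Longrightarrow> tpow D i (a * b) = tpow D i a ** tpow D i b"
  by (simp add: tpow_phi det_mat2 mat2_mult flip: phi_mult)

lemma phi_holomorphic:
  assumes i: "i \<in> idx D" and A: "\<And>r s. (\<lambda>z. A z $ r $ s) holomorphic_on S" and det: "\<And>z. z \<in> S \<Longrightarrow> det (A z) = 1"
  shows "(\<lambda>z. phi D i (A z) $ r $ s) holomorphic_on S"
proof -
  have "regular_on (carrier SL) (\<lambda>A. phi D i A $ r $ s)"
    using sl2_homs i by (auto simp: canonical_sl2_homs_def)
  then obtain p k where p: "p \<in> poly_fun" "\<And>g. g \<in> carrier SL \<Longrightarrow> phi D i g $ r $ s = p g / det g ^ k"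
    unfolding regular_on_def by blast
  have "(\<lambda>z. p (A z)) holomorphic_on S" by (rule poly_fun_holomorphic[OF p(1) A])
  moreover have "p (A z) = phi D i (A z) $ r $ s" if "z \<in> S" for z
    using p(2)[of "A z"] det[OF that] by (simp add: SL_def)
  ultimately show ?thesis by (simp cong: holomorphic_cong)
qed

lemma tpow_exp:
  assumes i: "i \<in> idx D"
  shows "alg_of (tpow D i (of_real (exp r))) = exp (r *\<^sub>R alg_of (gen_h D i))"
proof (rule one_parameter_torus[where e = "alg_of (gen_e D i)" and f = "alg_of (gen_f D i)"
      and \<gamma> = "\<lambda>r. alg_of (tpow D i (of_real (exp r)))"])
  have r: "bracket (gen_e D i) (gen_f D i) = gen_h D i"
    "bracket (gen_h D i) (gen_e D i) = cscale (of_int (cartan D i i)) (gen_e D i)"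
    using chevalley_rel i by (auto simp: chevalley_relations_def)
  show "br (alg_of (gen_e D i)) (alg_of (gen_f D i)) = alg_of (gen_h D i)"
    by (simp add: r flip: alg_of_bracket)
  show "br (alg_of (gen_h D i)) (alg_of (gen_e D i)) = 2 *\<^sub>R alg_of (gen_e D i)"
    using alg_of_cscale[of 2 "gen_e D i"] by (simp add: r cartan_diag[OF i] flip: alg_of_bracket)
  show "alg_of (tpow D i (of_real (exp (r + s)))) = alg_of (tpow D i (of_real (exp r))) * alg_of (tpow D i (of_real (exp s)))" for r s
    by (simp add: exp_add tpow_mult i flip: alg_of_mult)
  show "alg_of (tpow D i (of_real (exp r))) =
      exp ((exp (- r) - 1) *\<^sub>R alg_of (gen_f D i)) * exp (alg_of (gen_e D i)) * exp ((exp r - 1) *\<^sub>R alg_of (gen_f D i)) *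
      exp (- exp (- r) *\<^sub>R alg_of (gen_e D i))" for r
  proof -
    define t where "t = complex_of_real (exp r)"
    have t: "t \<noteq> 0" "complex_of_real (exp (- r)) = inverse t" by (simp_all add: t_def exp_minus)
    have "tpow D i t = yminus D i (inverse t - 1) ** xplus D i 1 ** yminus D i (t - 1) ** xplus D i (- inverse t)"
      using i t(1) by (simp add: tpow_phi yminus_phi xplus_phi det_mat2 mat2_mult algebra_simps flip: phi_mult)
    hence "tpow D i (of_real (exp r)) = yminus D i (of_real (exp (- r) - 1)) ** xplus D i (of_real 1) **
        yminus D i (of_real (exp r - 1)) ** xplus D i (of_real (- exp (- r)))"
      by (simp only: t_def[symmetric] of_real_diff of_real_minus t(2) of_real_1)
    thus ?thesis by (simp only: alg_of_mult alg_of_xplus alg_of_yminus scaleR_one)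
  qed
qed

text \<open>
  For positive \<open>z\<close> the element is an exponential of a multiple of \<open>h\<close>. The polynomial equations
  that define the torus extend from there to all nonzero \<open>z\<close>.
\<close>

lemma tpow_in_torus:
  assumes i: "i \<in> idx D" and z: "z \<noteq> 0"
  shows "tpow D i z \<in> T"
proof -
  obtain P where P: "P \<subseteq> poly_fun" "T = {g. invertible g \<and> (\<forall>p\<in>P. p g = 0)}"
    using group_facts(2) by (auto simp: closed_connected_subgroup_def zariski_closed_def)
  have pos: "tpow D i (of_real x) \<in> T" if "x > 0" for x
  proof -
    have "alg_of (tpow D i (of_real (exp (ln x)))) = alg_of (mexp (cscale (of_real (ln x)) (gen_h D i)))"
      unfolding tpow_exp[OF i] alg_of_mexp alg_of_cscale ..
    hence "tpow D i (of_real x) = mexp (cscale (of_real (ln x)) (gen_h D i))"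
      using that by (simp add: alg_of_inject)
    thus ?thesis using lie(3)[OF i] by (simp add: lie_algebra_def)
  qed
  have "p (tpow D i z) = 0" if p: "p \<in> P" for p
  proof (rule holomorphic_zero_on_positive[OF _ _ z])
    show "(\<lambda>z. p (tpow D i z)) holomorphic_on - {0}"
    proof (rule poly_fun_holomorphic)
      show "p \<in> poly_fun" using p P by auto
      have "(\<lambda>z. mat2 z 0 0 (inverse z) $ r $ s) holomorphic_on - {0}" for r s
        by (cases r rule: exhaust_2[THEN disjE]; cases s rule: exhaust_2[THEN disjE])
           (auto intro!: holomorphic_intros)
      thus "(\<lambda>z. tpow D i z $ r $ s) holomorphic_on - {0}" for r s
        unfolding tpow_phi by (intro phi_holomorphic i) (auto simp: det_mat2)
    qed
    show "p (tpow D i (of_real x)) = 0" if "x > 0" for x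
      using pos[OF that] p P by auto
  qed
  moreover have "invertible (tpow D i z)"
  proof -
    have "tpow D i z \<in> G" unfolding tpow_phi by (rule phi_in_group) (use i z in \<open>auto simp: det_mat2\<close>)
    moreover have "G \<subseteq> carrier GL"
      using group_facts(1) by (auto simp: closed_connected_subgroup_def dest: subgroup.subset)
    ultimately show ?thesis by (auto simp: GL_def)
  qed
  ultimately show ?thesis using P by auto
qed

end

section \<open>Torus parts and the Weyl group\<close>

lemma matrix_inv:
  fixes A :: "'n::finite cmat"
  assumes "invertible A"
  shows "A ** matrix_inv A = mat 1" "matrix_inv A ** A = mat 1"
  using someI_ex[OF assms[unfolded invertible_def]] by (simp_all add: matrix_inv_def)

lemma unipotent_diagonalizable:
  fixes g :: "'n::finite cmat"
  assumes "unipotent g" "diagonalizable_set S" "g \<in> S"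
  shows "g = mat 1"
proof -
  have "\<exists>P :: 'n cmat. invertible P \<and> (\<forall>g\<in>S. \<forall>r s. r \<noteq> s \<longrightarrow> (P ** g ** matrix_inv P) $ r $ s = 0)"
    using assms(2) by (simp only: diagonalizable_set_def)
  then obtain P :: "'n cmat" where P1: "invertible P"
    and "\<forall>g\<in>S. \<forall>r s. r \<noteq> s \<longrightarrow> (P ** g ** matrix_inv P) $ r $ s = 0" by (elim exE conjE)
  hence P2: "(P ** g ** matrix_inv P) $ r $ s = 0" if "r \<noteq> s" for r s using that assms(3) by simp
  note P = P1 P2
  obtain k where k: "(((**) (g - mat 1)) ^^ k) (mat 1) = 0"
    using assms(1) by (auto simp: unipotent_def)
  have inv: "P ** matrix_inv P = mat 1" "matrix_inv P ** P = mat 1" using P(1) by (simp_all add: matrix_inv)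
  define M where "M = P ** g ** matrix_inv P - mat 1"
  have sub: "(X - Y) ** Z = X ** Z - Y ** Z" "Z ** (X - Y) = Z ** X - Z ** Y" for X Y Z :: "'n cmat"
    by (simp_all add: matrix_matrix_mult_def vec_eq_iff sum_subtractf algebra_simps)
  have MP: "M ** P = P ** (g - mat 1)"
    by (simp add: M_def sub inv flip: matrix_mul_assoc)
  have pow: "(((**) M) ^^ n) (mat 1) ** P = P ** (((**) (g - mat 1)) ^^ n) (mat 1)" for n
    by (induction n) (simp_all add: matrix_mul_assoc MP flip: matrix_mul_assoc, simp add: matrix_mul_assoc MP)
  have "(((**) M) ^^ k) (mat 1) ** (P ** matrix_inv P) = 0"
    by (simp only: matrix_mul_assoc pow k) simp
  hence Mk: "(((**) M) ^^ k) (mat 1) = 0" by (simp add: inv)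
  have diag: "M $ r $ s = 0" if "r \<noteq> s" for r s
    using P(2)[OF that] that by (simp add: M_def mat_def)
  have "(((**) M) ^^ n) (mat 1) $ r $ r = (M $ r $ r) ^ n" for n r
  proof (induction n)
    case (Suc n)
    have "(((**) M) ^^ Suc n) (mat 1) $ r $ r = (\<Sum>j\<in>UNIV. M $ r $ j * (((**) M) ^^ n) (mat 1) $ j $ r)"
      by (simp add: matrix_matrix_mult_def)
    also have "\<dots> = (\<Sum>j\<in>{r}. M $ r $ j * (((**) M) ^^ n) (mat 1) $ j $ r)"
      by (rule sum.mono_neutral_right) (auto simp: diag)
    finally show ?case by (simp add: Suc)
  qed (simp add: mat_def)
  hence "M $ r $ r = 0" for r using Mk by (metis power_eq_0_iff zero_index)
  hence "M = 0" using diag by (metis (no_types, lifting) vec_eq_iff zero_index)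
  hence "P ** (g - mat 1) = 0" using MP by simp
  hence "(matrix_inv P ** P) ** (g - mat 1) = 0" by (simp flip: matrix_mul_assoc)
  thus ?thesis by (simp add: inv)
qed

lemma GL_simps [simp]: "carrier GL = {g. invertible g}" "mult GL = (**)" "one GL = mat 1"
  by (simp_all add: GL_def)

lemma invertible_matrix_inv: "invertible (A :: 'n::finite cmat) \<Longrightarrow> invertible (matrix_inv A)"
  using matrix_inv invertible_def by metis

lemma group_GL: "group (GL :: ('n::finite cmat) monoid)"
proof (rule groupI)
  show "\<exists>y\<in>carrier GL. y \<otimes>\<^bsub>GL\<^esub> x = \<one>\<^bsub>GL\<^esub>" if "x \<in> carrier GL" for x :: "'n cmat"
    using that matrix_inv(2)[of x] invertible_matrix_inv[of x] by auto
qed (auto simp: invertible_mult matrix_mul_assoc invertible_def[of "mat 1"])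

lemma inv_GL: "invertible g \<Longrightarrow> inv\<^bsub>GL\<^esub> g = matrix_inv (g :: 'n::finite cmat)"
  using group.inv_equality[OF group_GL, of "matrix_inv g" g] by (simp add: matrix_inv invertible_matrix_inv)

lemma subgroup_GL:
  assumes "subgroup H GL"
  shows "a \<in> H \<Longrightarrow> b \<in> H \<Longrightarrow> a ** b \<in> H" "mat 1 \<in> H" "a \<in> H \<Longrightarrow> matrix_inv a \<in> H" "a \<in> H \<Longrightarrow> invertible a"
    "a \<in> H \<Longrightarrow> a ** matrix_inv a = mat 1" "a \<in> H \<Longrightarrow> matrix_inv a ** a = mat 1"
proof -
  show i: "a \<in> H \<Longrightarrow> invertible a" using subgroup.subset[OF assms] by auto
  show "a \<in> H \<Longrightarrow> b \<in> H \<Longrightarrow> a ** b \<in> H" using subgroup.m_closed[OF assms] by simp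
  show "mat 1 \<in> H" using subgroup.one_closed[OF assms] by simp
  show "a \<in> H \<Longrightarrow> matrix_inv a \<in> H" using subgroup.m_inv_closed[OF assms, of a] i inv_GL[of a] by simp
  show "a \<in> H \<Longrightarrow> a ** matrix_inv a = mat 1" "a \<in> H \<Longrightarrow> matrix_inv a ** a = mat 1"
    using i matrix_inv by blast+
qed

lemma matrix_cancel:
  assumes "invertible (A :: 'n::finite cmat)"
  shows "A ** (matrix_inv A ** Z) = Z" "matrix_inv A ** (A ** Z) = Z"
  using assms by (simp_all add: matrix_mul_assoc matrix_inv)

context chevalley_group begin

lemma sub_T: "subgroup T GL" and sub_G: "subgroup G GL" and sub_U: "subgroup (unip D) GL" "subgroup (unip_op D) GL"
  using group_facts by (auto simp: closed_connected_subgroup_def)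

lemma unip_torus: "g \<in> unip D \<or> g \<in> unip_op D \<Longrightarrow> g \<in> T \<Longrightarrow> g = mat 1"
  using unipotent_diagonalizable[OF _ group_facts(6)] group_facts(14,15) by blast

text \<open>
  The quotient of two such decompositions lies in the intersection of the two Borel subgroups,
  which is the torus, and the torus contains no unipotent element except the identity.
\<close>

lemma torus_part_unique:
  assumes y: "y \<in> unip_op D" "y' \<in> unip_op D" and t: "\<tau> \<in> T" "\<tau>' \<in> T" and x: "x \<in> unip D" "x' \<in> unip D"
    and eq: "y ** \<tau> ** x = y' ** \<tau>' ** x'"
  shows "\<tau> = \<tau>'"
proof -
  note B = subgroup_GL[OF group_facts(8)] and B' = subgroup_GL[OF group_facts(9)]
    and U = subgroup_GL[OF sub_U(1)] and U' = subgroup_GL[OF sub_U(2)] and T = subgroup_GL[OF sub_T]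
  have TB: "T \<subseteq> borel D" "T \<subseteq> borel_op D" using group_facts(7) by auto
  define y0 x0 where "y0 = matrix_inv y' ** y" and "x0 = x' ** matrix_inv x"
  have y0: "y0 \<in> unip_op D" and x0: "x0 \<in> unip D" unfolding y0_def x0_def by (intro U U' y x)+
  have "matrix_inv y' ** (y ** \<tau> ** x) ** matrix_inv x = matrix_inv y' ** (y' ** \<tau>' ** x') ** matrix_inv x"
    by (simp only: eq)
  hence e: "y0 ** \<tau> = \<tau>' ** x0"
    using U(5)[OF x(1)] U'(6)[OF y(2)] U'(4)[OF y(2)]
    by (simp add: y0_def x0_def matrix_cancel flip: matrix_mul_assoc)
  have "y0 ** \<tau> \<in> borel_op D" using y0 t TB group_facts(11) B'(1) by blast
  moreover have "\<tau>' ** x0 \<in> borel D" using x0 t TB group_facts(10) B(1) by blast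
  ultimately have e2: "y0 ** \<tau> \<in> T" "\<tau>' ** x0 \<in> T" using group_facts(7) e by auto
  have "y0 = (y0 ** \<tau>) ** matrix_inv \<tau>" using T(5)[OF t(1)] by (simp flip: matrix_mul_assoc)
  hence "y0 \<in> T" using T(1)[OF e2(1) T(3)[OF t(1)]] by simp
  hence "y0 = mat 1" using unip_torus y0 by blast
  have "x0 = matrix_inv \<tau>' ** (\<tau>' ** x0)" by (simp only: matrix_cancel(2)[OF T(4)[OF t(2)]])
  hence "x0 \<in> T" using T(1)[OF T(3)[OF t(2)] e2(2)] by simp
  hence "x0 = mat 1" using unip_torus x0 by blast
  thus ?thesis using e \<open>y0 = mat 1\<close> by simp
qed

lemma torus_part:
  assumes "y \<in> unip_op D" "\<tau> \<in> T" "x \<in> unip D"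
  shows "torus_part D (y ** \<tau> ** x) = \<tau>"
  unfolding torus_part_def by (rule the_equality) (use assms torus_part_unique in blast)+

abbreviation "NT \<equiv> normalizer (as_group G) T"

lemma group_G: "group (as_group G)"
  by (rule subgroup.subgroup_is_group[OF sub_G group_GL])

lemma inv_G: "g \<in> G \<Longrightarrow> inv\<^bsub>as_group G\<^esub> g = matrix_inv g"
  using group.m_inv_consistent[OF group_GL sub_G, of g] inv_GL[OF subgroup_GL(4)[OF sub_G]] by simp

lemma sub_T_G: "subgroup T (as_group G)"
  using group.subgroup_incl[OF group_GL sub_T sub_G] group_facts(3) by simp

lemma normalizer_iff:
  "g \<in> NT \<longleftrightarrow> g \<in> G \<and> (\<forall>\<tau>\<in>T. g ** \<tau> ** matrix_inv g \<in> T) \<and> (\<forall>\<tau>\<in>T. matrix_inv g ** \<tau> ** g \<in> T)"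
proof -
  have "g \<in> NT \<longleftrightarrow> g \<in> G \<and> (\<lambda>\<tau>. g ** \<tau> ** matrix_inv g) ` T = T"
    using group_facts(3)
    by (cases "g \<in> G")
       (simp_all add: normalizer_def stabilizer_def l_coset_def r_coset_def inv_G UNION_singleton_eq_range image_image)
  also have "\<dots> \<longleftrightarrow> g \<in> G \<and> (\<forall>\<tau>\<in>T. g ** \<tau> ** matrix_inv g \<in> T) \<and> (\<forall>\<tau>\<in>T. matrix_inv g ** \<tau> ** g \<in> T)"
  proof (cases "g \<in> G")
    case True
    have inv: "invertible g" using True subgroup_GL(4)[OF sub_G] by blast
    have 1: "matrix_inv g ** (g ** \<tau> ** matrix_inv g) ** g = \<tau>" "g ** (matrix_inv g ** \<tau> ** g) ** matrix_inv g = \<tau>" for \<tau>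
      using inv by (simp_all add: matrix_cancel matrix_inv flip: matrix_mul_assoc)
    show ?thesis
    proof (intro iffI conjI)
      assume a: "g \<in> G \<and> (\<lambda>\<tau>. g ** \<tau> ** matrix_inv g) ` T = T"
      show "\<forall>\<tau>\<in>T. g ** \<tau> ** matrix_inv g \<in> T" using a by blast
      show "\<forall>\<tau>\<in>T. matrix_inv g ** \<tau> ** g \<in> T"
      proof
        fix \<tau> assume "\<tau> \<in> T"
        then obtain \<sigma> where "\<sigma> \<in> T" "\<tau> = g ** \<sigma> ** matrix_inv g" using a by blast
        thus "matrix_inv g ** \<tau> ** g \<in> T" by (simp only: 1)
      qed
    next
      assume a: "g \<in> G \<and> (\<forall>\<tau>\<in>T. g ** \<tau> ** matrix_inv g \<in> T) \<and> (\<forall>\<tau>\<in>T. matrix_inv g ** \<tau> ** g \<in> T)"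
      show "(\<lambda>\<tau>. g ** \<tau> ** matrix_inv g) ` T = T"
      proof
        show "T \<subseteq> (\<lambda>\<tau>. g ** \<tau> ** matrix_inv g) ` T"
        proof
          fix \<tau> assume "\<tau> \<in> T"
          thus "\<tau> \<in> (\<lambda>\<tau>. g ** \<tau> ** matrix_inv g) ` T"
            using a by (intro image_eqI[of _ _ "matrix_inv g ** \<tau> ** g"]) (simp_all only: 1)
        qed
      qed (use a in blast)
    qed (use True in blast)+
  qed simp
  finally show ?thesis .
qed

lemma NT_subset: "NT \<subseteq> G" using normalizer_iff by blast

lemma normal_T: "T \<lhd> as_group NT"
  using group.subgroup_in_normalizer[OF group_G sub_T_G] by simp

lemma weyl_group: "group (weyl_group D)"
  unfolding weyl_group_def by (rule normal.factorgroup_is_group[OF normal_T])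

lemma weyl_carrier: "w \<in> carrier (weyl_group D) \<longleftrightarrow> (\<exists>n\<in>NT. w = (\<lambda>\<tau>. \<tau> ** n) ` T)"
  unfolding weyl_group_def FactGroup_def RCOSETS_def by (auto simp: r_coset_def image_def)

lemma weyl_mult: "v \<otimes>\<^bsub>weyl_group D\<^esub> w = {a ** b | a b. a \<in> v \<and> b \<in> w}"
  unfolding weyl_group_def FactGroup_def set_mult_def by auto

lemma weyl_one: "\<one>\<^bsub>weyl_group D\<^esub> = T"
  by (simp add: weyl_group_def FactGroup_def)

lemma simple_reflection: "simple_reflection D i = (\<lambda>\<tau>. \<tau> ** s_bar D i) ` T"
  by (auto simp: simple_reflection_def r_coset_def image_def)

lemma word_prod_simps: "word_prod D [] = T" "word_prod D (i # ws) = simple_reflection D i \<otimes>\<^bsub>weyl_group D\<^esub> word_prod D ws"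
  by (simp_all add: word_prod_def weyl_one)

lemma s_bar_in_G: "i \<in> idx D \<Longrightarrow> s_bar D i \<in> G"
  by (simp add: s_bar_phi phi_in_group det_mat2)

lemma word_prod_left: "\<tau> \<in> T \<Longrightarrow> g \<in> word_prod D ws \<Longrightarrow> \<tau> ** g \<in> word_prod D ws"
proof (cases ws)
  case (Cons i vs)
  assume t: "\<tau> \<in> T" and g: "g \<in> word_prod D ws"
  then obtain \<sigma> b where "\<sigma> \<in> T" "b \<in> word_prod D vs" "g = (\<sigma> ** s_bar D i) ** b"
    by (auto simp: Cons word_prod_simps weyl_mult simple_reflection)
  moreover have "\<tau> ** \<sigma> \<in> T" using subgroup_GL(1)[OF sub_T t] \<open>\<sigma> \<in> T\<close> .
  ultimately show ?thesis
    unfolding Cons word_prod_simps weyl_mult simple_reflection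
    by (intro CollectI exI[of _ "(\<tau> ** \<sigma>) ** s_bar D i"] exI[of _ b]) (simp add: matrix_mul_assoc)
qed (use subgroup_GL(1)[OF sub_T] in \<open>simp add: word_prod_simps\<close>)

lemma word_prod_element: "set ws \<subseteq> idx D \<Longrightarrow> \<exists>g\<in>word_prod D ws. g \<in> G"
proof (induction ws)
  case Nil
  thus ?case using subgroup_GL(2)[OF sub_T] subgroup_GL(2)[OF sub_G] by (auto simp: word_prod_simps)
next
  case (Cons i ws)
  then obtain g where g: "g \<in> word_prod D ws" "g \<in> G" by auto
  have "mat 1 ** s_bar D i \<in> simple_reflection D i"
    unfolding simple_reflection using subgroup_GL(2)[OF sub_T] by (rule imageI)
  hence "s_bar D i ** g \<in> word_prod D (i # ws)" using g by (auto simp: word_prod_simps weyl_mult)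
  thus ?case using subgroup_GL(1)[OF sub_G s_bar_in_G g(2)] Cons.prems by auto
qed

text \<open>
  The set \<open>T s W\<close> is a single coset of the torus \<open>T\<close>, where \<open>W\<close> is the coset product of the
  remaining word. Comparing its elements \<open>s \<tau> g\<close> and \<open>s g\<close> for \<open>g \<in> W\<close> shows that \<open>s\<close> conjugates \<open>T\<close> into
  itself, and the inverse does so too because \<open>s\<^sup>2 \<in> T\<close>. Hence \<open>s\<close> normalizes \<open>T\<close>, and \<open>W\<close> is a coset as
  well.
\<close>

lemma word_prod_carrier:
  assumes ws: "set (i # ws) \<subseteq> idx D" and c: "word_prod D (i # ws) \<in> carrier (weyl_group D)"
  shows "s_bar D i \<in> NT" "word_prod D ws \<in> carrier (weyl_group D)"
proof -
  note T = subgroup_GL[OF sub_T] and G = subgroup_GL[OF sub_G]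
  let ?s = "s_bar D i"
  have i: "i \<in> idx D" using ws by simp
  have sG: "?s \<in> G" by (rule s_bar_in_G[OF i])
  have sinv: "invertible ?s" using G(4) sG .
  obtain n where n: "n \<in> NT" "word_prod D (i # ws) = (\<lambda>\<tau>. \<tau> ** n) ` T" using c by (auto simp: weyl_carrier)
  have ninv: "invertible n" using G(4) n(1) NT_subset by blast
  have mem: "\<tau> ** ?s ** w \<in> (\<lambda>\<tau>. \<tau> ** n) ` T" if "\<tau> \<in> T" "w \<in> word_prod D ws" for \<tau> w
    using that unfolding n(2)[symmetric] by (auto simp: word_prod_simps weyl_mult simple_reflection)
  have mem1: "\<exists>\<sigma>\<in>T. ?s ** w = \<sigma> ** n" if "w \<in> word_prod D ws" for w
    using mem[OF T(2) that] by auto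
  obtain g where g: "g \<in> word_prod D ws" "g \<in> G" using word_prod_element[of ws] ws by auto
  have ginv: "invertible g" using G(4) g(2) .
  have c1: "?s ** \<tau> ** matrix_inv ?s \<in> T" if t: "\<tau> \<in> T" for \<tau>
  proof -
    obtain \<sigma>1 where s1: "\<sigma>1 \<in> T" "?s ** (\<tau> ** g) = \<sigma>1 ** n" using mem1[OF word_prod_left[OF t g(1)]] by blast
    obtain \<sigma>2 where s2: "\<sigma>2 \<in> T" "?s ** g = \<sigma>2 ** n" using mem1[OF g(1)] by blast
    have "n = matrix_inv \<sigma>2 ** (?s ** g)" by (simp only: s2(2) matrix_cancel(2)[OF T(4)[OF s2(1)]])
    hence "?s ** (\<tau> ** g) = \<sigma>1 ** (matrix_inv \<sigma>2 ** (?s ** g))" using s1 by simp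
    hence "?s ** (\<tau> ** g) ** matrix_inv g ** matrix_inv ?s = \<sigma>1 ** (matrix_inv \<sigma>2 ** (?s ** g)) ** matrix_inv g ** matrix_inv ?s"
      by simp
    hence "?s ** \<tau> ** matrix_inv ?s = \<sigma>1 ** matrix_inv \<sigma>2"
      using ginv sinv by (simp add: matrix_cancel matrix_inv flip: matrix_mul_assoc)
    thus ?thesis using T(1)[OF s1(1) T(3)[OF s2(1)]] by simp
  qed
  have c2: "matrix_inv ?s ** \<tau> ** ?s \<in> T" if t: "\<tau> \<in> T" for \<tau>
  proof -
    let ?z = "tpow D i (-1)"
    have z: "?z \<in> T" by (rule tpow_in_torus[OF i]) simp
    have zs: "?s ** ?s = ?z" by (rule s_bar_square[OF i])
    have "matrix_inv ?s = matrix_inv ?z ** ?s"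
    proof -
      have "matrix_inv ?z ** (?s ** ?s) ** matrix_inv ?s = matrix_inv ?s" using T(6)[OF z] by (simp add: zs)
      thus ?thesis using sinv by (simp add: matrix_inv flip: matrix_mul_assoc)
    qed
    moreover have "?s = matrix_inv ?s ** ?z"
      using matrix_cancel(2)[OF sinv, of ?s] by (simp add: zs)
    ultimately have "matrix_inv ?s ** \<tau> ** ?s = matrix_inv ?z ** (?s ** \<tau> ** matrix_inv ?s) ** ?z"
      by (metis matrix_mul_assoc)
    thus ?thesis using T(1)[OF T(1)[OF T(3)[OF z] c1[OF t]] z] by simp
  qed
  show sN: "?s \<in> NT" using normalizer_iff sG c1 c2 by blast
  let ?m = "matrix_inv ?s ** n"
  have "word_prod D ws = (\<lambda>\<tau>. \<tau> ** ?m) ` T"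
  proof
    show "word_prod D ws \<subseteq> (\<lambda>\<tau>. \<tau> ** ?m) ` T"
    proof
      fix w assume "w \<in> word_prod D ws"
      then obtain \<sigma> where s: "\<sigma> \<in> T" "?s ** w = \<sigma> ** n" using mem1 by blast
      have "w = matrix_inv ?s ** (?s ** w)" by (simp only: matrix_cancel(2)[OF sinv])
      also have "\<dots> = (matrix_inv ?s ** \<sigma> ** ?s) ** ?m"
        using sinv by (simp add: s(2) matrix_cancel flip: matrix_mul_assoc)
      finally show "w \<in> (\<lambda>\<tau>. \<tau> ** ?m) ` T" using c2[OF s(1)] by (rule image_eqI)
    qed
    show "(\<lambda>\<tau>. \<tau> ** ?m) ` T \<subseteq> word_prod D ws"
    proof
      fix w assume "w \<in> (\<lambda>\<tau>. \<tau> ** ?m) ` T"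
      then obtain \<tau> where t: "\<tau> \<in> T" "w = \<tau> ** ?m" by blast
      have "(?s ** \<tau> ** matrix_inv ?s) ** n \<in> word_prod D (i # ws)" unfolding n(2) using c1[OF t(1)] by (rule imageI)
      then obtain \<sigma> v where v: "\<sigma> \<in> T" "v \<in> word_prod D ws" "(?s ** \<tau> ** matrix_inv ?s) ** n = (\<sigma> ** ?s) ** v"
        by (auto simp: word_prod_simps weyl_mult simple_reflection)
      have "w = matrix_inv ?s ** ((?s ** \<tau> ** matrix_inv ?s) ** n)"
        using sinv by (simp add: t(2) matrix_cancel flip: matrix_mul_assoc)
      also have "\<dots> = (matrix_inv ?s ** \<sigma> ** ?s) ** v" by (simp only: v(3)) (simp flip: matrix_mul_assoc)
      finally show "w \<in> word_prod D ws" using word_prod_left[OF c2[OF v(1)] v(2)] by simp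
    qed
  qed
  moreover have "?m \<in> NT"
  proof -
    have "subgroup NT (as_group G)"
      using group.normalizer_imp_subgroup[OF group_G] sub_T_G subgroup.subset by blast
    hence "subgroup NT GL" using group.incl_subgroup[OF group_GL sub_G] by simp
    thus ?thesis using subgroup_GL(1,3) sN n(1) by blast
  qed
  ultimately show "word_prod D ws \<in> carrier (weyl_group D)" by (auto simp: weyl_carrier)
qed

lemma weyl_length_le: "set ws \<subseteq> idx D \<Longrightarrow> weyl_length D (word_prod D ws) \<le> length ws"
  unfolding weyl_length_def by (rule Least_le) blast

lemma weyl_length_attained:
  assumes "set ws \<subseteq> idx D"
  obtains v where "set v \<subseteq> idx D" "length v = weyl_length D (word_prod D ws)" "word_prod D v = word_prod D ws"
proof -
  have "\<exists>v. set v \<subseteq> idx D \<and> length v = weyl_length D (word_prod D ws) \<and> word_prod D v = word_prod D ws"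
    unfolding weyl_length_def by (rule LeastI_ex[of "\<lambda>n. \<exists>v. set v \<subseteq> idx D \<and> length v = n \<and> word_prod D v = word_prod D ws"])
      (use assms in blast)
  thus ?thesis using that by blast
qed

text \<open>
  Suffixes of a reduced word are reduced, so the lengths add at every letter.
\<close>

lemma rep_word_prod:
  assumes rep: "canonical_representatives D rep"
  shows "ws \<noteq> [] \<Longrightarrow> set ws \<subseteq> idx D \<Longrightarrow> word_prod D ws \<in> carrier (weyl_group D) \<Longrightarrow>
    weyl_length D (word_prod D ws) = length ws \<Longrightarrow> rep (word_prod D ws) = foldr (\<lambda>i X. s_bar D i ** X) ws (mat 1)"
proof (induction ws)
  case (Cons i ws)
  note c = word_prod_carrier[OF Cons.prems(2,3)]
  have i: "i \<in> idx D" "set ws \<subseteq> idx D" using Cons.prems by auto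
  have sc: "simple_reflection D i \<in> carrier (weyl_group D)"
    using c(1) by (auto simp: weyl_carrier simple_reflection)
  have single: "word_prod D [i] = simple_reflection D i"
    using monoid.r_one[OF group.is_monoid[OF weyl_group] sc] unfolding word_prod_simps weyl_one .
  have rs: "rep (simple_reflection D i) = s_bar D i"
    using rep i by (auto simp: canonical_representatives_def)
  show ?case
  proof (cases "ws = []")
    case True
    thus ?thesis using single rs by simp
  next
    case False
    have len: "weyl_length D (word_prod D ws) = length ws"
    proof -
      obtain v where v: "set v \<subseteq> idx D" "length v = weyl_length D (word_prod D ws)" "word_prod D v = word_prod D ws"
        using weyl_length_attained[OF i(2)] .
      have "length (i # ws) \<le> length (i # v)"
        using weyl_length_le[of "i # v"] v i Cons.prems(4) by (simp add: word_prod_simps)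
      thus ?thesis using v(2) weyl_length_le[OF i(2)] by simp
    qed
    have len1: "weyl_length D (simple_reflection D i) = 1"
    proof -
      have "weyl_length D (simple_reflection D i) \<le> 1" using weyl_length_le[of "[i]"] i single by simp
      moreover have "weyl_length D (simple_reflection D i) \<noteq> 0"
      proof
        assume 0: "weyl_length D (simple_reflection D i) = 0"
        obtain v where "length v = weyl_length D (word_prod D [i])" "word_prod D v = word_prod D [i]"
          using weyl_length_attained[of "[i]"] i(1) by (metis empty_set empty_subsetI insert_subset list.simps(15))
        hence "simple_reflection D i = \<one>\<^bsub>weyl_group D\<^esub>"
          using 0 by (simp add: single weyl_one) (simp add: word_prod_simps)
        hence "word_prod D (i # ws) = word_prod D ws"
          using monoid.l_one[OF group.is_monoid[OF weyl_group] c(2)] by (simp add: word_prod_simps)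
        thus False using len Cons.prems(4) by simp
      qed
      ultimately show ?thesis by simp
    qed
    have "rep (word_prod D (i # ws)) = rep (simple_reflection D i) ** rep (word_prod D ws)"
      using rep sc c(2) len len1 Cons.prems(4) unfolding canonical_representatives_def word_prod_simps by simp
    thus ?thesis using Cons.IH[OF False i(2) c(2) len] rs by simp
  qed
qed simp

end

section \<open>Independence of Laurent monomials\<close>

definition laurent_monomial :: "nat \<Rightarrow> ivec \<Rightarrow> (nat \<Rightarrow> complex) \<Rightarrow> complex" where
  "laurent_monomial N d t = (\<Prod>l=1..N. t l powi d l)"

lemma laurent_monomial_mult:
  "laurent_monomial N d (\<lambda>l. t l * s l) = laurent_monomial N d t * laurent_monomial N d s"
  by (simp add: laurent_monomial_def power_int_mult_distrib prod.distrib)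

lemma laurent_monomial_separates:
  assumes "d \<noteq> e" "\<And>l. l \<notin> {1..N} \<Longrightarrow> d l = e l"
  shows "\<exists>t. (\<forall>l. t l \<noteq> 0) \<and> laurent_monomial N d t \<noteq> laurent_monomial N e t"
proof -
  obtain m where m: "d m \<noteq> e m" "m \<in> {1..N}" using assms by blast
  define t where "t = (\<lambda>l. if l = m then 2 else 1 :: complex)"
  have eval: "laurent_monomial N f t = 2 powi f m" for f
  proof -
    have "laurent_monomial N f t = (\<Prod>l=1..N. if l = m then 2 powi f m else 1)"
      unfolding laurent_monomial_def t_def by (intro prod.cong) auto
    also have "\<dots> = 2 powi f m" using m(2) by (subst prod.delta) auto
    finally show ?thesis .
  qed
  have "norm (2 powi d m :: complex) \<noteq> norm (2 powi e m :: complex)"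
    unfolding norm_power_int using m(1) power_int_strict_increasing[of "d m" "e m" "2::real"]
      power_int_strict_increasing[of "e m" "d m" "2::real"] by (cases "d m < e m") auto
  hence "laurent_monomial N d t \<noteq> laurent_monomial N e t" unfolding eval by metis
  thus ?thesis by (intro exI[of _ t]) (auto simp: t_def)
qed

text \<open>
  Dedekind's argument for the independence of characters: a relation is translated by a point
  that separates two of its monomials, and one of them is eliminated.
\<close>

lemma laurent_monomials_independent:
  assumes "finite S" "\<And>d l. d \<in> S \<Longrightarrow> l \<notin> {1..N} \<Longrightarrow> d l = 0"
    and "\<And>t. (\<And>l. t l \<noteq> 0) \<Longrightarrow> (\<Sum>d\<in>S. a d * laurent_monomial N d t) = 0"
  shows "\<forall>d\<in>S. a d = 0"
  using assms
proof (induction S arbitrary: a rule: finite_induct)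
  case (insert e S)
  have "a d = 0" if d: "d \<in> S" for d
  proof -
    obtain s where s: "\<And>l. s l \<noteq> 0" "laurent_monomial N d s \<noteq> laurent_monomial N e s"
      using laurent_monomial_separates[of d e N] d insert.hyps insert.prems(1)
      by (metis insertCI)
    have "\<forall>d\<in>S. a d * (laurent_monomial N d s - laurent_monomial N e s) = 0"
    proof (rule insert.IH)
      fix t :: "nat \<Rightarrow> complex" assume t: "\<And>l. t l \<noteq> 0"
      have "(\<Sum>d\<in>insert e S. a d * laurent_monomial N d (\<lambda>l. t l * s l)) = 0"
        by (rule insert.prems(2)) (simp add: t s)
      moreover have "laurent_monomial N e s * (\<Sum>d\<in>insert e S. a d * laurent_monomial N d t) = 0"
        using insert.prems(2)[OF t] by simp
      ultimately have "(\<Sum>d\<in>insert e S. a d * laurent_monomial N d (\<lambda>l. t l * s l)) -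
          laurent_monomial N e s * (\<Sum>d\<in>insert e S. a d * laurent_monomial N d t) = 0" by simp
      also have "(\<Sum>d\<in>insert e S. a d * laurent_monomial N d (\<lambda>l. t l * s l)) -
          laurent_monomial N e s * (\<Sum>d\<in>insert e S. a d * laurent_monomial N d t) =
        (\<Sum>d\<in>insert e S. a d * (laurent_monomial N d s - laurent_monomial N e s) * laurent_monomial N d t)"
        by (simp add: sum_distrib_left sum_subtractf[symmetric] laurent_monomial_mult algebra_simps del: sum.insert)
      also have "\<dots> = (\<Sum>d\<in>S. a d * (laurent_monomial N d s - laurent_monomial N e s) * laurent_monomial N d t)"
        using insert.hyps by simp
      finally show "(\<Sum>d\<in>S. a d * (laurent_monomial N d s - laurent_monomial N e s) * laurent_monomial N d t) = 0" .
    qed (use insert.prems(1) in blast)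
    thus ?thesis using s(2) d by auto
  qed
  moreover have "a e = 0"
  proof -
    have "(\<Sum>d\<in>insert e S. a d * laurent_monomial N d (\<lambda>_. 1)) = 0" by (rule insert.prems(2)) simp
    moreover have "(\<Sum>d\<in>S. a d * laurent_monomial N d (\<lambda>_. 1)) = 0" by (rule sum.neutral) (simp add: calculation \<open>\<And>d. d \<in> S \<Longrightarrow> a d = 0\<close>)
    ultimately show ?thesis using insert.hyps by (simp add: laurent_monomial_def)
  qed
  ultimately show ?case by blast
qed simp

lemma laurent_expansion_unique:
  assumes "laurent_expansion N F c" "laurent_expansion N F c'"
  shows "c = c'"
proof -
  define S where "S = {d. c d \<noteq> 0} \<union> {d. c' d \<noteq> 0}"
  have fin: "finite S" and supp: "\<And>d l. d \<in> S \<Longrightarrow> l \<notin> {1..N} \<Longrightarrow> d l = 0"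
    using assms unfolding laurent_expansion_def S_def by blast+
  have expand: "F t = (\<Sum>d\<in>S. k d * laurent_monomial N d t)"
    if "laurent_expansion N F k" "{d. k d \<noteq> 0} \<subseteq> S" "\<And>l. t l \<noteq> 0" for k t
  proof -
    have "F t = (\<Sum>d | k d \<noteq> 0. k d * laurent_monomial N d t)"
      using that unfolding laurent_expansion_def laurent_monomial_def by blast
    also have "\<dots> = (\<Sum>d\<in>S. k d * laurent_monomial N d t)"
      by (rule sum.mono_neutral_left) (use fin that(2) in auto)
    finally show ?thesis .
  qed
  have "\<forall>d\<in>S. c d - c' d = 0"
  proof (rule laurent_monomials_independent[OF fin, where N = N])
    show "d l = 0" if "d \<in> S" "l \<notin> {1..N}" for d l using supp that .
    fix t :: "nat \<Rightarrow> complex" assume t: "\<And>l. t l \<noteq> 0"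
    show "(\<Sum>d\<in>S. (c d - c' d) * laurent_monomial N d t) = 0"
      using expand[OF assms(1) _ t] expand[OF assms(2) _ t]
      by (simp add: left_diff_distrib sum_subtractf) (simp add: S_def)
  qed
  moreover have "c d = c' d" if "d \<notin> S" for d using that by (simp add: S_def)
  ultimately show ?thesis by (intro ext) (metis eq_iff_diff_eq_0)
qed

text \<open>
  Exponent vectors as lists, for computation.
\<close>

definition vec_of :: "int list \<Rightarrow> ivec" where
  "vec_of e = (\<lambda>l. if 1 \<le> l \<and> l \<le> length e then e ! (l - 1) else 0)"

lemma vec_of_inject: "length d = length e \<Longrightarrow> vec_of d = vec_of e \<longleftrightarrow> d = e"
proof
  assume len: "length d = length e" and eq: "vec_of d = vec_of e"
  show "d = e"
  proof (rule nth_equalityI[OF len])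
    fix k assume "k < length d"
    thus "d ! k = e ! k" using fun_cong[OF eq, of "Suc k"] len by (simp add: vec_of_def)
  qed
qed simp

lemma laurent_monomials_list:
  assumes dist: "distinct (map fst L)" and len: "\<forall>(e, k)\<in>set L. length e = N \<and> k \<noteq> 0"
    and F: "\<And>t. (\<forall>l\<in>{1..N}. t l \<noteq> 0) \<Longrightarrow> F t = (\<Sum>(e, k)\<leftarrow>L. k * laurent_monomial N (vec_of e) t)"
  shows "laurent_monomials N F = vec_of ` fst ` set L"
proof -
  define K where "K = map (\<lambda>(e, k). (vec_of e, k)) L"
  define c where "c d = (case map_of K d of None \<Rightarrow> 0 | Some k \<Rightarrow> k)" for d
  have distK: "distinct (map fst K)"
  proof -
    have lenN: "length e = N" if "e \<in> fst ` set L" for e using that len by auto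
    have "inj_on vec_of (fst ` set L)"
    proof (rule inj_onI)
      fix d e assume "d \<in> fst ` set L" "e \<in> fst ` set L" "vec_of d = vec_of e"
      thus "d = e" using lenN[of d] lenN[of e] vec_of_inject[of d e] by simp
    qed
    hence "distinct (map vec_of (map fst L))"
      by (intro distinct_map[THEN iffD2, OF conjI[OF dist]]) (simp only: set_map)
    moreover have "map fst K = map vec_of (map fst L)" by (simp add: K_def o_def case_prod_unfold)
    ultimately show ?thesis by simp
  qed
  have cK: "c d = k" if "(d, k) \<in> set K" for d k
    using that distK by (simp add: c_def)
  have nzK: "k \<noteq> 0" if "(d, k) \<in> set K" for d k
    using that len by (auto simp: K_def)
  have supp: "{d. c d \<noteq> 0} = fst ` set K"
  proof
    show "{d. c d \<noteq> 0} \<subseteq> fst ` set K"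
      by (auto simp: c_def split: option.splits dest!: map_of_SomeD intro!: rev_image_eqI)
    show "fst ` set K \<subseteq> {d. c d \<noteq> 0}" using cK nzK by force
  qed
  have "laurent_expansion N F c"
    unfolding laurent_expansion_def
  proof (intro conjI allI impI)
    show "finite {d. c d \<noteq> 0}" unfolding supp by simp
    show "d l = 0" if "c d \<noteq> 0" "l \<notin> {1..N}" for d l
    proof -
      have "d \<in> fst ` set K" using that(1) supp by blast
      thus ?thesis using that(2) len by (auto simp: K_def vec_of_def)
    qed
    fix t :: "nat \<Rightarrow> complex" assume "\<forall>l\<in>{1..N}. t l \<noteq> 0"
    hence "F t = (\<Sum>(e, k)\<leftarrow>L. k * laurent_monomial N (vec_of e) t)" by (rule F)
    also have "\<dots> = (\<Sum>(d, k)\<leftarrow>K. k * laurent_monomial N d t)" by (simp add: K_def o_def case_prod_unfold)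
    also have "\<dots> = (\<Sum>(d, k)\<leftarrow>K. c d * laurent_monomial N d t)"
      by (intro arg_cong[of _ _ sum_list] map_cong) (auto simp: cK)
    also have "\<dots> = (\<Sum>d\<leftarrow>map fst K. c d * laurent_monomial N d t)" by (simp add: o_def case_prod_unfold)
    also have "\<dots> = (\<Sum>d\<in>set (map fst K). c d * laurent_monomial N d t)"
      by (rule sum_list_distinct_conv_sum_set[OF distK])
    finally show "F t = (\<Sum>d | c d \<noteq> 0. c d * (\<Prod>l=1..N. t l powi d l))"
      unfolding supp laurent_monomial_def by simp
  qed
  hence "laurent_monomials N F = {d. c d \<noteq> 0}"
    unfolding laurent_monomials_def using laurent_expansion_unique by blast
  also have "\<dots> = vec_of ` fst ` set L" unfolding supp by (force simp: K_def)
  finally show ?thesis .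
qed

section \<open>Evaluating the algorithm\<close>

lemma step_no_moves: "moves iw \<Gamma> = {} \<Longrightarrow> step a iw \<Gamma> = \<Gamma>"
  by (simp add: step_def)

lemma DG_final_eq:
  assumes "stops_at a iw i k r"
  shows "DG_final a iw i k = DG a iw i k r"
proof -
  let ?r = "LEAST r. stops_at a iw i k r"
  have s: "stops_at a iw i k ?r" by (rule LeastI[of _ r]) (rule assms)
  have le: "?r \<le> r" by (rule Least_le) (rule assms)
  have "DG a iw i k (?r + m) = DG a iw i k ?r" for m
  proof (induction m)
    case (Suc m)
    have "DG a iw i k (?r + Suc m) = step a iw (DG a iw i k (?r + m))" by (simp add: DG_def)
    thus ?case using s Suc step_no_moves by (simp add: stops_at_def)
  qed simp
  from this[of "r - ?r"] le show ?thesis by (simp add: DG_final_def)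
qed

text \<open>
  The condition for adding an arrow, for a word of length six in two alternating letters. The
  next occurrence of a letter is two places further, so the number \<open>p\<close> in the second
  alternative can only be 2, which forces \<open>j \<le> 2\<close>.
\<close>

definition list_move :: "int list \<Rightarrow> int list \<Rightarrow> nat \<Rightarrow> bool" where
  "list_move d b j \<longleftrightarrow> 0 < d ! (j - 1) \<and> 0 < b ! (j + 1) \<and>
     (d ! (j + 1) < d ! (j - 1) \<or> d ! (j + 1) = d ! (j - 1) \<and> j \<le> 2 \<and> d ! (j + 3) = -1 \<and> b ! (j + 3) = 1)"

text \<open>
  The parameter \<open>c\<close> gives the exponent of the only variable strictly between two consecutive
  occurrences of a letter.
\<close>

definition list_target :: "(nat \<Rightarrow> int) \<Rightarrow> int list \<Rightarrow> nat \<Rightarrow> int list" where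
  "list_target c M j = M[j - 1 := M ! (j - 1) - 1, j := M ! j - c j, j + 1 := M ! (j + 1) - 1]"

definition list_target_b :: "int list \<Rightarrow> nat \<Rightarrow> int list" where
  "list_target_b b j = b[j - 1 := b ! (j - 1) + 1, j + 1 := b ! (j + 1) - 1]"

fun moves_along :: "nat list \<Rightarrow> int list \<Rightarrow> int list \<Rightarrow> (int list \<times> int list \<times> nat) list" where
  "moves_along [] M b = []"
| "moves_along (j # js) M b = (if list_move M b j then (M, b, j) # moves_along js M b else moves_along js M b)"

fun frontier_moves :: "(int list \<times> int list) list \<Rightarrow> (int list \<times> int list \<times> nat) list" where
  "frontier_moves [] = []"
| "frontier_moves ((M, b) # f) = moves_along [1, 2, 3, 4] M b @ frontier_moves f"

fun targets :: "(nat \<Rightarrow> int) \<Rightarrow> (int list \<times> int list \<times> nat) list \<Rightarrow> (int list \<times> int list) list" where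
  "targets c [] = []"
| "targets c ((M, b, j) # m) = (list_target c M j, list_target_b b j) # targets c m"

text \<open>
  Only the vertices created in the previous round can be sinks that admit an arrow. The lists are
  therefore split into these (\<open>f\<close>, with their integer vectors) and all earlier ones (\<open>V\<close>). The
  computation fails if a new vertex is an old one, which might have outgoing arrows already.
\<close>

fun run :: "(nat \<Rightarrow> int) \<Rightarrow> nat \<Rightarrow> int list list \<Rightarrow> (int list \<times> int list) list \<Rightarrow> int list list option"
  and run_next :: "(nat \<Rightarrow> int) \<Rightarrow> nat \<Rightarrow> int list list \<Rightarrow> (int list \<times> int list) list \<Rightarrow> int list list option" where
  "run c 0 V f = (if frontier_moves f = [] then Some (V @ map fst f) else None)"
| "run c (Suc n) V f = run_next c n (V @ map fst f) (targets c (frontier_moves f))"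
| "run_next c n V f = (if list_all (\<lambda>(M, b). M \<notin> set V) f then run c n V f else None)"

lemma set_moves_along: "set (moves_along js M b) = {(M, b, j) | j. j \<in> set js \<and> list_move M b j}"
  by (induction js) auto

lemma set_frontier_moves:
  "set (frontier_moves f) = {(M, b, j) | M b j. (M, b) \<in> set f \<and> j \<in> {1, 2, 3, 4} \<and> list_move M b j}"
  by (induction f rule: frontier_moves.induct) (auto simp: set_moves_along simp del: moves_along.simps)

lemma set_targets: "set (targets c m) = (\<lambda>(M, b, j). (list_target c M j, list_target_b b j)) ` set m"
  by (induction m rule: targets.induct) auto

lemma next_pos_word:
  assumes "iw = [x, y, x, y, x, y]" "x \<noteq> y"
  shows "next_pos iw 1 = 3" "next_pos iw 2 = 4" "next_pos iw 3 = 5" "next_pos iw 4 = 6"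
    "next_pos iw 5 = 7" "next_pos iw 6 = 7" "next_pos iw 7 = 7"
proof -
  have "{l \<in> {1..6}. P l} = set (filter P [1, 2, 3, 4, 5, 6])" for P :: "nat \<Rightarrow> bool"
    by (auto simp: atLeastAtMost_iff eval_nat_numeral le_Suc_eq)
  moreover have "length iw = 6" using assms by simp
  ultimately have n: "next_pos iw j = Min (set (filter (\<lambda>l. letter iw l = letter iw j \<and> j < l) [1, 2, 3, 4, 5, 6]) \<union> {7})" for j
    by (simp add: next_pos_def)
  show "next_pos iw 1 = 3" "next_pos iw 2 = 4" "next_pos iw 3 = 5" "next_pos iw 4 = 6"
    "next_pos iw 5 = 7" "next_pos iw 6 = 7" "next_pos iw 7 = 7"
    unfolding n using assms(2) by (auto simp: assms(1) letter_def)
qed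

context
  fixes iw :: "nat list" and x y :: nat and a :: "nat \<Rightarrow> nat \<Rightarrow> int" and c :: "nat \<Rightarrow> int"
  assumes iw: "iw = [x, y, x, y, x, y]" and xy: "x \<noteq> y"
    and c: "\<And>j. j \<in> {1, 2, 3, 4} \<Longrightarrow> c j = a (letter iw (j + 1)) (letter iw j)"
begin

lemma len: "length iw = 6" by (simp add: iw)

lemma next_pos_small: "j \<in> {1, 2, 3, 4} \<Longrightarrow> next_pos iw j = j + 2"
  using next_pos_word[OF iw xy] by auto

lemma next_pos_iter: "(next_pos iw ^^ p) j \<le> 6 \<longleftrightarrow> j \<le> 2" if "j \<in> {1, 2, 3, 4}" "p = 2" for j p
  using that next_pos_word[OF iw xy] by (auto simp: numeral_2_eq_2)

lemma next_pos_iter_7: "(next_pos iw ^^ p) j = 7" if "j \<in> {1, 2, 3, 4}" "p \<ge> 3" for j p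
proof -
  have 7: "(next_pos iw ^^ q) 7 = 7" for q
    by (induction q) (simp_all add: next_pos_word[OF iw xy])
  have "(next_pos iw ^^ 3) j = 7"
    using that(1) next_pos_word[OF iw xy] by (auto simp: eval_nat_numeral)
  moreover have "(next_pos iw ^^ p) j = (next_pos iw ^^ (p - 3)) ((next_pos iw ^^ 3) j)"
    using that(2) by (metis comp_apply funpow_add le_add_diff_inverse2)
  ultimately show ?thesis using 7 by simp
qed

lemma move_cond_list:
  assumes "length d = 6" "length b = 6" "j \<in> {1, 2, 3, 4}"
  shows "move_cond iw (vec_of d) (vec_of b) j \<longleftrightarrow> list_move d b j"
proof -
  have v: "vec_of e (Suc l) = e ! l" if "length e = 6" "l < 6" for e l
    using that by (simp add: vec_of_def)
  have ex: "(\<exists>p\<ge>2. (next_pos iw ^^ p) j \<le> length iw \<and> Q p) \<longleftrightarrow> j \<le> 2 \<and> Q 2" for Q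
  proof
    assume "\<exists>p\<ge>2. (next_pos iw ^^ p) j \<le> length iw \<and> Q p"
    then obtain p where p: "p \<ge> 2" "(next_pos iw ^^ p) j \<le> 6" "Q p" by (auto simp: len)
    hence "p = 2" using next_pos_iter_7[OF assms(3), of p] by (cases "p \<ge> 3") auto
    thus "j \<le> 2 \<and> Q 2" using p next_pos_iter[OF assms(3)] by auto
  next
    assume "j \<le> 2 \<and> Q 2"
    thus "\<exists>p\<ge>2. (next_pos iw ^^ p) j \<le> length iw \<and> Q p"
      using next_pos_iter[OF assms(3), of 2] by (auto simp: len)
  qed
  have n2: "(next_pos iw ^^ 2) j = j + 4" if "j \<le> 2"
    using that assms(3) next_pos_word[OF iw xy] by (auto simp: numeral_2_eq_2)
  have e: "vec_of d j = d ! (j - 1)" "vec_of d (j + 2) = d ! (j + 1)" "vec_of b (j + 2) = b ! (j + 1)"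
    "j \<le> 2 \<Longrightarrow> vec_of d (j + 4) = d ! (j + 3)" "j \<le> 2 \<Longrightarrow> vec_of b (j + 4) = b ! (j + 3)"
    using assms by (auto simp: vec_of_def)
  show ?thesis
    unfolding move_cond_def ex list_move_def next_pos_small[OF assms(3)] e using n2 e by auto
qed

lemma target_list:
  assumes "length M = 6" "j \<in> {1, 2, 3, 4}"
  shows "target a iw (vec_of M) j = vec_of (list_target c M j)"
proof
  fix l
  consider "l < j \<or> l > j + 2" | "l = j" | "l = j + 1" | "l = j + 2" by linarith
  thus "target a iw (vec_of M) j l = vec_of (list_target c M j) l"
    by cases (use assms in \<open>auto simp: target_def A_vec_def next_pos_small vec_of_def list_target_def nth_list_update c\<close>)
qed

lemma target_b_list:
  assumes "length b = 6" "j \<in> {1, 2, 3, 4}"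
  shows "target_b iw (vec_of b) j = vec_of (list_target_b b j)"
proof
  fix l
  consider "l < j \<or> l > j + 2" | "l = j" | "l = j + 1" | "l = j + 2" by linarith
  thus "target_b iw (vec_of b) j l = vec_of (list_target_b b j) l"
    by cases (use assms in \<open>auto simp: target_b_def next_pos_small vec_of_def list_target_b_def nth_list_update\<close>)
qed

definition tracks :: "monomial_graph \<Rightarrow> int list list \<Rightarrow> (int list \<times> int list) list \<Rightarrow> bool" where
  "tracks \<Gamma> V f \<longleftrightarrow>
     (\<forall>M\<in>set V. length M = 6) \<and> (\<forall>M b. (M, b) \<in> set f \<longrightarrow> length M = 6 \<and> length b = 6) \<and>
     set V \<inter> fst ` set f = {} \<and>
     verts \<Gamma> = vec_of ` (set V \<union> fst ` set f) \<and>
     fst ` arrows \<Gamma> \<subseteq> vec_of ` set V \<and>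
     fst ` assoc \<Gamma> \<subseteq> verts \<Gamma> \<and>
     {m \<in> assoc \<Gamma>. fst m \<in> vec_of ` fst ` set f} = map_prod vec_of vec_of ` set f \<and>
     (\<forall>M b j. (M, b, j) \<in> moves iw \<Gamma> \<longrightarrow> M \<in> vec_of ` fst ` set f)"

lemma tracks_moves:
  assumes "tracks \<Gamma> V f"
  shows "moves iw \<Gamma> = (\<lambda>(M, b, j). (vec_of M, vec_of b, j)) ` set (frontier_moves f)"
proof -
  from assms have wV: "\<And>M. M \<in> set V \<Longrightarrow> length M = 6" and wf: "\<And>M b. (M, b) \<in> set f \<Longrightarrow> length M = 6 \<and> length b = 6"
    and disj: "set V \<inter> fst ` set f = {}" and vs: "verts \<Gamma> = vec_of ` (set V \<union> fst ` set f)"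
    and ar: "fst ` arrows \<Gamma> \<subseteq> vec_of ` set V"
    and as: "{m \<in> assoc \<Gamma>. fst m \<in> vec_of ` fst ` set f} = map_prod vec_of vec_of ` set f"
    and mv': "\<forall>M b j. (M, b, j) \<in> moves iw \<Gamma> \<longrightarrow> M \<in> vec_of ` fst ` set f"
    unfolding tracks_def by simp_all
  from mv' have mv: "M \<in> vec_of ` fst ` set f" if "(M, b, j) \<in> moves iw \<Gamma>" for M b j
    using that by (elim allE impE)
  have j: "j \<in> {1..length iw} \<and> next_pos iw j \<le> length iw \<longleftrightarrow> j \<in> {1, 2, 3, 4}" for j
  proof
    assume j: "j \<in> {1..length iw} \<and> next_pos iw j \<le> length iw"
    hence "j \<in> {1, 2, 3, 4} \<or> j = 5 \<or> j = 6" by (auto simp: len)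
    thus "j \<in> {1, 2, 3, 4}" using j next_pos_word[OF iw xy] by (auto simp: len)
  qed (use next_pos_small[of j] len in auto)
  have sink: "vec_of M \<in> sinks \<Gamma>" if M: "(M, b) \<in> set f" for M b
  proof -
    have "vec_of M \<notin> vec_of ` set V"
    proof
      assume "vec_of M \<in> vec_of ` set V"
      then obtain M' where "M' \<in> set V" "vec_of M = vec_of M'" by blast
      hence "M \<in> set V" using vec_of_inject[of M M'] wV wf[OF M] by simp
      thus False using disj M by force
    qed
    hence "(vec_of M, M') \<notin> arrows \<Gamma>" for M' using ar by force
    moreover have "vec_of M \<in> verts \<Gamma>" unfolding vs using M by force
    ultimately show ?thesis by (simp add: sinks_def)
  qed
  show ?thesis
  proof (rule Set.set_eqI)
    fix m :: "ivec \<times> ivec \<times> nat"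
    obtain M' b' j' where m: "m = (M', b', j')" by (cases m) auto
    have "m \<in> moves iw \<Gamma> \<longleftrightarrow> (\<exists>M b. M' = vec_of M \<and> b' = vec_of b \<and> (M, b) \<in> set f \<and> j' \<in> {1, 2, 3, 4} \<and> list_move M b j')"
    proof
      assume mm: "m \<in> moves iw \<Gamma>"
      hence "(M', b') \<in> {m \<in> assoc \<Gamma>. fst m \<in> vec_of ` fst ` set f}"
        using mv[of M' b' j'] by (simp add: m moves_def)
      then obtain M b where Mb: "M' = vec_of M" "b' = vec_of b" "(M, b) \<in> set f" unfolding as by auto
      have j': "j' \<in> {1, 2, 3, 4}" using mm j[of j'] by (simp add: m moves_def)
      have "move_cond iw M' b' j'" using mm by (simp add: m moves_def)
      hence "list_move M b j'" using move_cond_list[of M b j'] wf[OF Mb(3)] j' Mb by simp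
      thus "\<exists>M b. M' = vec_of M \<and> b' = vec_of b \<and> (M, b) \<in> set f \<and> j' \<in> {1, 2, 3, 4} \<and> list_move M b j'"
        using Mb j' by blast
    next
      assume "\<exists>M b. M' = vec_of M \<and> b' = vec_of b \<and> (M, b) \<in> set f \<and> j' \<in> {1, 2, 3, 4} \<and> list_move M b j'"
      then obtain M b where Mb: "M' = vec_of M" "b' = vec_of b" "(M, b) \<in> set f" "j' \<in> {1, 2, 3, 4}" "list_move M b j'"
        by blast
      have "(M', b') \<in> map_prod vec_of vec_of ` set f" using Mb by force
      hence "(M', b') \<in> assoc \<Gamma>" unfolding as[symmetric] by simp
      moreover have "move_cond iw M' b' j'" using move_cond_list[of M b j'] wf[OF Mb(3)] Mb by simp
      ultimately show "m \<in> moves iw \<Gamma>" using sink[OF Mb(3)] j[of j'] Mb by (simp add: m moves_def)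
    qed
    also have "\<dots> \<longleftrightarrow> m \<in> (\<lambda>(M, b, j). (vec_of M, vec_of b, j)) ` set (frontier_moves f)"
      unfolding m set_frontier_moves by force
    finally show "m \<in> moves iw \<Gamma> \<longleftrightarrow> m \<in> (\<lambda>(M, b, j). (vec_of M, vec_of b, j)) ` set (frontier_moves f)" .
  qed
qed

text \<open>
  A sink that admits an arrow receives it in the next round and is then no longer a sink.
\<close>

lemma step_moves_new:
  assumes "(M, b, j) \<in> moves iw (step a iw \<Gamma>)"
  shows "M \<in> {target a iw M j | M b j. (M, b, j) \<in> moves iw \<Gamma>}"
proof (rule ccontr)
  assume no: "M \<notin> {target a iw M j | M b j. (M, b, j) \<in> moves iw \<Gamma>}"
  have M: "M \<in> sinks (step a iw \<Gamma>)" "(M, b) \<in> assoc (step a iw \<Gamma>)" "j \<in> {1..length iw}" "next_pos iw j \<le> length iw"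
    "move_cond iw M b j" using assms by (auto simp: moves_def)
  have "(M, b) \<in> assoc \<Gamma>" using M(2) no by (auto simp: step_def)
  moreover have "M \<in> sinks \<Gamma>" using M(1) no by (auto simp: sinks_def step_def)
  ultimately have "(M, b, j) \<in> moves iw \<Gamma>" using M by (simp add: moves_def)
  hence "(M, target a iw M j) \<in> arrows (step a iw \<Gamma>)" unfolding step_def by simp blast
  thus False using M(1) unfolding sinks_def by blast
qed

lemma tracks_step:
  assumes tr: "tracks \<Gamma> V f" and f': "f' = targets c (frontier_moves f)" and V': "V' = V @ map fst f"
    and fresh: "set V' \<inter> fst ` set f' = {}"
  shows "tracks (step a iw \<Gamma>) V' f'"
proof -
  note mv = tracks_moves[OF tr]
  from tr have wV: "\<And>M. M \<in> set V \<Longrightarrow> length M = 6" and wf: "\<And>M b. (M, b) \<in> set f \<Longrightarrow> length M = 6 \<and> length b = 6"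
    and vs: "verts \<Gamma> = vec_of ` (set V \<union> fst ` set f)"
    and ar: "fst ` arrows \<Gamma> \<subseteq> vec_of ` set V"
    unfolding tracks_def by simp_all
  from tr have as: "fst ` assoc \<Gamma> \<subseteq> verts \<Gamma>"
    unfolding tracks_def by (elim conjE)
  have wm: "length M = 6 \<and> length b = 6 \<and> j \<in> {1, 2, 3, 4} \<and> (M, b) \<in> set f" if "(M, b, j) \<in> set (frontier_moves f)" for M b j
    using that wf by (auto simp: set_frontier_moves)
  have t: "target a iw (vec_of M) j = vec_of (list_target c M j)" "target_b iw (vec_of b) j = vec_of (list_target_b b j)"
    if "(M, b, j) \<in> set (frontier_moves f)" for M b j
    using wm[OF that] target_list target_b_list by auto
  have im: "{h M b j | M b j. (M, b, j) \<in> moves iw \<Gamma>} = (\<lambda>(M, b, j). h (vec_of M) (vec_of b) j) ` set (frontier_moves f)"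
    for h :: "ivec \<Rightarrow> ivec \<Rightarrow> nat \<Rightarrow> 'z"
    unfolding mv by force
  have 2: "{target a iw M j | M b j. (M, b, j) \<in> moves iw \<Gamma>} = vec_of ` fst ` set f'"
    unfolding im[of "\<lambda>M b j. target a iw M j"] f' set_targets image_image by (rule image_cong) (auto simp: t)
  have 4: "{(target a iw M j, target_b iw b j) | M b j. (M, b, j) \<in> moves iw \<Gamma>} = map_prod vec_of vec_of ` set f'"
    unfolding im[of "\<lambda>M b j. (target a iw M j, target_b iw b j)"] f' set_targets image_image
    by (rule image_cong) (auto simp: t)
  have wV': "\<And>M. M \<in> set V' \<Longrightarrow> length M = 6" using wV wf by (auto simp: V')
  have wf': "\<And>M b. (M, b) \<in> set f' \<Longrightarrow> length M = 6 \<and> length b = 6"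
    using wm by (force simp: f' set_targets list_target_def list_target_b_def)
  have vV': "verts \<Gamma> = vec_of ` set V'" by (simp add: vs V')
  have disj: "vec_of ` set V' \<inter> vec_of ` fst ` set f' = {}"
  proof (rule ccontr)
    assume "vec_of ` set V' \<inter> vec_of ` fst ` set f' \<noteq> {}"
    then obtain M M' b where 1: "M \<in> set V'" "(M', b) \<in> set f'" "vec_of M = vec_of M'" by auto
    hence "M = M'" using vec_of_inject[of M M'] wV' wf' by simp
    thus False using 1 fresh by force
  qed
  have verts: "verts (step a iw \<Gamma>) = vec_of ` (set V' \<union> fst ` set f')"
    unfolding image_Un vV'[symmetric] 2[symmetric] by (simp add: step_def)
  have arr: "fst ` arrows (step a iw \<Gamma>) \<subseteq> vec_of ` set V'"
  proof
    fix M assume "M \<in> fst ` arrows (step a iw \<Gamma>)"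
    hence "M \<in> fst ` arrows \<Gamma> \<or> (\<exists>b j. (M, b, j) \<in> moves iw \<Gamma>)" by (auto simp: step_def)
    thus "M \<in> vec_of ` set V'"
    proof
      assume "\<exists>b j. (M, b, j) \<in> moves iw \<Gamma>"
      thus ?thesis using vV' by (auto simp: moves_def sinks_def)
    qed (use ar in \<open>auto simp: V'\<close>)
  qed
  have asc: "assoc (step a iw \<Gamma>) = assoc \<Gamma> \<union> map_prod vec_of vec_of ` set f'"
    unfolding 4[symmetric] by (simp add: step_def)
  have "{m \<in> assoc (step a iw \<Gamma>). fst m \<in> vec_of ` fst ` set f'} = map_prod vec_of vec_of ` set f'"
  proof
    show "map_prod vec_of vec_of ` set f' \<subseteq> {m \<in> assoc (step a iw \<Gamma>). fst m \<in> vec_of ` fst ` set f'}"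
      unfolding asc by force
    show "{m \<in> assoc (step a iw \<Gamma>). fst m \<in> vec_of ` fst ` set f'} \<subseteq> map_prod vec_of vec_of ` set f'"
      unfolding asc using as vV' disj by fast
  qed
  moreover have "fst ` assoc (step a iw \<Gamma>) \<subseteq> verts (step a iw \<Gamma>)"
    unfolding asc verts using as vV' by force
  moreover have "M \<in> vec_of ` fst ` set f'" if "(M, b, j) \<in> moves iw (step a iw \<Gamma>)" for M b j
    using step_moves_new[OF that] unfolding 2 .
  ultimately show ?thesis
    unfolding tracks_def using wV' wf' fresh verts arr by simp
qed

lemma run_tracks:
  shows "run c n V f = Some W \<Longrightarrow> tracks \<Gamma> V f \<Longrightarrow>
      moves iw ((step a iw ^^ n) \<Gamma>) = {} \<and> verts ((step a iw ^^ n) \<Gamma>) = vec_of ` set W"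
proof (induction n arbitrary: V f \<Gamma>)
  case 0
  hence "frontier_moves f = []" "W = V @ map fst f" by (auto split: if_splits)
  thus ?case using tracks_moves[OF 0(2)] 0(2) by (simp add: tracks_def)
next
  case (Suc n)
  let ?V = "V @ map fst f" and ?f = "targets c (frontier_moves f)"
  have r: "list_all (\<lambda>(M, b). M \<notin> set ?V) ?f" "run c n ?V ?f = Some W"
    using Suc.prems(1) by (auto split: if_splits)
  have "set W \<inter> fst ` set g = {}" if "list_all (\<lambda>(M, b). M \<notin> set W) g" for W :: "int list list" and g :: "(int list \<times> int list) list"
    using that by (auto simp: list_all_iff)
  from this[OF r(1)] have "set ?V \<inter> fst ` set ?f = {}" .
  from Suc.IH[OF r(2) tracks_step[OF Suc.prems(2) refl refl this]]
  show ?case by (simp only: funpow_Suc_right o_apply)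
qed

lemma DG_final_run:
  assumes init: "initial_graph a iw i k = \<lparr>verts = {vec_of M}, arrows = {}, assoc = {(vec_of M, vec_of b)}\<rparr>"
    and len: "length M = 6" "length b = 6" and run: "run c r [] [(M, b)] = Some W"
  shows "stops_at a iw i k r" "verts (DG_final a iw i k) = vec_of ` set W"
proof -
  have "tracks (initial_graph a iw i k) [] [(M, b)]"
    unfolding init tracks_def using len by (auto simp: moves_def sinks_def)
  from run_tracks[OF run this]
  have r: "moves iw (DG a iw i k r) = {}" "verts (DG a iw i k r) = vec_of ` set W" by (simp_all add: DG_def)
  thus s: "stops_at a iw i k r" by (simp add: stops_at_def)
  show "verts (DG_final a iw i k) = vec_of ` set W" by (simp add: DG_final_eq[OF s] r)
qed

end

definition coeff_one :: "nat \<Rightarrow> int" where "coeff_one j = (if odd j then -3 else -1)"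
definition coeff_two :: "nat \<Rightarrow> int" where "coeff_two j = (if odd j then -1 else -3)"

fun run_yields :: "int list list \<Rightarrow> int list list option \<Rightarrow> bool" where
  "run_yields V None = False"
| "run_yields V (Some W) = (set V = set W)"

lemma run_one: "run_yields
    [[1, 0, 0, 0, 0, 0], [0, 3, -1, 0, 0, 0], [0, 2, 0, -1, 0, 0], [0, 1, 1, -2, 0, 0], [0, 1, 0, 1, -1, 0],
     [0, 0, 2, -3, 0, 0], [0, 1, 0, 0, 0, -1], [0, 0, 1, 0, -1, 0], [0, 0, 1, -1, 0, -1], [0, 0, 0, 3, -2, 0],
     [0, 0, 0, 2, -1, -1], [0, 0, 0, 1, 0, -2], [0, 0, 0, 0, 1, -3]]
    (run coeff_one 9 [] [([1, 0, 0, 0, 0, 0], [0, 0, 1, 3, 2, 3])])"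
  by code_simp

lemma run_two: "run_yields
    [[1, 0, 0, 0, 0, 0], [0, 1, -1, 0, 0, 0], [0, 0, 2, -1, 0, 0], [0, 0, 1, 0, -1, 0], [0, 0, 0, 1, -2, 0],
     [0, 0, 0, 0, 1, -1]]
    (run coeff_two 5 [] [([1, 0, 0, 0, 0, 0], [0, 0, 1, 1, 2, 1])])"
  by code_simp

section \<open>The minor as a function of the parameters\<close>

lemma regular_holomorphic:
  assumes "regular_on S f" and "\<And>z. z \<in> X \<Longrightarrow> A z \<in> S" and "\<And>g. g \<in> S \<Longrightarrow> invertible g"
    and A: "\<And>r s. (\<lambda>z. A z $ r $ s) holomorphic_on X"
  shows "(\<lambda>z. f (A z)) holomorphic_on X"
proof -
  obtain p k where p: "p \<in> poly_fun" "\<And>g. g \<in> S \<Longrightarrow> f g = p g / det g ^ k"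
    using assms(1) unfolding regular_on_def by blast
  have "(\<lambda>z. det (A z)) holomorphic_on X"
    unfolding det_def by (intro holomorphic_intros A)
  moreover have "det (A z) ^ k \<noteq> 0" if "z \<in> X" for z
    using assms(2)[OF that] assms(3) invertible_det_nz by auto
  ultimately have "(\<lambda>z. p (A z) / det (A z) ^ k) holomorphic_on X"
    by (intro holomorphic_intros poly_fun_holomorphic[OF p(1) A])
  thus ?thesis using p(2) assms(2) by (simp cong: holomorphic_cong)
qed

lemma mult_holomorphic:
  fixes A B :: "complex \<Rightarrow> 'n::finite cmat"
  assumes "\<And>r s. (\<lambda>z. A z $ r $ s) holomorphic_on X" "\<And>r s. (\<lambda>z. B z $ r $ s) holomorphic_on X"
  shows "(\<lambda>z. (A z ** B z) $ r $ s) holomorphic_on X"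
  unfolding matrix_matrix_mult_def by (simp, intro holomorphic_intros assms)

lemma laurent_monomial_holomorphic:
  assumes "\<And>l. l \<in> {1..N} \<Longrightarrow> t l \<noteq> 0"
  shows "(\<lambda>z. laurent_monomial N d (t(m := z))) holomorphic_on - {0}"
  unfolding laurent_monomial_def
proof (rule holomorphic_on_prod)
  fix l assume "l \<in> {1..N}"
  show "(\<lambda>z. (t(m := z)) l powi d l) holomorphic_on - {0}"
    by (cases "l = m") (auto intro!: holomorphic_intros)
qed

context chevalley_group begin

definition theta_product :: "nat list \<Rightarrow> nat list \<Rightarrow> (nat \<Rightarrow> complex) \<Rightarrow> 'n cmat" where
  "theta_product iw ls t = foldr (\<lambda>l X. xminus D (letter iw l) (t l) ** X) ls (mat 1)"

lemma theta_product_in_G: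
  assumes "\<And>l. l \<in> set ls \<Longrightarrow> letter iw l \<in> idx D \<and> t l \<noteq> 0"
  shows "theta_product iw ls t \<in> G"
  using assms
proof (induction ls)
  case (Cons l ls)
  have "xminus D (letter iw l) (t l) \<in> G"
    using Cons.prems[of l] by (simp add: xminus_phi phi_in_group det_mat2)
  thus ?case using Cons subgroup_GL(1)[OF sub_G] by (simp add: theta_product_def)
qed (use subgroup_GL(2)[OF sub_G] in \<open>simp add: theta_product_def\<close>)

lemma theta_product_holomorphic:
  assumes "\<And>l. l \<in> set ls \<Longrightarrow> letter iw l \<in> idx D \<and> t l \<noteq> 0"
  shows "(\<lambda>z. theta_product iw ls (t(m := z)) $ r $ s) holomorphic_on - {0}"
  using assms
proof (induction ls arbitrary: r s)
  case (Cons l ls)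
  have i: "letter iw l \<in> idx D" using Cons.prems by simp
  have "(\<lambda>z. xminus D (letter iw l) ((t(m := z)) l) $ r $ s) holomorphic_on - {0}" for r s
  proof (cases "l = m")
    case True
    have "(\<lambda>z. mat2 (inverse z) 0 1 z $ r $ s) holomorphic_on - {0}" for r s
      by (cases r rule: exhaust_2[THEN disjE]; cases s rule: exhaust_2[THEN disjE])
         (auto intro!: holomorphic_intros)
    hence hol: "(\<lambda>z. phi D (letter iw l) (mat2 (inverse z) 0 1 z) $ r $ s) holomorphic_on - {0}"
      by (intro phi_holomorphic i) (auto simp: det_mat2)
    have eq: "xminus D (letter iw l) ((t(m := z)) l) = phi D (letter iw l) (mat2 (inverse z) 0 1 z)"
      if "z \<in> - {0}" for z using that True i by (simp add: xminus_phi)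
    show ?thesis by (rule holomorphic_transform[OF hol]) (simp only: eq)
  qed simp
  from mult_holomorphic[OF this Cons.IH] Cons.prems show ?case by (simp add: theta_product_def)
qed (simp add: theta_product_def)

text \<open>
  Both sides are holomorphic in each nonzero parameter separately, so the restriction to
  positive values is removed one variable at a time.
\<close>

lemma extend_from_positive:
  assumes reg: "regular_on G \<Delta>" and iw: "set iw \<subseteq> idx D"
    and pos: "\<And>t. (\<And>l. t l > 0) \<Longrightarrow> \<Delta> (theta_minus D iw (\<lambda>l. of_real (t l))) =
       (\<Sum>(e, k)\<leftarrow>L. k * laurent_monomial (length iw) (vec_of e) (\<lambda>l. of_real (t l)))"
    and t: "\<And>l. l \<in> {1..length iw} \<Longrightarrow> t l \<noteq> 0"
  shows "\<Delta> (theta_minus D iw t) = (\<Sum>(e, k)\<leftarrow>L. k * laurent_monomial (length iw) (vec_of e) t)"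
proof -
  define N where "N = length iw"
  have theta: "theta_minus D iw t = theta_product iw [1..<Suc N] t" for t
    by (simp add: theta_minus_def theta_product_def N_def)
  have let_idx: "letter iw l \<in> idx D" if "l \<in> set [1..<Suc N]" for l
    using that iw by (auto simp: letter_def N_def)
  define c where "c t = (\<Sum>(e, k)\<leftarrow>L. k * laurent_monomial N (vec_of e) t)" for t
  have cong: "theta_product iw [1..<Suc N] t = theta_product iw [1..<Suc N] t'" "c t = c t'"
    if "\<And>l. l \<in> {1..N} \<Longrightarrow> t l = t' l" for t t'
  proof -
    show "theta_product iw [1..<Suc N] t = theta_product iw [1..<Suc N] t'"
      unfolding theta_product_def by (rule foldr_cong) (use that in auto)
    have "laurent_monomial N d t = laurent_monomial N d t'" for d
      unfolding laurent_monomial_def by (rule prod.cong) (use that in auto)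
    thus "c t = c t'" by (simp add: c_def)
  qed
  have "\<forall>t. (\<forall>l\<in>{1..N}. t l \<noteq> 0) \<and> (\<forall>l\<in>{1..N}. m < l \<longrightarrow> t l \<in> of_real ` {0<..}) \<longrightarrow>
      \<Delta> (theta_product iw [1..<Suc N] t) = c t" for m
  proof (induction m)
    case 0
    show ?case
    proof (intro allI impI)
      fix t :: "nat \<Rightarrow> complex"
      assume "(\<forall>l\<in>{1..N}. t l \<noteq> 0) \<and> (\<forall>l\<in>{1..N}. 0 < l \<longrightarrow> t l \<in> of_real ` {0<..})"
      hence "\<forall>l\<in>{1..N}. \<exists>x>0. t l = of_real x" by force
      then obtain x where x: "\<And>l. l \<in> {1..N} \<Longrightarrow> x l > 0 \<and> t l = of_real (x l)" by metis
      define x' where "x' l = (if l \<in> {1..N} then x l else 1)" for l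
      have tx: "t l = of_real (x' l)" if "l \<in> {1..N}" for l using x that by (simp add: x'_def)
      have c1: "theta_product iw [1..<Suc N] t = theta_product iw [1..<Suc N] (\<lambda>l. of_real (x' l))"
        "c t = c (\<lambda>l. of_real (x' l))"
        by (rule cong; use tx in simp)+
      have "x' l > 0" for l using x by (simp add: x'_def)
      from pos[of x', OF this] show "\<Delta> (theta_product iw [1..<Suc N] t) = c t"
        unfolding c1 by (simp only: c_def N_def theta[unfolded N_def])
    qed
  next
    case (Suc m)
    show ?case
    proof (intro allI impI)
      fix t :: "nat \<Rightarrow> complex"
      assume t: "(\<forall>l\<in>{1..N}. t l \<noteq> 0) \<and> (\<forall>l\<in>{1..N}. Suc m < l \<longrightarrow> t l \<in> of_real ` {0<..})"
      show "\<Delta> (theta_product iw [1..<Suc N] t) = c t"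
      proof (cases "Suc m \<in> {1..N}")
        case False
        hence "m < l \<Longrightarrow> l \<in> {1..N} \<Longrightarrow> Suc m < l" for l by (cases "l = Suc m") auto
        thus ?thesis using t Suc.IH by blast
      next
        case True
        define f where "f z = \<Delta> (theta_product iw [1..<Suc N] (t(Suc m := z))) - c (t(Suc m := z))" for z
        have "f (t (Suc m)) = 0"
        proof (rule holomorphic_zero_on_positive[of f])
          have "(\<lambda>z. \<Delta> (theta_product iw [1..<Suc N] (t(Suc m := z)))) holomorphic_on - {0}"
          proof (rule regular_holomorphic[OF reg])
            show "theta_product iw [1..<Suc N] (t(Suc m := z)) \<in> G" if "z \<in> - {0}" for z
              using that t let_idx by (intro theta_product_in_G) auto
            show "(\<lambda>z. theta_product iw [1..<Suc N] (t(Suc m := z)) $ r $ s) holomorphic_on - {0}" for r s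
              using t let_idx by (intro theta_product_holomorphic) auto
          qed (rule subgroup_GL(4)[OF sub_G])
          moreover have "(\<lambda>z. c (t(Suc m := z))) holomorphic_on - {0}"
          proof -
            have "(\<lambda>z. \<Sum>(e, k)\<leftarrow>K. k * laurent_monomial N (vec_of e) (t(Suc m := z))) holomorphic_on - {0}" for K
            proof (induction K)
              case (Cons ek K)
              show ?case
                unfolding list.map sum_list.Cons case_prod_unfold
                by (intro holomorphic_intros laurent_monomial_holomorphic Cons[unfolded case_prod_unfold]) (use t in auto)
            qed simp
            thus ?thesis by (simp add: c_def)
          qed
          ultimately show "f holomorphic_on - {0}" unfolding f_def by (intro holomorphic_intros)
          show "f (of_real x) = 0" if "x > 0" for x
          proof -
            have "\<forall>l\<in>{1..N}. (t(Suc m := of_real x)) l \<noteq> 0" using t that by auto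
            moreover have "\<forall>l\<in>{1..N}. m < l \<longrightarrow> (t(Suc m := of_real x)) l \<in> of_real ` {0<..}"
              using t that by auto
            ultimately have "\<Delta> (theta_product iw [1..<Suc N] (t(Suc m := of_real x))) = c (t(Suc m := of_real x))"
              using Suc.IH by blast
            thus ?thesis by (simp only: f_def diff_self)
          qed
          show "t (Suc m) \<noteq> 0" using t True by blast
        qed
        thus ?thesis by (simp only: f_def fun_upd_triv right_minus_eq)
      qed
    qed
  qed
  from this[of N] t have "\<Delta> (theta_product iw [1..<Suc N] t) = c t" by (auto simp: N_def)
  thus ?thesis by (simp add: theta c_def N_def)
qed

end

text \<open>
  If the last letter of the word is \<open>i\<close>, the last step of the recursion leaves the \<open>i\<close>-th
  character equal to the last parameter.
\<close>

definition chi :: "nat list \<Rightarrow> nat \<Rightarrow> (nat \<Rightarrow> real) \<Rightarrow> real" where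
  "chi iw i t = (if iw = [1, 2, 1, 2, 1, 2] then (if i = 1 then chi_one t else t 6)
                 else (if i = 1 then t 6 else chi_two t))"

lemma chi_pos: "(\<And>l. t l > 0) \<Longrightarrow> chi iw i t > 0"
  by (auto simp: chi_def chi_one_def chi_two_def intro!: add_pos_pos divide_pos_pos mult_pos_pos zero_less_power)

locale g2_chevalley = chevalley_group D for D :: "('n::finite) chevalley_data" +
  assumes type_G2: "idx D = {1, 2}" "cartan D 2 1 = -3" "cartan D 1 2 = -1"
begin

abbreviation "E i \<equiv> alg_of (gen_e D i)"
abbreviation "F i \<equiv> alg_of (gen_f D i)"
abbreviation "H i \<equiv> alg_of (gen_h D i)"

lemma idx: "1 \<in> idx D" "2 \<in> idx D" by (simp_all add: type_G2)

lemma cartan_values: "cartan D 1 1 = 2" "cartan D 2 2 = 2" "cartan D 2 1 = -3" "cartan D 1 2 = -1"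
  using cartan_diag idx type_G2 by auto

lemma weyl_elem_s_bar: "weyl_elem (E i) (F i) = alg_of (s_bar D i)"
  using alg_of_xplus[of D i "-1"] alg_of_yminus[of D i 1]
  by (simp add: weyl_elem_def s_bar_def alg_of_mult)

lemma alg_zero: "alg_of 0 = 0" by (rule matalg_eqI) simp

sublocale g2: g2_group "E 1" "E 2" "F 1" "F 2" "H 1" "H 2" "\<lambda>t. alg_of (xminus D 1 (of_real t))" "\<lambda>t. alg_of (xminus D 2 (of_real t))"
  "\<lambda>t. alg_of (tpow D 1 (of_real t))" "\<lambda>t. alg_of (tpow D 2 (of_real t))"
proof
  have rel: "bracket (gen_h D i) (gen_e D j) = cscale (of_real (of_int (cartan D i j))) (gen_e D j)"
    "bracket (gen_h D i) (gen_f D j) = cscale (of_real (- of_int (cartan D i j))) (gen_f D j)"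
    "bracket (gen_e D i) (gen_f D j) = (if i = j then gen_h D i else 0)"
    "i \<noteq> j \<Longrightarrow> (bracket (gen_e D i) ^^ nat (1 - cartan D i j)) (gen_e D j) = 0"
    "i \<noteq> j \<Longrightarrow> (bracket (gen_f D i) ^^ nat (1 - cartan D i j)) (gen_f D j) = 0"
    if "i \<in> {1, 2}" "j \<in> {1, 2}" for i j
    using chevalley_rel that unfolding chevalley_relations_def type_G2 by auto
  have h: "br (H i) (E j) = of_int (cartan D i j) *\<^sub>R E j" "br (H i) (F j) = - of_int (cartan D i j) *\<^sub>R F j"
    "br (E i) (F j) = (if i = j then H i else 0)" if "i \<in> {1, 2}" "j \<in> {1, 2}" for i j
    unfolding alg_of_bracket[symmetric] rel[OF that] alg_of_cscale by (simp_all add: alg_zero)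
  show "br (H 1) (E 1) = 2 *\<^sub>R E 1" "br (H 1) (E 2) = - E 2" "br (H 2) (E 1) = (-3) *\<^sub>R E 1" "br (H 2) (E 2) = 2 *\<^sub>R E 2"
    "br (H 1) (F 1) = (-2) *\<^sub>R F 1" "br (H 1) (F 2) = F 2" "br (H 2) (F 1) = 3 *\<^sub>R F 1" "br (H 2) (F 2) = (-2) *\<^sub>R F 2"
    "br (E 1) (F 1) = H 1" "br (E 1) (F 2) = 0" "br (E 2) (F 1) = 0" "br (E 2) (F 2) = H 2"
    using h[of 1 1] h[of 1 2] h[of 2 1] h[of 2 2] by (simp_all add: cartan_values[simplified])
  have it: "(h ^^ 2) X = h (h X)" "(h ^^ 4) X = h (h (h (h X)))" for h and X :: "'n cmat"
    by (simp_all add: eval_nat_numeral)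
  have "(bracket (gen_e D 1) ^^ 2) (gen_e D 2) = 0" "(bracket (gen_f D 1) ^^ 2) (gen_f D 2) = 0"
    using rel(4,5)[of 1 2] unfolding cartan_values(4) by simp_all
  thus "br (E 1) (br (E 1) (E 2)) = 0" "br (F 1) (br (F 1) (F 2)) = 0"
    unfolding it alg_of_bracket[symmetric] by (simp_all only: alg_zero)
  have "(bracket (gen_e D 2) ^^ 4) (gen_e D 1) = 0" "(bracket (gen_f D 2) ^^ 4) (gen_f D 1) = 0"
    using rel(4,5)[of 2 1] unfolding cartan_values(3) by simp_all
  thus "br (E 2) (br (E 2) (br (E 2) (br (E 2) (E 1)))) = 0" "br (F 2) (br (F 2) (br (F 2) (br (F 2) (F 1)))) = 0"
    unfolding it alg_of_bracket[symmetric] by (simp_all only: alg_zero)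
  have xm: "alg_of (xminus D i (of_real t)) = exp (t *\<^sub>R F i) * exp (- ln t *\<^sub>R H i)" if "i \<in> idx D" "t > 0" for i t
  proof -
    have "inverse (complex_of_real t) = of_real (exp (- ln t))" using that by (simp add: exp_minus)
    thus ?thesis unfolding xminus_def alg_of_mult alg_of_yminus by (simp only: tpow_exp[OF that(1)])
  qed
  show "t > 0 \<Longrightarrow> alg_of (xminus D 1 (of_real t)) = exp (t *\<^sub>R F 1) * exp (- ln t *\<^sub>R H 1)"
    "t > 0 \<Longrightarrow> alg_of (xminus D 2 (of_real t)) = exp (t *\<^sub>R F 2) * exp (- ln t *\<^sub>R H 2)" for t
    using xm idx by blast+
  have sl2: "exp (c *\<^sub>R E i) * alg_of (xminus D i (of_real t)) = weyl_elem (E i) (F i) * exp (- (1 / t + c) *\<^sub>R F i) * exp (t *\<^sub>R E i)"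
    if "i \<in> idx D" "t > 0" for i c t
  proof -
    have "xplus D i (of_real c) ** xminus D i (of_real t) =
        s_bar D i ** yminus D i (of_real (- (1 / t + c))) ** xplus D i (of_real t)"
      using xplus_xminus[OF that(1), of "of_real t" "of_real c"] that(2) by simp
    from arg_cong[OF this, of alg_of] show ?thesis
      unfolding alg_of_mult alg_of_xplus alg_of_yminus weyl_elem_s_bar .
  qed
  show "t > 0 \<Longrightarrow> exp (c *\<^sub>R E 1) * alg_of (xminus D 1 (of_real t)) = weyl_elem (E 1) (F 1) * exp (- (1 / t + c) *\<^sub>R F 1) * exp (t *\<^sub>R E 1)"
    "t > 0 \<Longrightarrow> exp (c *\<^sub>R E 2) * alg_of (xminus D 2 (of_real t)) = weyl_elem (E 2) (F 2) * exp (- (1 / t + c) *\<^sub>R F 2) * exp (t *\<^sub>R E 2)" for c t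
    using sl2 idx by blast+
  have tp: "weyl_elem (E i) (F i) * exp (- c *\<^sub>R F i) = exp ((1 / c) *\<^sub>R F i) * alg_of (tpow D i (of_real c)) * exp (- (1 / c) *\<^sub>R E i)"
    if "i \<in> idx D" "c > 0" for i c
  proof -
    have "s_bar D i ** yminus D i (of_real (- c)) =
        yminus D i (of_real (1 / c)) ** tpow D i (of_real c) ** xplus D i (of_real (- (1 / c)))"
      using s_bar_yminus[OF that(1), of "of_real c"] that(2) by simp
    from arg_cong[OF this, of alg_of] show ?thesis
      unfolding alg_of_mult alg_of_xplus alg_of_yminus weyl_elem_s_bar .
  qed
  show "c > 0 \<Longrightarrow> weyl_elem (E 1) (F 1) * exp (- c *\<^sub>R F 1) = exp ((1 / c) *\<^sub>R F 1) * alg_of (tpow D 1 (of_real c)) * exp (- (1 / c) *\<^sub>R E 1)"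
    "c > 0 \<Longrightarrow> weyl_elem (E 2) (F 2) * exp (- c *\<^sub>R F 2) = exp ((1 / c) *\<^sub>R F 2) * alg_of (tpow D 2 (of_real c)) * exp (- (1 / c) *\<^sub>R E 2)" for c
    using tp idx by blast+
qed

abbreviation "S_neg \<equiv> alg_of ` unip_op D"
abbreviation "S_pos \<equiv> alg_of ` unip D"

lemma unip_closed:
  "g \<in> S_neg \<Longrightarrow> h \<in> S_neg \<Longrightarrow> g * h \<in> S_neg" "exp (t *\<^sub>R F 1) \<in> S_neg" "exp (t *\<^sub>R F 2) \<in> S_neg"
  "g \<in> S_pos \<Longrightarrow> h \<in> S_pos \<Longrightarrow> g * h \<in> S_pos" "exp (t *\<^sub>R E 1) \<in> S_pos" "exp (t *\<^sub>R E 2) \<in> S_pos"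
proof -
  show "g \<in> S_neg \<Longrightarrow> h \<in> S_neg \<Longrightarrow> g * h \<in> S_neg" "g \<in> S_pos \<Longrightarrow> h \<in> S_pos \<Longrightarrow> g * h \<in> S_pos"
    using subgroup_GL(1)[OF sub_U(1)] subgroup_GL(1)[OF sub_U(2)] by (auto simp flip: alg_of_mult)
  have "yminus D i (of_real t) \<in> unip_op D" "xplus D i (of_real t) \<in> unip D" if "i \<in> idx D" for i
    using lie(1,2)[OF that] by (simp_all add: lie_algebra_def yminus_def xplus_def)
  thus "exp (t *\<^sub>R F 1) \<in> S_neg" "exp (t *\<^sub>R F 2) \<in> S_neg" "exp (t *\<^sub>R E 1) \<in> S_pos" "exp (t *\<^sub>R E 2) \<in> S_pos"
    using idx by (auto simp flip: alg_of_xplus alg_of_yminus)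
qed

text \<open>
  Here \<open>w\<close> is the representative of the longest element: the torus part of
  \<open>inverse w * \<theta> * s\<close> is \<open>c\<^sup>h\<close> with \<open>c\<close> the value of the character.
\<close>

lemma theta_big_cell:
  assumes iw: "iw = [1, 2, 1, 2, 1, 2] \<or> iw = [2, 1, 2, 1, 2, 1]" and i: "i \<in> {1, 2}" and t: "\<And>l. t l > 0"
  defines "w \<equiv> foldr (\<lambda>i X. s_bar D i ** X) iw (mat 1)"
  shows "\<exists>y\<in>unip_op D. \<exists>x\<in>unip D.
     theta_minus D iw (\<lambda>l. of_real (t l)) ** s_bar D i = w ** (y ** tpow D i (of_real (chi iw i t)) ** x)"
proof -
  let ?\<theta> = "theta_minus D iw (\<lambda>l. of_real (t l))"
  obtain y u where y: "y \<in> S_neg" "alg_of ?\<theta> = alg_of w * y * g2.pos.coord u"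
    and u: "(if i = 1 then fst (snd u) else fst u) = chi iw i t"
  proof -
    have a1: "alg_of (mat 1) = (1 :: 'n matalg)" by (rule matalg_eqI) simp
    show thesis
    proof (cases "iw = [1, 2, 1, 2, 1, 2]")
      case True
      have fac: "\<exists>y\<in>S_neg. alg_of (xminus D 1 (of_real (t 1))) * alg_of (xminus D 2 (of_real (t 2))) * alg_of (xminus D 1 (of_real (t 3))) * alg_of (xminus D 2 (of_real (t 4))) * alg_of (xminus D 1 (of_real (t 5))) * alg_of (xminus D 2 (of_real (t 6))) =
          weyl_elem (E 1) (F 1) * weyl_elem (E 2) (F 2) * weyl_elem (E 1) (F 1) * weyl_elem (E 2) (F 2) * weyl_elem (E 1) (F 1) * weyl_elem (E 2) (F 2) * y * g2.pos.coord (coord_one t)"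
        by (rule g2.factorization(1)) (intro unip_closed t | assumption)+
      have "\<exists>y\<in>S_neg. alg_of ?\<theta> = alg_of w * y * g2.pos.coord (coord_one t)"
        using fac
        by (simp add: True theta_minus_def letter_def w_def alg_of_mult weyl_elem_s_bar[simplified] a1 mult.assoc upt_rec
            eval_nat_numeral)
      moreover have "(if i = 1 then fst (snd (coord_one t)) else fst (coord_one t)) = chi iw i t"
        using coord_one[OF t] i by (auto simp: chi_def True)
      ultimately show thesis using that by blast
    next
      case False
      hence iw2: "iw = [2, 1, 2, 1, 2, 1]" using iw by simp
      have fac: "\<exists>y\<in>S_neg. alg_of (xminus D 2 (of_real (t 1))) * alg_of (xminus D 1 (of_real (t 2))) * alg_of (xminus D 2 (of_real (t 3))) * alg_of (xminus D 1 (of_real (t 4))) * alg_of (xminus D 2 (of_real (t 5))) * alg_of (xminus D 1 (of_real (t 6))) =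
          weyl_elem (E 2) (F 2) * weyl_elem (E 1) (F 1) * weyl_elem (E 2) (F 2) * weyl_elem (E 1) (F 1) * weyl_elem (E 2) (F 2) * weyl_elem (E 1) (F 1) * y * g2.pos.coord (coord_two t)"
        by (rule g2.factorization(2)) (intro unip_closed t | assumption)+
      have "\<exists>y\<in>S_neg. alg_of ?\<theta> = alg_of w * y * g2.pos.coord (coord_two t)"
        using fac
        by (simp add: iw2 theta_minus_def letter_def w_def alg_of_mult weyl_elem_s_bar[simplified] a1 mult.assoc upt_rec
            eval_nat_numeral)
      moreover have "(if i = 1 then fst (snd (coord_two t)) else fst (coord_two t)) = chi iw i t"
        using coord_two[OF t] i by (auto simp: chi_def iw2)
      ultimately show thesis using that by blast
    qed
  qed
  have "\<exists>y'\<in>S_neg. \<exists>x\<in>S_pos. y * g2.pos.coord u * alg_of (s_bar D i) = y' * alg_of (tpow D i (of_real (chi iw i t))) * x"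
  proof (cases "i = 1")
    case True
    hence u': "fst (snd u) = chi iw i t" using u by simp
    have cp: "fst (snd u) > 0" unfolding u' by (rule chi_pos[OF t])
    show ?thesis
      unfolding True weyl_elem_s_bar[symmetric] unfolding u'[unfolded True, symmetric]
      by (rule g2.coord_big_cell(1)) (intro unip_closed y(1) cp | assumption)+
  next
    case False
    hence i2: "i = 2" and u': "fst u = chi iw i t" using u i by auto
    have cp: "fst u > 0" unfolding u' by (rule chi_pos[OF t])
    show ?thesis
      unfolding i2 weyl_elem_s_bar[symmetric] unfolding u'[unfolded i2, symmetric]
      by (rule g2.coord_big_cell(2)) (intro unip_closed y(1) cp | assumption)+
  qed
  then obtain y' x where 1: "y' \<in> unip_op D" "x \<in> unip D"
    "y * g2.pos.coord u * alg_of (s_bar D i) = alg_of y' * alg_of (tpow D i (of_real (chi iw i t))) * alg_of x" by blast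
  have "alg_of (?\<theta> ** s_bar D i) = alg_of w * (y * g2.pos.coord u * alg_of (s_bar D i))"
    by (simp only: alg_of_mult y(2) mult.assoc)
  also have "\<dots> = alg_of (w ** (y' ** tpow D i (of_real (chi iw i t)) ** x))"
    by (simp only: 1(3) alg_of_mult)
  finally have "?\<theta> ** s_bar D i = w ** (y' ** tpow D i (of_real (chi iw i t)) ** x)"
    by (simp add: alg_of_inject)
  thus ?thesis using 1 by blast
qed

text \<open>
  The value lies in the translated big cell because the character is positive, hence nonzero, at
  positive parameters.
\<close>

lemma minor_on_positive:
  assumes w0: "longest_element D w0" and word: "reduced_word D iw w0"
    and iw: "iw = [1, 2, 1, 2, 1, 2] \<or> iw = [2, 1, 2, 1, 2, 1]"
    and rep: "canonical_representatives D rep" and i: "i \<in> idx D"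
    and minor: "generalized_minor D rep w0 (simple_reflection D i) i \<Delta>"
    and t: "\<And>l. t l > 0"
  shows "\<Delta> (theta_minus D iw (\<lambda>l. of_real (t l))) = of_real (chi iw i t)"
proof -
  let ?\<theta> = "theta_minus D iw (\<lambda>l. of_real (t l))" and ?c = "complex_of_real (chi iw i t)" and ?s = "s_bar D i"
  define w where "w = foldr (\<lambda>i X. s_bar D i ** X) iw (mat 1)"
  have i12: "i \<in> {1, 2}" using i type_G2 by simp
  have c: "?c \<noteq> 0" using chi_pos[of t iw i, OF t] by simp
  have wp: "word_prod D iw = w0" "set iw \<subseteq> idx D" "length iw = weyl_length D w0"
    using word by (auto simp: reduced_word_def)
  have "rep w0 = w"
    using rep_word_prod[OF rep, of iw] wp iw w0 by (auto simp: longest_element_def w_def)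
  have rs: "rep (simple_reflection D i) = ?s" using rep i by (auto simp: canonical_representatives_def)
  have sinv: "invertible ?s" using subgroup_GL(4)[OF sub_G s_bar_in_G[OF i]] .
  have wG: "foldr (\<lambda>i X. s_bar D i ** X) ws (mat 1) \<in> G" if "set ws \<subseteq> idx D" for ws
    using that by (induction ws) (auto intro: subgroup_GL(1,2)[OF sub_G] s_bar_in_G)
  have winv: "invertible w" using subgroup_GL(4)[OF sub_G wG[OF wp(2)]] by (simp add: w_def)
  have "\<exists>\<xi>. weight_character D (fundamental_weight i) \<xi> \<and>
    (\<forall>x\<in>(\<lambda>g. w ** g ** matrix_inv ?s) ` big_cell D. \<Delta> x = \<xi> (torus_part D (matrix_inv w ** x ** ?s)))"
    using conjunct2[OF minor[unfolded generalized_minor_def]] by (simp only: \<open>rep w0 = w\<close> rs)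
  then obtain \<xi> where \<xi>0: "weight_character D (fundamental_weight i) \<xi> \<and>
    (\<forall>x\<in>(\<lambda>g. w ** g ** matrix_inv ?s) ` big_cell D. \<Delta> x = \<xi> (torus_part D (matrix_inv w ** x ** ?s)))"
    by (rule exE)
  note \<xi> = conjunct1[OF \<xi>0] conjunct2[OF \<xi>0]
  obtain y x where yx: "y \<in> unip_op D" "x \<in> unip D" "?\<theta> ** ?s = w ** (y ** tpow D i ?c ** x)"
  proof -
    have "\<exists>y\<in>unip_op D. \<exists>x\<in>unip D. ?\<theta> ** ?s = w ** (y ** tpow D i ?c ** x)"
      unfolding w_def by (rule theta_big_cell[OF iw i12 t])
    thus thesis using that by (elim bexE)
  qed
  have T: "tpow D i ?c \<in> T" by (rule tpow_in_torus[OF i c])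
  have "?\<theta> = w ** (y ** tpow D i ?c ** x) ** matrix_inv ?s"
    unfolding yx(3)[symmetric] using sinv by (simp add: matrix_inv flip: matrix_mul_assoc)
  moreover have "y ** tpow D i ?c ** x \<in> big_cell D"
    unfolding big_cell_def using yx(1,2) T by (intro CollectI exI conjI) (rule refl)
  ultimately have "?\<theta> \<in> (\<lambda>g. w ** g ** matrix_inv ?s) ` big_cell D" by (rule image_eqI)
  with \<xi>(2) have "\<Delta> ?\<theta> = \<xi> (torus_part D (matrix_inv w ** ?\<theta> ** ?s))" by (rule bspec)
  also have "matrix_inv w ** ?\<theta> ** ?s = y ** tpow D i ?c ** x"
    using winv by (simp add: yx(3) matrix_cancel flip: matrix_mul_assoc)
  also have "torus_part D \<dots> = tpow D i ?c" by (rule torus_part[OF yx(1) T yx(2)])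
  also have "\<xi> \<dots> = ?c powi fundamental_weight i i"
    using \<xi>(1) i c by (simp add: weight_character_def)
  finally show ?thesis by (simp add: fundamental_weight_def)
qed

end

section \<open>Comparison of the two sets of monomials\<close>

definition terms_one :: "(int list \<times> complex) list" where
  "terms_one = [([1, 0, 0, 0, 0, 0], 1), ([0, 3, -1, 0, 0, 0], 1), ([0, 2, 0, -1, 0, 0], 3), ([0, 1, 1, -2, 0, 0], 3),
     ([0, 1, 0, 1, -1, 0], 3), ([0, 0, 2, -3, 0, 0], 1), ([0, 1, 0, 0, 0, -1], 3), ([0, 0, 1, 0, -1, 0], 2),
     ([0, 0, 1, -1, 0, -1], 3), ([0, 0, 0, 3, -2, 0], 1), ([0, 0, 0, 2, -1, -1], 3), ([0, 0, 0, 1, 0, -2], 3),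
     ([0, 0, 0, 0, 1, -3], 1)]"

definition terms_two :: "(int list \<times> complex) list" where
  "terms_two = [([1, 0, 0, 0, 0, 0], 1), ([0, 1, -1, 0, 0, 0], 1), ([0, 0, 2, -1, 0, 0], 1), ([0, 0, 1, 0, -1, 0], 2),
     ([0, 0, 0, 1, -2, 0], 1), ([0, 0, 0, 0, 1, -1], 1)]"

definition terms_last :: "(int list \<times> complex) list" where
  "terms_last = [([0, 0, 0, 0, 0, 1], 1)]"

definition chi_terms :: "nat list \<Rightarrow> nat \<Rightarrow> (int list \<times> complex) list" where
  "chi_terms iw i = (if iw = [1, 2, 1, 2, 1, 2] then (if i = 1 then terms_one else terms_last)
                     else (if i = 1 then terms_last else terms_two))"

lemma laurent_monomial_6:
  "laurent_monomial 6 (vec_of [d1, d2, d3, d4, d5, d6]) t =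
     t 1 powi d1 * t 2 powi d2 * t 3 powi d3 * t 4 powi d4 * t 5 powi d5 * t 6 powi d6"
proof -
  have "{1..6} = {1, 2, 3, 4, 5, 6 :: nat}" by auto
  thus ?thesis by (simp add: laurent_monomial_def vec_of_def)
qed

lemma chi_terms:
  assumes "\<And>l. t l > 0"
  shows "complex_of_real (chi iw i t) = (\<Sum>(e, k)\<leftarrow>chi_terms iw i. k * laurent_monomial 6 (vec_of e) (\<lambda>l. of_real (t l)))"
proof -
  have "complex_of_real (chi_one t) = (\<Sum>(e, k)\<leftarrow>terms_one. k * laurent_monomial 6 (vec_of e) (\<lambda>l. of_real (t l)))"
    by (simp add: chi_one_def terms_one_def laurent_monomial_6 power_int_minus divide_inverse mult_ac)
  moreover have "complex_of_real (chi_two t) = (\<Sum>(e, k)\<leftarrow>terms_two. k * laurent_monomial 6 (vec_of e) (\<lambda>l. of_real (t l)))"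
    by (simp add: chi_two_def terms_two_def laurent_monomial_6 power_int_minus divide_inverse mult_ac)
  moreover have "complex_of_real (t 6) = (\<Sum>(e, k)\<leftarrow>terms_last. k * laurent_monomial 6 (vec_of e) (\<lambda>l. of_real (t l)))"
    by (simp add: terms_last_def laurent_monomial_6)
  ultimately show ?thesis by (simp add: chi_def chi_terms_def)
qed

context g2_chevalley begin

lemma minor_monomials:
  assumes w0: "longest_element D w0" and word: "reduced_word D iw w0"
    and iw: "iw = [1, 2, 1, 2, 1, 2] \<or> iw = [2, 1, 2, 1, 2, 1]"
    and rep: "canonical_representatives D rep" and i: "i \<in> idx D"
    and minor: "generalized_minor D rep w0 (simple_reflection D i) i \<Delta>"
  shows "laurent_monomials 6 (\<lambda>t. \<Delta> (theta_minus D iw t)) = vec_of ` fst ` set (chi_terms iw i)"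
proof (rule laurent_monomials_list)
  show "distinct (map fst (chi_terms iw i))"
    by (simp add: chi_terms_def terms_one_def terms_two_def terms_last_def)
  show "\<forall>(e, k)\<in>set (chi_terms iw i). length e = 6 \<and> k \<noteq> 0"
    by (simp add: chi_terms_def terms_one_def terms_two_def terms_last_def)
  have len: "length iw = 6" and idx_iw: "set iw \<subseteq> idx D" using iw by (auto simp: type_G2)
  have reg: "regular_on G \<Delta>" using minor by (simp add: generalized_minor_def)
  fix t :: "nat \<Rightarrow> complex" assume t: "\<forall>l\<in>{1..6}. t l \<noteq> 0"
  show "\<Delta> (theta_minus D iw t) = (\<Sum>(e, k)\<leftarrow>chi_terms iw i. k * laurent_monomial 6 (vec_of e) t)"
    unfolding len[symmetric]
  proof (rule extend_from_positive[OF reg idx_iw])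
    show "\<Delta> (theta_minus D iw (\<lambda>l. of_real (t l))) =
        (\<Sum>(e, k)\<leftarrow>chi_terms iw i. k * laurent_monomial (length iw) (vec_of e) (\<lambda>l. of_real (t l)))"
      if "\<And>l. t l > 0" for t
      unfolding len minor_on_positive[OF w0 word iw rep i minor that] by (rule chi_terms[OF that])
  qed (use t len in auto)
qed

lemmas reflect_simps = reflect_word_def reflect_def simple_root_def fundamental_weight_def letter_def
  cartan_values cartan_values[simplified]

lemma position_one:
  assumes "iw = [1, 2, 1, 2, 1, 2]" "k \<in> {1..6}" "i \<in> {1, 2}"
    and "\<forall>j\<in>{1, 2}. reflect_word (cartan D) (rev (drop k iw)) (simple_root (cartan D) (letter iw k)) j
           = simple_root (cartan D) i j"
  shows "k = (if i = 1 then 1 else 6)"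
proof -
  have "k = 1 \<or> k = 2 \<or> k = 3 \<or> k = 4 \<or> k = 5 \<or> k = 6" using assms(2) by auto
  thus ?thesis
    using assms(3,4) by (elim disjE insertE emptyE) (simp_all add: assms(1) reflect_simps)
qed

lemma position_two:
  assumes "iw = [2, 1, 2, 1, 2, 1]" "k \<in> {1..6}" "i \<in> {1, 2}"
    and "\<forall>j\<in>{1, 2}. reflect_word (cartan D) (rev (drop k iw)) (simple_root (cartan D) (letter iw k)) j
           = simple_root (cartan D) i j"
  shows "k = (if i = 1 then 6 else 1)"
proof -
  have "k = 1 \<or> k = 2 \<or> k = 3 \<or> k = 4 \<or> k = 5 \<or> k = 6" using assms(2) by auto
  thus ?thesis
    using assms(3,4) by (elim disjE insertE emptyE) (simp_all add: assms(1) reflect_simps)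
qed

lemma nat_cases_6:
  assumes "P 0" "P 1" "P 2" "P 3" "P 4" "P 5" "P 6" "\<And>l. l > 6 \<Longrightarrow> P (l :: nat)"
  shows "P l"
proof -
  have "l = 0 \<or> l = 1 \<or> l = 2 \<or> l = 3 \<or> l = 4 \<or> l = 5 \<or> l = 6 \<or> l > 6" by linarith
  thus ?thesis using assms by blast
qed

lemma initial_graph_vec:
  assumes "(\<lambda>l. if l = k then 1 else 0) = vec_of M" "initial_b a iw i k = vec_of b"
  shows "initial_graph a iw i k = \<lparr>verts = {vec_of M}, arrows = {}, assoc = {(vec_of M, vec_of b)}\<rparr>"
  unfolding initial_graph_def Let_def assms ..

lemma initial_monomial:
  "(\<lambda>l. if l = 1 then 1 else 0) = vec_of [1, 0, 0, 0, 0, 0]" "(\<lambda>l. if l = 6 then 1 else 0) = vec_of [0, 0, 0, 0, 0, 1]"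
  by (rule ext, rule nat_cases_6, simp_all add: vec_of_def)+

lemma initial_b_one:
  "initial_b (cartan D) [1, 2, 1, 2, 1, 2] 1 1 = vec_of [0, 0, 1, 3, 2, 3]"
  "initial_b (cartan D) [1, 2, 1, 2, 1, 2] 2 6 = vec_of [0, 1, 1, 2, 1, 0]"
  by (rule ext, rule nat_cases_6, simp_all add: vec_of_def initial_b_def reflect_simps)+

lemma initial_b_two:
  "initial_b (cartan D) [2, 1, 2, 1, 2, 1] 2 1 = vec_of [0, 0, 1, 1, 2, 1]"
  "initial_b (cartan D) [2, 1, 2, 1, 2, 1] 1 6 = vec_of [0, 1, 3, 2, 3, 0]"
  by (rule ext, rule nat_cases_6, simp_all add: vec_of_def initial_b_def reflect_simps)+

lemma run_yields_Some: "run_yields V r \<Longrightarrow> \<exists>W. r = Some W \<and> set V = set W"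
  by (cases r) auto

lemma algorithm:
  assumes iw: "iw = [1, 2, 1, 2, 1, 2] \<or> iw = [2, 1, 2, 1, 2, 1]" and i: "i \<in> {1, 2}" and k: "k \<in> {1..6}"
    "\<forall>j\<in>{1, 2}. reflect_word (cartan D) (rev (drop k iw)) (simple_root (cartan D) (letter iw k)) j
        = simple_root (cartan D) i j"
  shows "(\<exists>r. stops_at (cartan D) iw i k r) \<and> verts (DG_final (cartan D) iw i k) = vec_of ` fst ` set (chi_terms iw i)"
proof -
  define c where "c = (if iw = [1, 2, 1, 2, 1, 2] then coeff_one else coeff_two)"
  have c: "c j = cartan D (letter iw (j + 1)) (letter iw j)" if "j \<in> {1, 2, 3, 4}" for j
    using iw that by (elim disjE insertE emptyE)
      (simp_all add: c_def coeff_one_def coeff_two_def letter_def cartan_values cartan_values[simplified])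
  have iw': "iw = [1, 2, 1, 2, 1, 2] \<and> (1::nat) \<noteq> 2 \<or> iw = [2, 1, 2, 1, 2, 1] \<and> (2::nat) \<noteq> 1" using iw by simp
  have final: "(\<exists>r. stops_at (cartan D) iw i k r) \<and> verts (DG_final (cartan D) iw i k) = vec_of ` set V"
    if init: "initial_graph (cartan D) iw i k = \<lparr>verts = {vec_of M}, arrows = {}, assoc = {(vec_of M, vec_of b)}\<rparr>"
      "length M = 6" "length b = 6" "run_yields V (run c r [] [(M, b)])" for M b V r
  proof -
    obtain W where W: "run c r [] [(M, b)] = Some W" "set V = set W" using run_yields_Some[OF init(4)] by blast
    show ?thesis
      using iw'
    proof
      assume "iw = [1, 2, 1, 2, 1, 2] \<and> (1::nat) \<noteq> 2"
      hence "iw = [1, 2, 1, 2, 1, 2]" "(1::nat) \<noteq> 2" by simp_all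
      from DG_final_run[OF this c init(1-3) W(1)] show ?thesis unfolding W(2) by blast
    next
      assume "iw = [2, 1, 2, 1, 2, 1] \<and> (2::nat) \<noteq> 1"
      hence "iw = [2, 1, 2, 1, 2, 1]" "(2::nat) \<noteq> 1" by simp_all
      from DG_final_run[OF this c init(1-3) W(1)] show ?thesis unfolding W(2) by blast
    qed
  qed
  have last: "run_yields [[0, 0, 0, 0, 0, 1]] (run c 0 [] [([0, 0, 0, 0, 0, 1], [0, b2, b3, b4, b5, 0])])" for b2 b3 b4 b5
    by (simp add: list_move_def)
  show ?thesis
  proof (cases "iw = [1, 2, 1, 2, 1, 2]")
    case True
    have k': "k = (if i = 1 then 1 else 6)" by (rule position_one[OF True k(1) i k(2)])
    show ?thesis
    proof (cases "i = 1")
      case i1: True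
      have "initial_graph (cartan D) iw i k = \<lparr>verts = {vec_of [1, 0, 0, 0, 0, 0]}, arrows = {},
          assoc = {(vec_of [1, 0, 0, 0, 0, 0], vec_of [0, 0, 1, 3, 2, 3])}\<rparr>"
        using k' i1 initial_monomial(1) initial_b_one(1) unfolding True by (intro initial_graph_vec) simp_all
      moreover have "c = coeff_one" by (simp add: c_def True)
      ultimately show ?thesis
        using final[OF _ _ _ run_one[folded \<open>c = coeff_one\<close>]] i1 by (simp add: chi_terms_def terms_one_def True)
    next
      case i2: False
      hence "i = 2" using i by simp
      hence "initial_graph (cartan D) iw i k = \<lparr>verts = {vec_of [0, 0, 0, 0, 0, 1]}, arrows = {},
          assoc = {(vec_of [0, 0, 0, 0, 0, 1], vec_of [0, 1, 1, 2, 1, 0])}\<rparr>"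
        using k' initial_monomial(2) initial_b_one(2) unfolding True by (intro initial_graph_vec) simp_all
      thus ?thesis using final[OF _ _ _ last] i2 by (simp add: chi_terms_def terms_last_def True)
    qed
  next
    case False
    hence iw2: "iw = [2, 1, 2, 1, 2, 1]" using iw by simp
    have k': "k = (if i = 1 then 6 else 1)" by (rule position_two[OF iw2 k(1) i k(2)])
    show ?thesis
    proof (cases "i = 1")
      case i1: True
      hence "initial_graph (cartan D) iw i k = \<lparr>verts = {vec_of [0, 0, 0, 0, 0, 1]}, arrows = {},
          assoc = {(vec_of [0, 0, 0, 0, 0, 1], vec_of [0, 1, 3, 2, 3, 0])}\<rparr>"
        using k' initial_monomial(2) initial_b_two(2) unfolding iw2 by (intro initial_graph_vec) simp_all
      thus ?thesis using final[OF _ _ _ last] i1 by (simp add: chi_terms_def terms_last_def iw2)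
    next
      case i2: False
      hence "i = 2" using i by simp
      hence "initial_graph (cartan D) iw i k = \<lparr>verts = {vec_of [1, 0, 0, 0, 0, 0]}, arrows = {},
          assoc = {(vec_of [1, 0, 0, 0, 0, 0], vec_of [0, 0, 1, 1, 2, 1])}\<rparr>"
        using k' initial_monomial(1) initial_b_two(1) unfolding iw2 by (intro initial_graph_vec) simp_all
      moreover have "c = coeff_two" by (simp add: c_def iw2)
      ultimately show ?thesis
        using final[OF _ _ _ run_two[folded \<open>c = coeff_two\<close>]] i2 by (simp add: chi_terms_def terms_two_def iw2)
    qed
  qed
qed

end

theorem mainTheorem2:
  fixes D :: "('n::finite) chevalley_data"
    and w0 :: "'n cmat set"
    and rep :: "'n cmat set \<Rightarrow> 'n cmat"
    and iw :: "nat list"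
    and i k N :: nat
    and \<Delta> :: "'n cmat \<Rightarrow> complex"
  assumes group: "simply_connected_simple_group D"
    and type_G2: "idx D = {1, 2}" "cartan D 2 1 = -3" "cartan D 1 2 = -1"
    and w0: "longest_element D w0"
    and N: "N = weyl_length D w0"
    and word: "reduced_word D iw w0"
    and word_cases: "iw = [1,2,1,2,1,2] \<or> iw = [2,1,2,1,2,1]"
    and rep: "canonical_representatives D rep"
    and i: "i \<in> idx D"
    and minor: "generalized_minor D rep w0 (simple_reflection D i) i \<Delta>"
    and k: "k \<in> {1..N}"
      "\<forall>j\<in>idx D. reflect_word (cartan D) (rev (drop k iw)) (simple_root (cartan D) (letter iw k)) j
                  = simple_root (cartan D) i j"
  shows "(\<exists>r. stops_at (cartan D) iw i k r) \<and>
    laurent_monomials N (\<lambda>t. \<Delta> (theta_minus D iw t)) = verts (DG_final (cartan D) iw i k)"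
proof -
  interpret g2_chevalley D by unfold_locales (fact group type_G2)+
  have N6: "N = 6" using N word word_cases by (auto simp: reduced_word_def)
  show ?thesis
    unfolding N6 minor_monomials[OF w0 word word_cases rep i minor]
    using algorithm[OF word_cases i[unfolded type_G2(1)] k(1)[unfolded N6] k(2)[unfolded type_G2(1)]] by simp
qed

end
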